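(* Let $n\ge 2$, $\beta\in(0,1)$, and let $\Omega$ be a uniformly $C^{1+\beta}$ domain in $\mathbf{R}^n$ with boundary $\Gamma$. Let $\mu,\nu,\delta\in(0,\infty]$. Then there is a constant $C=C(\mu,\nu,\delta,\Omega)$ such that $$\| v\cdot\mathbf{n} \|_{L^\infty(\Gamma)} \le C \left( \| v \|_{BMO^{\mu,\nu}_b(\Omega)} + \|\operatorname{div} v \|_{L^n_{\mathrm{ul}}(\Gamma_\delta)} \right)$$ for all vector fields $v \in BMO^{\mu,\nu}_b(\Omega)$ with $\operatorname{div} v\in L^n_{\mathrm{ul}}(\Gamma_\delta)$, where $v\cdot\mathbf{n}$ is the normal trace of $v$ on $\Gamma$.
   Context: For a domain $\Omega\subset\mathbf{R}^n$ with boundary $\Gamma=\partial\Omega$: $d_\Omega(x)=\inf_{y\in\Gamma}|x-y|$; $\Gamma_\delta=\{x\in\Omega : d_\Omega(x)<\delta\}$ for $0<\delta<\infty$, and $\Gamma_\infty=\Omega$; $\mathbf{n}$ is the exterior unit normal on $\Gamma$; $B_r(x)$ is the closed ball of radius $r$ centered at $x$; $f_B=\frac1{|B|}\int_B f\,dy$. Uniformly $C^{1+\beta}$ domain: there exist $r_*,\delta_*,L>0$ such that for each $z_0\in\Gamma$, up to translation and rotation (placing $z_0$ at the origin), there is $h_{z_0}\in C^{1+\beta}(B_{r_*}(0'))$, $B_{r_*}(0')\subset\mathbf{R}^{n-1}$, with $|\nabla^k h_{z_0}|\le L$ for $k=0,1$, $[\nabla h_{z_0}]_{C^\beta(B_{r_*}(0'))}\le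 L$, $\nabla' h_{z_0}(0')=0'$, $h_{z_0}(0')=0$, such that the neighborhood $U=\{(x',x_n): h_{z_0}(x')-\delta_*<x_n<h_{z_0}(x')+\delta_*,\ |x'|<r_*\}$ satisfies $\Omega\cap U=\{(x',x_n): h_{z_0}(x')<x_n<h_{z_0}(x')+\delta_*,\ |x'|<r_*\}$ and $\partial\Omega\cap U=\{(x',x_n): x_n=h_{z_0}(x'),\ |x'|<r_*\}$. For $f\in L^1_{\mathrm{loc}}(\Omega)$ and $\mu,\nu\in(0,\infty]$: $$[f]_{BMO^\mu}=\sup\Big\{\tfrac1{|B_r(x)|}\int_{B_r(x)}|f-f_{B_r(x)}|\,dy : B_r(x)\subset\Omega,\ r<\mu\Big\},$$ $$[f]_{b^\nu}=\sup\Big\{r^{-n}\int_{\Omega\cap B_r(x)}|f|\,dy : x\in\Gamma,\ 0<r<\nu\Big\}.$$ $BMO^{\mu,\nu}_b(\Omega)$ is the space of $f\in L^1_{\mathrm{loc}}(\Omega)$ with finite norm $\|f\|_{BMO^{\mu,\nu}_b}=[f]_{BMO^\mu}+[f]_{b^\nu}$; for vector fields these quantities are taken componentwise. For a fixed $r_0>0$ (different choices give equivalent norms) and an open set $D\subset\mathbf{R}^n$, $L^n_{\mathrm{ul}}(D)$ is the space of $f\in L^n_{\mathrm{loc}}(D)$ with $\|f\|_{L^n_{\mathrm{ul}}(D)}=\sup_{x\in\mathbf{R}^n}\|f\|_{L^n(B_{r_0}(x)\cap D)}<\infty$. Normal trace: $v\cdot\mathbf{n}$ on $\Gamma$ is understood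 in the weak sense through integration by parts, i.e. $\int_\Gamma (v\cdot\mathbf{n})\varphi\,d\mathcal{H}^{n-1}=\int_\Omega(\operatorname{div}v)\varphi\,dx+\int_\Omega v\cdot\nabla\varphi\,dx$ for all $\varphi\in C^1_c(\mathbf{R}^n)$ vanishing on $\Omega\setminus\Gamma_{\delta'}$ for some $\delta'<\delta$, where $\operatorname{div} v$ is the distributional divergence. *)

theory Defs
  imports "HOL-Analysis.Analysis" "HOL-Probability.Essential_Supremum"
begin

section \<open>Domains of class $C^{1+\beta}$\<close>

text \<open>
  The local coordinates at a boundary point \<open>z\<close> are given by a unit vector \<open>e\<close>, the image of the
  \<open>x\<^sub>n\<close>-direction under the rotation: \<open>z + y + t *\<^sub>R e\<close> with \<open>y \<bullet> e = 0\<close> is the point with coordinates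
  \<open>x' = y\<close>, \<open>x\<^sub>n = t\<close>. So the hyperplane orthogonal to \<open>e\<close> plays the role of the \<open>(n - 1)\<close>-dimensional
  space of the \<open>x'\<close>; the values of \<open>h\<close> outside \<open>hyper_disc e r\<close> are irrelevant.
\<close>

definition hyper_disc :: "real ^ 'n \<Rightarrow> real \<Rightarrow> (real ^ 'n) set" where
  "hyper_disc e r = {y. y \<bullet> e = 0 \<and> norm y \<le> r}"

text \<open>
  \<open>G\<close> is the gradient of \<open>h\<close> in the hyperplane (one-sided at the rim of the closed disc). The Hoelder
  bound on \<open>G\<close> makes \<open>h\<close> a \<open>C\<^sup>1\<^sup>+\<^sup>\<beta>\<close> function on the disc.
\<close>

definition C1_Hoelder_graph_function ::
    "real \<Rightarrow> real \<Rightarrow> real \<Rightarrow> real ^ 'n \<Rightarrow> (real ^ 'n \<Rightarrow> real) \<Rightarrow> bool" where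
  "C1_Hoelder_graph_function \<beta> r L e h \<longleftrightarrow>
     (\<exists>G :: real ^ 'n \<Rightarrow> real ^ 'n.
        (\<forall>y \<in> hyper_disc e r.
           G y \<bullet> e = 0 \<and>
           (h has_derivative (\<lambda>k. G y \<bullet> k)) (at y within hyper_disc e r) \<and>
           \<bar>h y\<bar> \<le> L \<and> norm (G y) \<le> L) \<and>
        (\<forall>y \<in> hyper_disc e r. \<forall>y' \<in> hyper_disc e r.
           norm (G y - G y') \<le> L * norm (y - y') powr \<beta>) \<and>
        h 0 = 0 \<and> G 0 = 0)"

definition graph_slab ::
    "real ^ 'n \<Rightarrow> real ^ 'n \<Rightarrow> real \<Rightarrow> (real ^ 'n \<Rightarrow> real \<Rightarrow> bool) \<Rightarrow> (real ^ 'n) set" where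
  "graph_slab z e r P = {z + y + t *\<^sub>R e | y t. y \<bullet> e = 0 \<and> norm y < r \<and> P y t}"

definition uniformly_C1_Hoelder_domain :: "real \<Rightarrow> (real ^ 'n) set \<Rightarrow> bool" where
  "uniformly_C1_Hoelder_domain \<beta> \<Omega> \<longleftrightarrow>
     open \<Omega> \<and> connected \<Omega> \<and> \<Omega> \<noteq> {} \<and>
     (\<exists>r d L. r > 0 \<and> d > 0 \<and> L > 0 \<and>
       (\<forall>z \<in> frontier \<Omega>. \<exists>e h.
          norm e = 1 \<and> C1_Hoelder_graph_function \<beta> r L e h \<and>
          (let U = graph_slab z e r (\<lambda>y t. h y - d < t \<and> t < h y + d) in
             \<Omega> \<inter> U = graph_slab z e r (\<lambda>y t. h y < t \<and> t < h y + d) \<and>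
             frontier \<Omega> \<inter> U = graph_slab z e r (\<lambda>y t. t = h y))))"

definition bdry_dist :: "(real ^ 'n) set \<Rightarrow> real ^ 'n \<Rightarrow> ennreal" where
  "bdry_dist \<Omega> x = (INF y \<in> frontier \<Omega>. ennreal (dist x y))"

text \<open>The case distinction only matters if the boundary is empty.\<close>

definition bdry_layer :: "(real ^ 'n) set \<Rightarrow> ennreal \<Rightarrow> (real ^ 'n) set" where
  "bdry_layer \<Omega> \<delta> = (if \<delta> = \<infinity> then \<Omega> else {x \<in> \<Omega>. bdry_dist \<Omega> x < \<delta>})"


section \<open>Surface measure\<close>

text \<open>
  Hausdorff measure, normalised so that it agrees with Lebesgue measure on \<open>s\<close>-dimensional
  subspaces. \<open>diameter\<close> is only meaningful for bounded sets; the empty set has to contribute \<open>0\<close>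
  also for \<open>s = 0\<close>.
\<close>

definition hausdorff_weight :: "nat \<Rightarrow> 'a::metric_space set \<Rightarrow> ennreal" where
  "hausdorff_weight s A =
     (if A = {} then 0 else ennreal (unit_ball_vol (real s) * (diameter A / 2) ^ s))"

definition hausdorff_outer :: "nat \<Rightarrow> 'a::metric_space set \<Rightarrow> ennreal" where
  "hausdorff_outer s A =
     (SUP \<epsilon> \<in> {0<..}.
        INF C \<in> {C :: nat \<Rightarrow> 'a set. A \<subseteq> (\<Union>i. C i) \<and> (\<forall>i. bounded (C i) \<and> diameter (C i) \<le> \<epsilon>)}.
          \<Sum>i. hausdorff_weight s (C i))"

text \<open>
  \<open>hausdorff_outer s\<close> is a metric outer measure, hence countably additive on the Borel sets, so that
  \<open>measure_of\<close> does not fall back to the null measure.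
\<close>

definition hausdorff_measure :: "nat \<Rightarrow> 'a::metric_space measure" where
  "hausdorff_measure s = measure_of UNIV (sets borel) (hausdorff_outer s)"

definition surface_measure :: "(real ^ 'n) set \<Rightarrow> (real ^ 'n) measure" where
  "surface_measure \<Omega> = restrict_space (hausdorff_measure (CARD('n) - 1)) (frontier \<Omega>)"


section \<open>Function spaces\<close>

definition L1_loc :: "(real ^ 'n) set \<Rightarrow> (real ^ 'n \<Rightarrow> real) \<Rightarrow> bool" where
  "L1_loc \<Omega> f \<longleftrightarrow> (\<forall>K. compact K \<and> K \<subseteq> \<Omega> \<longrightarrow> f absolutely_integrable_on K)"

definition set_mean :: "(real ^ 'n) set \<Rightarrow> (real ^ 'n \<Rightarrow> real) \<Rightarrow> real" where
  "set_mean B f = (LINT y:B|lebesgue. f y) / measure lebesgue B"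

definition BMO_seminorm :: "(real ^ 'n) set \<Rightarrow> ennreal \<Rightarrow> (real ^ 'n \<Rightarrow> real) \<Rightarrow> ennreal" where
  "BMO_seminorm \<Omega> \<mu> f =
     (SUP (x, r) \<in> {(x, r). 0 < r \<and> ennreal r < \<mu> \<and> cball x r \<subseteq> \<Omega>}.
        ennreal (set_mean (cball x r) (\<lambda>y. \<bar>f y - set_mean (cball x r) f\<bar>)))"

definition b_seminorm :: "(real ^ 'n) set \<Rightarrow> ennreal \<Rightarrow> (real ^ 'n \<Rightarrow> real) \<Rightarrow> ennreal" where
  "b_seminorm \<Omega> \<nu> f =
     (SUP (x, r) \<in> {(x, r). x \<in> frontier \<Omega> \<and> 0 < r \<and> ennreal r < \<nu>}.
        ennreal (1 / r ^ CARD('n)) * (\<integral>\<^sup>+y \<in> \<Omega> \<inter> cball x r. ennreal \<bar>f y\<bar> \<partial>lebesgue))"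

definition BMO_b_norm ::
    "(real ^ 'n) set \<Rightarrow> ennreal \<Rightarrow> ennreal \<Rightarrow> (real ^ 'n \<Rightarrow> real) \<Rightarrow> ennreal" where
  "BMO_b_norm \<Omega> \<mu> \<nu> f = BMO_seminorm \<Omega> \<mu> f + b_seminorm \<Omega> \<nu> f"

definition BMO_b :: "(real ^ 'n) set \<Rightarrow> ennreal \<Rightarrow> ennreal \<Rightarrow> (real ^ 'n \<Rightarrow> real) set" where
  "BMO_b \<Omega> \<mu> \<nu> = {f. L1_loc \<Omega> f \<and> BMO_b_norm \<Omega> \<mu> \<nu> f < \<infinity>}"

definition BMO_b_vec ::
    "(real ^ 'n) set \<Rightarrow> ennreal \<Rightarrow> ennreal \<Rightarrow> (real ^ 'n \<Rightarrow> real ^ 'n) set" where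
  "BMO_b_vec \<Omega> \<mu> \<nu> = {v. \<forall>i. (\<lambda>x. v x $ i) \<in> BMO_b \<Omega> \<mu> \<nu>}"

definition BMO_b_vec_norm ::
    "(real ^ 'n) set \<Rightarrow> ennreal \<Rightarrow> ennreal \<Rightarrow> (real ^ 'n \<Rightarrow> real ^ 'n) \<Rightarrow> ennreal" where
  "BMO_b_vec_norm \<Omega> \<mu> \<nu> v = (\<Sum>i\<in>UNIV. BMO_b_norm \<Omega> \<mu> \<nu> (\<lambda>x. v x $ i))"

definition ennreal_root :: "nat \<Rightarrow> ennreal \<Rightarrow> ennreal" where
  "ennreal_root p a = (if a = \<infinity> then \<infinity> else ennreal (root p (enn2real a)))"

definition Lp_norm :: "nat \<Rightarrow> (real ^ 'n) set \<Rightarrow> (real ^ 'n \<Rightarrow> real) \<Rightarrow> ennreal" where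
  "Lp_norm p D f = ennreal_root p (\<integral>\<^sup>+x \<in> D. ennreal (\<bar>f x\<bar> ^ p) \<partial>lebesgue)"

definition Lp_loc :: "nat \<Rightarrow> (real ^ 'n) set \<Rightarrow> (real ^ 'n \<Rightarrow> real) \<Rightarrow> bool" where
  "Lp_loc p D f \<longleftrightarrow> f \<in> borel_measurable (lebesgue_on D) \<and>
     (\<forall>K. compact K \<and> K \<subseteq> D \<longrightarrow> Lp_norm p K f < \<infinity>)"

definition Lp_ul_norm :: "nat \<Rightarrow> real \<Rightarrow> (real ^ 'n) set \<Rightarrow> (real ^ 'n \<Rightarrow> real) \<Rightarrow> ennreal" where
  "Lp_ul_norm p r\<^sub>0 D f = (SUP x. Lp_norm p (cball x r\<^sub>0 \<inter> D) f)"

definition Lp_ul :: "nat \<Rightarrow> real \<Rightarrow> (real ^ 'n) set \<Rightarrow> (real ^ 'n \<Rightarrow> real) set" where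
  "Lp_ul p r\<^sub>0 D = {f. Lp_loc p D f \<and> Lp_ul_norm p r\<^sub>0 D f < \<infinity>}"


section \<open>Divergence and normal trace\<close>

definition grad :: "(real ^ 'n \<Rightarrow> real) \<Rightarrow> real ^ 'n \<Rightarrow> real ^ 'n" where
  "grad f x = (THE D. GDERIV f x :> D)"

primrec Ck :: "nat \<Rightarrow> (real ^ 'n \<Rightarrow> real) \<Rightarrow> bool" where
  "Ck 0 f \<longleftrightarrow> continuous_on UNIV f"
| "Ck (Suc k) f \<longleftrightarrow> (\<forall>x. \<exists>D. GDERIV f x :> D) \<and> (\<forall>i. Ck k (\<lambda>x. grad f x $ i))"

definition fun_support :: "(real ^ 'n \<Rightarrow> real) \<Rightarrow> (real ^ 'n) set" where
  "fun_support f = closure {x. f x \<noteq> 0}"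

text \<open>\<open>w\<close> is the distributional divergence of \<open>v\<close> in the open set \<open>D\<close>.\<close>

definition distributional_div ::
    "(real ^ 'n) set \<Rightarrow> (real ^ 'n \<Rightarrow> real ^ 'n) \<Rightarrow> (real ^ 'n \<Rightarrow> real) \<Rightarrow> bool" where
  "distributional_div D v w \<longleftrightarrow>
     (\<forall>\<psi>. (\<forall>k. Ck k \<psi>) \<and> compact (fun_support \<psi>) \<and> fun_support \<psi> \<subseteq> D \<longrightarrow>
        (LINT x:D|lebesgue. w x * \<psi> x) = - (LINT x:D|lebesgue. v x \<bullet> grad \<psi> x))"

text \<open>
  \<open>g\<close> is the normal trace of \<open>v\<close>, where \<open>w\<close> is the divergence of \<open>v\<close> in \<open>bdry_layer \<Omega> \<delta>\<close>. The values
  of \<open>w\<close> outside this layer do not enter, because the test functions vanish there.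
\<close>

definition normal_trace ::
    "(real ^ 'n) set \<Rightarrow> ennreal \<Rightarrow> (real ^ 'n \<Rightarrow> real ^ 'n) \<Rightarrow> (real ^ 'n \<Rightarrow> real) \<Rightarrow>
     (real ^ 'n \<Rightarrow> real) \<Rightarrow> bool" where
  "normal_trace \<Omega> \<delta> v w g \<longleftrightarrow>
     g \<in> borel_measurable (surface_measure \<Omega>) \<and>
     (\<forall>K. compact K \<and> K \<subseteq> frontier \<Omega> \<longrightarrow> set_integrable (surface_measure \<Omega>) K g) \<and>
     (\<forall>\<phi>. Ck 1 \<phi> \<and> compact (fun_support \<phi>) \<and>
          (\<exists>\<delta>'. 0 < \<delta>' \<and> \<delta>' < \<delta> \<and> (\<forall>x \<in> \<Omega> - bdry_layer \<Omega> \<delta>'. \<phi> x = 0)) \<longrightarrow>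
        (LINT x|surface_measure \<Omega>. g x * \<phi> x) =
        (LINT x:\<Omega>|lebesgue. w x * \<phi> x) + (LINT x:\<Omega>|lebesgue. v x \<bullet> grad \<phi> x))"

end

theory Submission
  imports Defs
begin

text \<open>
  For a test function \<open>\<phi>\<close> put \<open>T \<phi> = \<integral>\<^sub>\<Omega> w \<phi> + \<integral>\<^sub>\<Omega> v \<bullet> \<nabla>\<phi>\<close>. If the support of \<open>\<phi>\<close> misses \<open>\<Gamma>\<close>, then
  \<open>T \<phi> = 0\<close>: the restriction of \<open>\<phi>\<close> to \<open>\<Omega>\<close>, extended by zero and mollified, is a test function for
  the distributional divergence. Hence \<open>\<phi>\<close> may be replaced by \<open>\<phi> \<theta>\<close>, where \<open>\<theta>\<close> is \<open>1\<close> near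
  \<open>S = \<Gamma> \<inter> supp \<phi>\<close>, vanishes outside the \<open>\<rho>\<close>-neighbourhood of \<open>S\<close> and has \<open>\<bar>\<nabla>\<theta>\<bar> \<le> 4 / \<rho>\<close>. As
  \<open>\<rho> \<longlonglongrightarrow> 0\<close>, the integrals of \<open>w \<phi> \<theta>\<close> and \<open>\<theta> v \<bullet> \<nabla>\<phi>\<close> tend to \<open>0\<close>, and what remains is at most
  \<open>4 / \<rho>\<close> times the integral of \<open>\<bar>v\<bar> \<bar>\<phi>\<bar>\<close> over that neighbourhood. It is covered by balls of radius
  \<open>6 \<rho>\<close> centred at points \<open>z \<in> S\<close> for which the balls of radius \<open>\<rho>\<close> are disjoint. On each of them the
  \<open>b\<close>-seminorm bounds the integral of \<open>\<bar>v\<bar>\<close> by a multiple of \<open>\<rho> ^ n\<close>, and the surface measure of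
  \<open>\<Gamma> \<inter> cball z \<rho>\<close> is at least a multiple of \<open>\<rho> ^ (n - 1)\<close>, so a Riemann sum argument gives
  \<open>\<bar>T \<phi>\<bar> \<le> C [v]\<^sub>b \<integral>\<^sub>\<Gamma> \<bar>\<phi>\<bar>\<close>. By duality of \<open>L\<^sup>1\<close> and \<open>L\<^sup>\<infinity>\<close> on \<open>\<Gamma>\<close>, \<open>T\<close> is represented by a bounded
  function, and the same inequality bounds every normal trace almost everywhere.
\<close>

section \<open>Hausdorff measure\<close>

text \<open>The estimate is scale invariant. At scale \<open>\<rho>\<close> the gradient of the
  cutoff costs a factor \<open>1 / \<rho>\<close>, a boundary ball carries at most a multiple of
  \<open>\<rho> ^ n\<close> of the mass of \<open>v\<close>, and it occupies at least a multiple of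
  \<open>\<rho> ^ (n - 1)\<close> of surface. The powers cancel, so \<open>\<rho>\<close> may tend
  to 0 without any smoothness of \<open>v\<close>. The divergence enters through the integrability
  of \<open>w\<close> up to \<open>\<Gamma>\<close>, because \<open>w \<phi> \<theta>\<close> lives
  on sets that shrink to \<open>\<Gamma>\<close>. The surface measure is a bare Hausdorff measure.
  Two facts about it take the place of an area formula: a lower density bound, found by comparing a
  cover of the graph with the volume of vertical tubes over the covering sets, and finiteness on
  bounded sets, found by a packing count. Both see the graph through its Lipschitz constant. In the
  final constant, 4 is the slope of the cutoff and 6 = 5 + 1 adds the dilation factor of Vitali's
  lemma to the width of the neighbourhood of \<open>S\<close>.\<close>

lemma metric_outer_measure_borel:
  fixes f :: "'a::metric_space set \<Rightarrow> ennreal"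
  assumes pos: "f {} = 0"
    and mono: "\<And>A B. A \<subseteq> B \<Longrightarrow> f A \<le> f B"
    and csub: "\<And>A :: nat \<Rightarrow> 'a set. f (\<Union>i. A i) \<le> (\<Sum>i. f (A i))"
    and sep: "\<And>A B \<rho>. 0 < \<rho> \<Longrightarrow> (\<And>a b. a \<in> A \<Longrightarrow> b \<in> B \<Longrightarrow> \<rho> \<le> dist a b) \<Longrightarrow> f A + f B \<le> f (A \<union> B)"
  shows "measure_space UNIV (sets borel) f"
proof -
  have sub2: "f (A \<union> B) \<le> f A + f B" for A B
  proof -
    have "f (A \<union> B) \<le> f (\<Union>i. binaryset A B i)"
      by (simp add: UN_binaryset_eq)
    also have "\<dots> \<le> (\<Sum>i. f (binaryset A B i))" by (rule csub)
    also have "\<dots> = f A + f B" by (rule suminf_binaryset_eq) (rule pos)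
    finally show ?thesis .
  qed
  have oms: "outer_measure_space (Pow UNIV) f"
    unfolding outer_measure_space_def positive_def increasing_def countably_subadditive_def
    using pos mono csub by auto
  interpret sigma_algebra UNIV "Pow UNIV :: 'a set set" by (rule sigma_algebra_Pow)
  have meas: "measure_space UNIV (lambda_system UNIV (Pow UNIV) f) f"
    by (rule caratheodory_lemma[OF oms])
  \<comment> \<open>Caratheodory's criterion for a closed \<open>F\<close>. The part of
    \<open>A\<close> at distance at least \<open>1 / (k + 1)\<close> from \<open>F\<close> is
    separated from \<open>A \<inter> F\<close>, so additivity holds for it. What is missing of
    \<open>A - F\<close> lies in the union of the shells \<open>R j\<close> with
    \<open>j \<ge> k\<close>, whose measure is at most the tail of a convergent series.\<close>
  have closed_le: "f (A \<inter> F) + f (A - F) \<le> f A" if F: "closed F" "F \<noteq> {}" and fin: "f A < \<infinity>" for A F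
  proof -
    define d where "d = (\<lambda>x. infdist x F)"
    define Ak where "Ak = (\<lambda>k::nat. {x\<in>A. 1 / (real k + 1) \<le> d x})"
    define R where "R = (\<lambda>k::nat. {x\<in>A. 1 / (real k + 2) \<le> d x \<and> d x < 1 / (real k + 1)})"
    have dle: "d a \<le> d b + dist a b" for a b
      unfolding d_def by (metis infdist_triangle dist_commute)
    have dF: "d a = 0" if "a \<in> F" for a using that by (simp add: d_def)
    have dpos: "d a > 0" if "a \<notin> F" for a
      using that F unfolding d_def by (simp add: infdist_pos_not_in_closed)
    \<comment> \<open>Neighbouring shells touch, but shells whose indices differ by at least 2 are a
      positive distance apart. So the sum over one parity class is at most the measure of its
      union.\<close>
    have odd_even: "(\<Sum>j<m. f (R (2*j+p))) \<le> f (\<Union>j<m. R (2*j+p))" for m p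
    proof (induction m)
      case (Suc m)
      have "(\<Sum>j<Suc m. f (R (2*j+p))) \<le> f (\<Union>j<m. R (2*j+p)) + f (R (2*m+p))"
        using Suc by (simp add: add_right_mono)
      also have "\<dots> \<le> f ((\<Union>j<m. R (2*j+p)) \<union> R (2*m+p))"
      \<comment> \<open>For \<open>m = 0\<close> the first union is empty; with \<open>p = 0\<close>
        the width used below would be \<open>1 / 0\<close>.\<close>
      proof (cases "m = 0")
        case False
        show ?thesis
        proof (rule sep)
          have "0 < real (2*m+p)" using False by simp
          then show "0 < 1 / real (2*m+p) - 1 / (real (2*m+p) + 1)"
            by (simp add: frac_less2 del: of_nat_add of_nat_mult)
          fix a b assume a: "a \<in> (\<Union>j<m. R (2*j+p))" and b: "b \<in> R (2*m+p)"
          then obtain j where j: "j < m" "1 / (real (2*j+p) + 2) \<le> d a" by (auto simp: R_def)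
          have "1 / real (2*m+p) \<le> 1 / (real (2*j+p) + 2)"
            using j(1) by (intro divide_left_mono) auto
          then show "1 / real (2*m+p) - 1 / (real (2*m+p) + 1) \<le> dist a b"
            using j(2) b dle[of a b] by (auto simp: R_def)
        qed
      qed (simp add: pos)
      also have "(\<Union>j<m. R (2*j+p)) \<union> R (2*m+p) = (\<Union>j<Suc m. R (2*j+p))"
        by (auto simp: less_Suc_eq)
      finally show ?case .
    qed (simp add: pos)
    have RA: "f (\<Union>j<m. R (2*j+p)) \<le> f A" for m p
      by (rule mono) (auto simp: R_def)
    have bound: "(\<Sum>j<k. f (R j)) \<le> f A + f A" for k
    proof -
      have "(\<Sum>j<2*m. f (R j)) = (\<Sum>j<m. f (R (2*j+0))) + (\<Sum>j<m. f (R (2*j+1)))" for m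
        by (induction m) (auto simp: algebra_simps)
      then have "(\<Sum>j<2*k. f (R j)) \<le> f A + f A"
        using order_trans[OF odd_even RA] by (metis add_mono)
      moreover have "(\<Sum>j<k. f (R j)) \<le> (\<Sum>j<2*k. f (R j))"
        by (rule sum_mono2) auto
      ultimately show ?thesis by order
    qed
    define S where "S = (\<Sum>j. f (R j))"
    have "S \<le> f A + f A" unfolding S_def
      by (rule suminf_le_const) (use bound in auto)
    then have Sfin: "S < \<infinity>" using fin by (simp add: le_less_trans)
    \<comment> \<open>The partial sum stands on the left so that no tail has to be subtracted in
      \<open>ennreal\<close>. In the limit it becomes \<open>S\<close>, which cancels because it is
      finite.\<close>
    have key: "f (A \<inter> F) + f (A - F) + (\<Sum>j<k. f (R j)) \<le> f A + S" for k
    proof -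
      have 1: "f (A \<inter> F) + f (Ak k) \<le> f ((A \<inter> F) \<union> Ak k)"
      proof (rule sep)
        fix a b assume "a \<in> A \<inter> F" "b \<in> Ak k"
        then show "1 / (real k + 1) \<le> dist a b"
          using dle[of b a] dF[of a] by (auto simp: Ak_def dist_commute)
      qed simp
      also have "\<dots> \<le> f A" by (rule mono) (auto simp: Ak_def)
      finally have 1: "f (A \<inter> F) + f (Ak k) \<le> f A" .
      have cov: "A - F \<subseteq> Ak k \<union> (\<Union>i. R (i + k))"
      proof
        fix x assume x: "x \<in> A - F"
        then have dx: "d x > 0" using dpos by auto
        show "x \<in> Ak k \<union> (\<Union>i. R (i + k))"
        proof (cases "1 / (real k + 1) \<le> d x")
          case False
          obtain m0 where m0: "1 / (real m0 + 1) \<le> d x"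
            using dx by (metis less_imp_le nat_approx_posE of_nat_Suc add.commute)
          define m where "m = (LEAST m. 1 / (real m + 1) \<le> d x)"
          have m: "1 / (real m + 1) \<le> d x" unfolding m_def by (rule LeastI) (rule m0)
          have "k < m"
          proof (rule ccontr)
            assume "\<not> k < m"
            then have "1 / (real k + 1) \<le> 1 / (real m + 1)" by (intro divide_left_mono) auto
            with m False show False by simp
          qed
          moreover have "\<not> 1 / (real (m - 1) + 1) \<le> d x"
            using \<open>k < m\<close> not_less_Least[of "m - 1" "\<lambda>m. 1 / (real m + 1) \<le> d x"]
            unfolding m_def[symmetric] by auto
          ultimately have "x \<in> R ((m - 1 - k) + k)" using m x
            by (auto simp: R_def of_nat_diff algebra_simps)
          then show ?thesis by blast
        qed (use x in \<open>auto simp: Ak_def\<close>)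
      qed
      have "f (A - F) \<le> f (Ak k) + f (\<Union>i. R (i + k))"
        using mono[OF cov] sub2 order_trans by blast
      also have "\<dots> \<le> f (Ak k) + (\<Sum>i. f (R (i + k)))"
        by (intro add_left_mono csub)
      finally have 2: "f (A - F) \<le> f (Ak k) + (\<Sum>i. f (R (i + k)))" .
      have 3: "S = (\<Sum>i. f (R (i + k))) + (\<Sum>j<k. f (R j))"
        unfolding S_def by (rule suminf_offset) auto
      have "f (A \<inter> F) + f (A - F) + (\<Sum>j<k. f (R j))
          \<le> f (A \<inter> F) + (f (Ak k) + (\<Sum>i. f (R (i + k)))) + (\<Sum>j<k. f (R j))"
        by (intro add_right_mono add_left_mono 2)
      also have "\<dots> = (f (A \<inter> F) + f (Ak k)) + S" unfolding 3 by (simp add: ac_simps)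
      also have "\<dots> \<le> f A + S" by (intro add_right_mono 1)
      finally show ?thesis .
    qed
    have "(\<lambda>k. f (A \<inter> F) + f (A - F) + (\<Sum>j<k. f (R j))) \<longlonglongrightarrow> f (A \<inter> F) + f (A - F) + S"
      unfolding S_def by (intro tendsto_add tendsto_const summable_LIMSEQ) auto
    then have "f (A \<inter> F) + f (A - F) + S \<le> f A + S"
      by (rule LIMSEQ_le_const2) (use key in auto)
    then show ?thesis using Sfin by (auto simp: ennreal_add_left_cancel_le add.commute)
  qed
  have closed_in: "F \<in> lambda_system UNIV (Pow UNIV) f" if "closed F" for F
  proof -
    have "f (A \<inter> F) + f (A - F) = f A" for A
    proof (rule antisym)
      show "f (A \<inter> F) + f (A - F) \<le> f A"
      proof (cases "F = {} \<or> f A = \<infinity>")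
        case False
        then show ?thesis using closed_le[OF that, of A] by (simp add: less_top)
      qed (auto simp: pos)
      show "f A \<le> f (A \<inter> F) + f (A - F)"
        using sub2[of "A \<inter> F" "A - F"] by (simp add: Int_Diff_Un)
    qed
    then show ?thesis unfolding lambda_system_eq by auto
  qed
  have "sigma_algebra UNIV (lambda_system UNIV (Pow UNIV) f)"
    using meas by (simp add: measure_space_def)
  then have "sigma_sets UNIV {F. closed F} \<subseteq> lambda_system UNIV (Pow UNIV) f"
    by (rule sigma_algebra.sigma_sets_subset) (use closed_in in auto)
  then have "sets borel \<subseteq> lambda_system UNIV (Pow UNIV) f"
    by (simp add: borel_eq_closed)
  then show ?thesis
    by (intro measure_down[OF meas]) (auto simp: sets.sigma_algebra_axioms[of borel, simplified])
qed

section \<open>Hausdorff premeasures at a fixed scale\<close>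

definition hausdorff_pre :: "nat \<Rightarrow> real \<Rightarrow> 'a::metric_space set \<Rightarrow> ennreal" where
  "hausdorff_pre s \<epsilon> A =
     (INF C \<in> {C :: nat \<Rightarrow> 'a set. A \<subseteq> (\<Union>i. C i) \<and> (\<forall>i. bounded (C i) \<and> diameter (C i) \<le> \<epsilon>)}.
          \<Sum>i. hausdorff_weight s (C i))"

lemma hausdorff_outer_eq_SUP: "hausdorff_outer s A = (SUP \<epsilon>\<in>{0<..}. hausdorff_pre s \<epsilon> A)"
  by (simp add: hausdorff_outer_def hausdorff_pre_def)

lemma hausdorff_pre_le:
  assumes "A \<subseteq> (\<Union>i. C i)" "\<And>i. bounded (C i)" "\<And>i. diameter (C i) \<le> \<epsilon>"
  shows "hausdorff_pre s \<epsilon> A \<le> (\<Sum>i. hausdorff_weight s (C i))"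
  unfolding hausdorff_pre_def by (rule INF_lower) (use assms in auto)

lemma hausdorff_pre_greatest:
  assumes "\<And>C. A \<subseteq> (\<Union>i. C i) \<Longrightarrow> (\<And>i. bounded (C i)) \<Longrightarrow> (\<And>i. diameter (C i) \<le> \<epsilon>) \<Longrightarrow>
    x \<le> (\<Sum>i. hausdorff_weight s (C i))"
  shows "x \<le> hausdorff_pre s \<epsilon> A"
  unfolding hausdorff_pre_def by (rule INF_greatest) (use assms in auto)

lemma hausdorff_pre_le_outer: "0 < \<epsilon> \<Longrightarrow> hausdorff_pre s \<epsilon> A \<le> hausdorff_outer s A"
  unfolding hausdorff_outer_eq_SUP by (rule SUP_upper) auto

lemma hausdorff_pre_antimono: "\<epsilon> \<le> \<epsilon>' \<Longrightarrow> hausdorff_pre s \<epsilon>' A \<le> hausdorff_pre s \<epsilon> A"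
  by (rule hausdorff_pre_greatest, rule hausdorff_pre_le) (auto intro: order_trans)

text \<open>Near-optimal covers of the pieces, with errors that form a geometric series of sum
  \<open>e\<close>, are merged into a single sequence by \<open>prod_decode\<close>.\<close>

lemma hausdorff_pre_UN:
  assumes e: "0 < \<epsilon>"
  shows "hausdorff_pre s \<epsilon> (\<Union>i. A i) \<le> (\<Sum>i. hausdorff_pre s \<epsilon> (A i))"
proof (rule ennreal_le_epsilon)
  fix e :: real assume fin: "(\<Sum>i. hausdorff_pre s \<epsilon> (A i)) < top" and e: "0 < e"
  have "\<exists>C. A i \<subseteq> (\<Union>j. C j) \<and> (\<forall>j. bounded (C j) \<and> diameter (C j) \<le> \<epsilon>) \<and>
      (\<Sum>j. hausdorff_weight s (C j)) < hausdorff_pre s \<epsilon> (A i) + ennreal (e * (1/2)^Suc i)" for i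
  proof -
    have "hausdorff_pre s \<epsilon> (A i) < top"
      using fin ennreal_suminf_lessD by blast
    then have "hausdorff_pre s \<epsilon> (A i) < hausdorff_pre s \<epsilon> (A i) + ennreal (e * (1/2)^Suc i)"
      using e by (auto simp: ennreal_zero_less_mult_iff simp flip: ennreal_mult'')
    then show ?thesis
      unfolding hausdorff_pre_def[of s \<epsilon> "A i"] INF_less_iff by blast
  qed
  then obtain C where C: "\<And>i. A i \<subseteq> (\<Union>j. C i j)" "\<And>i j. bounded (C i j)" "\<And>i j. diameter (C i j) \<le> \<epsilon>"
      "\<And>i. (\<Sum>j. hausdorff_weight s (C i j)) < hausdorff_pre s \<epsilon> (A i) + ennreal (e * (1/2)^Suc i)"
    by metis
  define D where "D = (\<lambda>k. case prod_decode k of (i, j) \<Rightarrow> C i j)"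
  have "hausdorff_pre s \<epsilon> (\<Union>i. A i) \<le> (\<Sum>k. hausdorff_weight s (D k))"
  proof (rule hausdorff_pre_le)
    show "(\<Union>i. A i) \<subseteq> (\<Union>k. D k)"
    proof
      fix x assume "x \<in> (\<Union>i. A i)"
      then obtain i j where "x \<in> C i j" using C(1) by blast
      then have "x \<in> D (prod_encode (i, j))" by (simp add: D_def)
      then show "x \<in> (\<Union>k. D k)" by blast
    qed
  qed (auto simp: D_def C split: prod.split)
  also have "\<dots> = (\<Sum>k. (\<lambda>(i,j). hausdorff_weight s (C i j)) (prod_decode k))"
    by (simp add: D_def case_prod_beta)
  also have "\<dots> = (\<Sum>i. \<Sum>j. hausdorff_weight s (C i j))"
    by (rule suminf_ennreal_2dimen) simp
  also have "\<dots> \<le> (\<Sum>i. hausdorff_pre s \<epsilon> (A i) + ennreal (e * (1/2)^Suc i))"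
    by (intro suminf_le less_imp_le C(4)) auto
  also have "\<dots> = (\<Sum>i. hausdorff_pre s \<epsilon> (A i)) + (\<Sum>i. ennreal (e * (1/2)^Suc i))"
    by (rule suminf_add[symmetric]) auto
  also have "(\<Sum>i. ennreal (e * (1/2)^Suc i)) = ennreal e"
  proof -
    have "(\<lambda>i. e * (1/2)^Suc i) sums (e * 1)"
      by (intro sums_mult power_half_series)
    then show ?thesis using e by (intro suminf_ennreal_eq) auto
  qed
  finally show "hausdorff_pre s \<epsilon> (\<Union>i. A i) \<le> (\<Sum>i. hausdorff_pre s \<epsilon> (A i)) + ennreal e" .
qed

text \<open>A covering set of diameter less than \<open>\<rho>\<close> cannot meet both
  \<open>A\<close> and \<open>B\<close>, so every cover of the union splits into covers of the two
  parts. A set that belongs to the other part is replaced by \<open>{}\<close>, which has weight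
  0.\<close>

lemma hausdorff_pre_separated:
  assumes "\<epsilon> < \<rho>" and d: "\<And>a b. a \<in> A \<Longrightarrow> b \<in> B \<Longrightarrow> \<rho> \<le> dist a b"
  shows "hausdorff_pre s \<epsilon> A + hausdorff_pre s \<epsilon> B \<le> hausdorff_pre s \<epsilon> (A \<union> B)"
proof (rule hausdorff_pre_greatest)
  fix C :: "nat \<Rightarrow> 'a set"
  assume C: "A \<union> B \<subseteq> (\<Union>i. C i)" "\<And>i. bounded (C i)" "\<And>i. diameter (C i) \<le> \<epsilon>"
  define D where "D = (\<lambda>E i. if C i \<inter> E = {} then {} else C i)"
  have eps: "0 \<le> \<epsilon>" using C(2)[of 0] C(3)[of 0] diameter_ge_0[of "C 0"] by linarith
  have le: "hausdorff_pre s \<epsilon> E \<le> (\<Sum>i. hausdorff_weight s (D E i))" if "E \<subseteq> (\<Union>i. C i)" for E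
    by (rule hausdorff_pre_le) (use that C eps in \<open>auto simp: D_def; blast\<close>)+
  have w: "hausdorff_weight s (D A i) + hausdorff_weight s (D B i) \<le> hausdorff_weight s (C i)" for i
  proof -
    have "C i \<inter> A = {} \<or> C i \<inter> B = {}"
    proof (rule ccontr)
      assume "\<not> ?thesis"
      then obtain a b where "a \<in> C i" "a \<in> A" "b \<in> C i" "b \<in> B" by auto
      then show False
        using d[of a b] diameter_bounded_bound[OF C(2)[of i], of a b] C(3)[of i] assms(1) by force
    qed
    then show ?thesis by (auto simp: D_def hausdorff_weight_def)
  qed
  have "hausdorff_pre s \<epsilon> A + hausdorff_pre s \<epsilon> B
      \<le> (\<Sum>i. hausdorff_weight s (D A i)) + (\<Sum>i. hausdorff_weight s (D B i))"
    using C(1) by (intro add_mono le) auto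
  also have "\<dots> = (\<Sum>i. hausdorff_weight s (D A i) + hausdorff_weight s (D B i))"
    by (rule suminf_add) auto
  also have "\<dots> \<le> (\<Sum>i. hausdorff_weight s (C i))"
    by (intro suminf_le w) auto
  finally show "hausdorff_pre s \<epsilon> A + hausdorff_pre s \<epsilon> B \<le> (\<Sum>i. hausdorff_weight s (C i))" .
qed

lemma hausdorff_outer_mono: "A \<subseteq> B \<Longrightarrow> hausdorff_outer s A \<le> hausdorff_outer s B"
  unfolding hausdorff_outer_eq_SUP
  by (intro SUP_mono bexI, rule hausdorff_pre_greatest, rule hausdorff_pre_le) auto

text \<open>Separated sets are additive only at scales below their distance. Since the premeasures
  grow as the scale shrinks, this is enough for the supremum.\<close>

lemma measure_space_hausdorff_outer: "measure_space UNIV (sets borel) (hausdorff_outer s)"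
proof (rule metric_outer_measure_borel)
  show "hausdorff_outer s ({} :: 'a set) = 0"
  proof -
    have "hausdorff_pre s \<epsilon> ({} :: 'a set) = 0" if "0 < \<epsilon>" for \<epsilon>
      using hausdorff_pre_le[of "{}" "\<lambda>_. {} :: 'a set" \<epsilon> s] that by (simp add: hausdorff_weight_def)
    then show ?thesis unfolding hausdorff_outer_eq_SUP
      by (intro antisym SUP_least) auto
  qed
next
  fix A :: "nat \<Rightarrow> 'a set"
  show "hausdorff_outer s (\<Union>i. A i) \<le> (\<Sum>i. hausdorff_outer s (A i))"
    unfolding hausdorff_outer_eq_SUP[of s "\<Union>i. A i"]
  proof (rule SUP_least)
    fix \<epsilon> :: real assume "\<epsilon> \<in> {0<..}"
    then show "hausdorff_pre s \<epsilon> (\<Union>i. A i) \<le> (\<Sum>i. hausdorff_outer s (A i))"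
      by (intro order_trans[OF hausdorff_pre_UN] suminf_le hausdorff_pre_le_outer) auto
  qed
next
  fix A B :: "'a set" and \<rho> :: real
  assume \<rho>: "0 < \<rho>" and d: "\<And>a b. a \<in> A \<Longrightarrow> b \<in> B \<Longrightarrow> \<rho> \<le> dist a b"
  have *: "hausdorff_pre s \<epsilon> A + hausdorff_pre s \<epsilon>' B \<le> hausdorff_outer s (A \<union> B)"
    if "0 < \<epsilon>" "0 < \<epsilon>'" for \<epsilon> \<epsilon>'
  proof -
    define e where "e = min (\<rho>/2) (min \<epsilon> \<epsilon>')"
    have "hausdorff_pre s \<epsilon> A + hausdorff_pre s \<epsilon>' B \<le> hausdorff_pre s e A + hausdorff_pre s e B"
      by (intro add_mono hausdorff_pre_antimono) (auto simp: e_def)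
    also have "\<dots> \<le> hausdorff_pre s e (A \<union> B)"
      by (rule hausdorff_pre_separated[OF _ d]) (use \<rho> in \<open>auto simp: e_def\<close>)
    also have "\<dots> \<le> hausdorff_outer s (A \<union> B)"
      by (rule hausdorff_pre_le_outer) (use \<rho> that in \<open>auto simp: e_def\<close>)
    finally show ?thesis .
  qed
  have ne: "{0::real<..} \<noteq> {}" by auto
  show "hausdorff_outer s A + hausdorff_outer s B \<le> hausdorff_outer s (A \<union> B)"
    unfolding hausdorff_outer_eq_SUP[of s A] hausdorff_outer_eq_SUP[of s B]
    by (subst ennreal_SUP_add_left[OF ne, symmetric], rule SUP_least,
        subst ennreal_SUP_add_right[OF ne], rule SUP_least) (use * in auto)
qed (rule hausdorff_outer_mono)

lemma space_hausdorff_measure [simp]: "space (hausdorff_measure s) = UNIV"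
  unfolding hausdorff_measure_def by (simp add: space_measure_of_conv)

lemma sets_hausdorff_measure [simp, measurable_cong]: "sets (hausdorff_measure s) = sets borel"
  unfolding hausdorff_measure_def
  by (metis sets.sets_measure_of_eq space_borel)

lemma emeasure_hausdorff_measure:
  assumes "A \<in> sets borel"
  shows "emeasure (hausdorff_measure s) A = hausdorff_outer s A"
  unfolding hausdorff_measure_def
  by (rule emeasure_measure_of_sigma)
     (use assms measure_space_hausdorff_outer[of s] in \<open>auto simp: measure_space_def\<close>)

section \<open>Smooth functions and mollification\<close>

lemma GDERIV_imp_grad: "GDERIV f x :> D \<Longrightarrow> grad f x = D"
  unfolding grad_def
proof (rule the_equality)
  fix D' assume "GDERIV f x :> D" "GDERIV f x :> D'"
  then have "(\<lambda>h. h \<bullet> D) = (\<lambda>h. h \<bullet> D')"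
    unfolding gderiv_def by (rule has_derivative_unique)
  then have "h \<bullet> D = h \<bullet> D'" for h by metis
  then show "D' = D" by (metis vector_eq_ldot)
qed

text \<open>\<open>grad\<close> is a definite description, so regularity is shown by exhibiting some
  derivative \<open>g\<close> and letting uniqueness identify it with \<open>grad f\<close>.\<close>

lemma Ck_SucI:
  assumes "\<And>x. GDERIV f x :> g x" "\<And>i. Ck k (\<lambda>x. g x $ i)"
  shows "Ck (Suc k) f"
proof -
  have "grad f = g" using GDERIV_imp_grad[OF assms(1)] by auto
  then show ?thesis using assms by auto
qed

lemma Ck_GDERIV: "Ck (Suc k) f \<Longrightarrow> GDERIV f x :> grad f x"
  by (simp del: gderiv_deriv) (metis GDERIV_imp_grad)

lemma Ck_antimono_Suc: "Ck (Suc k) f \<Longrightarrow> Ck k f"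
proof (induction k arbitrary: f)
  case 0
  then have "\<forall>x. GDERIV f x :> grad f x" using Ck_GDERIV by blast
  then show ?case
    by (auto simp: gderiv_def intro!: continuous_at_imp_continuous_on has_derivative_continuous)
next
  case (Suc k)
  have g: "Ck (Suc k) (\<lambda>x. grad f x $ i)" for i using Suc.prems by (simp only: Ck.simps(2)[of "Suc k"])
  show ?case
  proof (rule Ck_SucI)
    show "GDERIV f x :> grad f x" for x using Ck_GDERIV[OF Suc.prems] .
    show "Ck k (\<lambda>x. grad f x $ i)" for i using Suc.IH[OF g] .
  qed
qed

lemma Ck_continuous: "Ck k f \<Longrightarrow> continuous_on UNIV f"
proof (induction k)
  case (Suc k)
  then show ?case using Ck_antimono_Suc by blast
qed simp

lemma Ck_1_continuous_grad: "Ck (Suc 0) f \<Longrightarrow> continuous_on UNIV (grad f)"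
  using continuous_on_vec_lambda[of UNIV "\<lambda>i x. grad f x $ i"] by simp

lemma Ck_const: "Ck k (\<lambda>x. c)"
proof (induction k arbitrary: c)
  case (Suc k)
  then show ?case by (intro Ck_SucI[where g="\<lambda>_. 0"] GDERIV_const) auto
qed auto

lemma Ck_add: "Ck k f \<Longrightarrow> Ck k g \<Longrightarrow> Ck k (\<lambda>x. f x + g x)"
proof (induction k arbitrary: f g)
  case (Suc k)
  show ?case
  proof (rule Ck_SucI)
    show "GDERIV (\<lambda>x. f x + g x) x :> grad f x + grad g x" for x
      by (intro GDERIV_add Ck_GDERIV[OF Suc.prems(1)] Ck_GDERIV[OF Suc.prems(2)])
    show "Ck k (\<lambda>x. (grad f x + grad g x) $ i)" for i
      using Suc.prems by (auto intro!: Suc.IH)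
  qed
qed (auto intro: continuous_on_add)

lemma Ck_mult: "Ck k f \<Longrightarrow> Ck k g \<Longrightarrow> Ck k (\<lambda>x. f x * g x)"
proof (induction k arbitrary: f g)
  case (Suc k)
  show ?case
  proof (rule Ck_SucI)
    show "GDERIV (\<lambda>x. f x * g x) x :> f x *\<^sub>R grad g x + g x *\<^sub>R grad f x" for x
      by (intro GDERIV_mult Ck_GDERIV[OF Suc.prems(1)] Ck_GDERIV[OF Suc.prems(2)])
    show "Ck k (\<lambda>x. (f x *\<^sub>R grad g x + g x *\<^sub>R grad f x) $ i)" for i
      using Suc.prems Suc.prems[THEN Ck_antimono_Suc] by (auto intro!: Suc.IH Ck_add)
  qed
qed (auto intro: continuous_on_mult)

lemma Ck_component:
  fixes i :: "'n::finite"
  shows "Ck k (\<lambda>x :: real ^ 'n. x $ i)"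
proof (cases k)
  case (Suc m)
  show ?thesis unfolding Suc
  proof (rule Ck_SucI)
    show "GDERIV (\<lambda>x. x $ i) x :> axis i 1" for x
      unfolding gderiv_def using bounded_linear_imp_has_derivative[OF bounded_linear_vec_nth[of i]]
      by (simp add: inner_axis)
    show "Ck m (\<lambda>x. axis i 1 $ j)" for j by (rule Ck_const)
  qed
qed (auto intro: continuous_on_component)

text \<open>The powers of \<open>inverse t\<close> make the family closed under differentiation.\<close>

definition flat_exp :: "nat \<Rightarrow> real \<Rightarrow> real" where
  "flat_exp m t = (if 0 < t then inverse t ^ m * exp (- inverse t) else 0)"

text \<open>To the right of 0 the substitution of \<open>inverse t\<close> turns this into the fact
  that \<open>exp\<close> grows faster than every power.\<close>

lemma flat_exp_tendsto_0: "(flat_exp m \<longlongrightarrow> 0) (at 0)"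
proof -
  have "((\<lambda>t::real. inverse t ^ m * exp (- inverse t)) \<longlongrightarrow> 0) (at_right 0)"
    using filterlim_compose[OF tendsto_power_div_exp_0 filterlim_inverse_at_top_right, of m]
    by (simp add: exp_minus field_simps)
  then have "(flat_exp m \<longlongrightarrow> 0) (at_right 0)"
    by (rule Lim_transform_eventually) (auto simp: flat_exp_def eventually_at_right_less intro!: eventually_at_rightI[of 0 1])
  moreover have "(flat_exp m \<longlongrightarrow> 0) (at_left 0)"
    by (rule Lim_transform_eventually[OF tendsto_const]) (auto simp: flat_exp_def intro!: eventually_at_leftI[of "-1" 0])
  ultimately show ?thesis by (simp add: filterlim_at_split)
qed

text \<open>The point of interest is \<open>t = 0\<close>: there the difference quotient of
  \<open>flat_exp m\<close> is \<open>flat_exp (m + 1)\<close>, which tends to 0, and the claimed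
  derivative is 0 as well.\<close>

lemma flat_exp_DERIV:
  "(flat_exp m has_real_derivative flat_exp (m + 2) t - real m * flat_exp (m + 1) t) (at t)"
proof -
  consider "t > 0" | "t < 0" | "t = 0" by linarith
  then show ?thesis
  proof cases
    case 1
    have "((\<lambda>t. inverse t ^ m * exp (- inverse t)) has_real_derivative
        flat_exp (m + 2) t - real m * flat_exp (m + 1) t) (at t)"
    proof -
      have g: "((\<lambda>u. u ^ m * exp (- u)) has_real_derivative
          real m * u ^ (m - 1) * exp (- u) - u ^ m * exp (- u)) (at u)" for u :: real
        by (auto intro!: derivative_eq_intros)
      have "(inverse has_real_derivative - (inverse t ^ 2)) (at t)"
        using DERIV_inverse[of t] 1 by (simp add: power2_eq_square)
      from DERIV_chain2[OF g this] show ?thesis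
        by (rule DERIV_cong) (use 1 in \<open>cases m; simp add: flat_exp_def algebra_simps power2_eq_square\<close>)
    qed
    then show ?thesis
      by (rule has_field_derivative_transform_within_open[where S="{0<..}"]) (use 1 in \<open>auto simp: flat_exp_def\<close>)
  next
    case 2
    have "((\<lambda>t. 0) has_real_derivative flat_exp (m + 2) t - real m * flat_exp (m + 1) t) (at t)"
      using 2 by (auto simp: flat_exp_def)
    then show ?thesis
      by (rule has_field_derivative_transform_within_open[where S="{..<0}"]) (use 2 in \<open>auto simp: flat_exp_def\<close>)
  next
    case 3
    have "((\<lambda>h. (flat_exp m (0 + h) - flat_exp m 0) / h) \<longlongrightarrow> 0) (at 0)"
      by (rule Lim_transform_eventually[OF flat_exp_tendsto_0[of "m+1"]])
         (auto simp: flat_exp_def eventually_at_filter field_simps)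
    then show ?thesis unfolding DERIV_def 3 by (simp add: flat_exp_def)
  qed
qed

text \<open>The induction treats all \<open>m\<close> at once: a derivative turns
  \<open>flat_exp m\<close> into a combination of \<open>flat_exp (m + 1)\<close> and
  \<open>flat_exp (m + 2)\<close> times a coordinate of \<open>x\<close>. The argument is quadratic
  in \<open>x\<close>, hence smooth at the origin as well.\<close>

lemma Ck_flat_exp_radial: "Ck k (\<lambda>x :: real ^ 'n. flat_exp m (c - x \<bullet> x))"
proof (induction k arbitrary: m)
  case 0
  have "continuous_on UNIV (flat_exp m)"
    by (intro continuous_at_imp_continuous_on ballI DERIV_isCont[OF flat_exp_DERIV])
  then show ?case
    by (auto intro!: continuous_on_compose2[where f="\<lambda>x :: real ^ 'n. c - x \<bullet> x" and t=UNIV] continuous_intros)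
next
  case (Suc k)
  show ?case
  proof (rule Ck_SucI)
    fix x :: "real ^ 'n"
    have "GDERIV (\<lambda>x. c - x \<bullet> x) x :> (-2) *\<^sub>R x"
      unfolding gderiv_def by (auto intro!: derivative_eq_intros simp: inner_commute)
    from GDERIV_DERIV_compose[OF this flat_exp_DERIV]
    show "GDERIV (\<lambda>x. flat_exp m (c - x \<bullet> x)) x :>
      (flat_exp (m+2) (c - x \<bullet> x) - real m * flat_exp (m+1) (c - x \<bullet> x)) *\<^sub>R ((-2) *\<^sub>R x)" .
  next
    fix i
    have "Ck k (\<lambda>x :: real ^ 'n. (flat_exp (m+2) (c - x \<bullet> x) + (- real m) * flat_exp (m+1) (c - x \<bullet> x)) * ((-2) * x $ i))"
      by (intro Ck_mult Ck_add Ck_const Ck_component Suc)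
    then show "Ck k (\<lambda>x :: real ^ 'n. ((flat_exp (m+2) (c - x \<bullet> x) - real m * flat_exp (m+1) (c - x \<bullet> x)) *\<^sub>R ((-2) *\<^sub>R x)) $ i)"
      by (simp add: algebra_simps)
  qed
qed

section \<open>Convolution with compactly supported functions\<close>

lemma integrable_lborel_compact_support:
  fixes f :: "'a::euclidean_space \<Rightarrow> real"
  assumes "continuous_on UNIV f" "bounded {x. f x \<noteq> 0}"
  shows "integrable lborel f"
proof -
  have "compact (closure {x. f x \<noteq> 0})" using assms(2) by simp
  then have "integrable lborel (\<lambda>x. indicator (closure {x. f x \<noteq> 0}) x *\<^sub>R f x)"
    by (rule borel_integrable_compact) (rule continuous_on_subset[OF assms(1)], simp)
  moreover have "(\<lambda>x. indicator (closure {x. f x \<noteq> 0}) x *\<^sub>R f x) = f"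
    using closure_subset[of "{x. f x \<noteq> 0}"] by (auto simp: indicator_def fun_eq_iff)
  ultimately show ?thesis by simp
qed

lemma lborel_integral_eq_integral_cbox:
  fixes f :: "'a::euclidean_space \<Rightarrow> real"
  assumes "continuous_on UNIV f" "{x. f x \<noteq> 0} \<subseteq> cbox a b"
  shows "(LINT x|lborel. f x) = integral (cbox a b) f"
proof -
  have "integrable lborel f"
    using assms bounded_subset[OF bounded_cbox] by (intro integrable_lborel_compact_support) auto
  then have "(LINT x|lborel. f x) = integral UNIV f" by (simp add: integral_lborel)
  also have "\<dots> = integral (cbox a b) f"
    using assms(2) by (subst integral_restrict_UNIV[symmetric]) (auto intro!: integral_cong)
  finally show ?thesis .
qed

lemma lborel_integral_reflect_shift:
  fixes f :: "'a::euclidean_space \<Rightarrow> real"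
  assumes [measurable]: "f \<in> borel_measurable borel"
  shows "(LINT y|lborel. f (x - y)) = (LINT y|lborel. f y)"
proof -
  have "lborel = distr lborel borel (\<lambda>y. x - y)"
    using lborel_affine[of "-1" x] by (simp add: density_1)
  then have "(LINT y|lborel. f y) = (LINT y|distr lborel borel (\<lambda>y. x - y). f y)"
    by (rule arg_cong[where f="\<lambda>M. integral\<^sup>L M f"])
  also have "\<dots> = (LINT y|lborel. f (x - y))" by (rule integral_distr) auto
  finally show ?thesis ..
qed

text \<open>The first factor is integrated and the second is translated. So compact support is asked
  of the first and differentiability of the second; \<open>conv_commute\<close> exchanges the
  roles.\<close>

definition conv :: "('a::euclidean_space \<Rightarrow> real) \<Rightarrow> ('a \<Rightarrow> real) \<Rightarrow> 'a \<Rightarrow> real" where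
  "conv f g x = (LINT y|lborel. f y * g (x - y))"

lemma conv_commute:
  assumes "continuous_on UNIV f" "continuous_on UNIV g"
  shows "conv f g = conv g f"
proof
  fix x
  have [measurable]: "f \<in> borel_measurable borel" "g \<in> borel_measurable borel"
    using assms by (auto intro: borel_measurable_continuous_onI)
  show "conv f g x = conv g f x"
    using lborel_integral_reflect_shift[of "\<lambda>y. f y * g (x - y)" x]
    by (simp add: conv_def mult.commute)
qed

lemma conv_eq_integral:
  assumes "continuous_on UNIV f" "continuous_on UNIV g" "{x. f x \<noteq> 0} \<subseteq> cbox a b"
  shows "conv f g x = integral (cbox a b) (\<lambda>y. f y * g (x - y))"
  unfolding conv_def
proof (rule lborel_integral_eq_integral_cbox)
  show "continuous_on UNIV (\<lambda>y. f y * g (x - y))"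
    by (intro continuous_on_mult assms(1) continuous_on_compose2[OF assms(2)] continuous_intros) auto
qed (use assms(3) in auto)

lemma continuous_conv:
  assumes "continuous_on UNIV f" "continuous_on UNIV g" "bounded {x. f x \<noteq> 0}"
  shows "continuous_on UNIV (conv f g)"
proof -
  obtain a where a: "{x. f x \<noteq> 0} \<subseteq> cbox (-a) a"
    using bounded_subset_cbox_symmetric[OF assms(3)] by blast
  have "continuous_on UNIV (\<lambda>x. integral (cbox (-a) a) (\<lambda>y. f y * g (x - y)))"
    by (rule integral_continuous_on_param, unfold case_prod_beta)
       (intro continuous_on_mult continuous_on_compose2[OF assms(1), where f=snd]
         continuous_on_compose2[OF assms(2), where f="\<lambda>p. fst p - snd p"] continuous_intros; simp)
  then show ?thesis using conv_eq_integral[OF assms(1,2) a] by (simp add: fun_eq_iff cong: continuous_on_cong)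
qed

text \<open>Differentiation under the integral sign. The bounded support of \<open>f\<close> makes
  the integral one over a fixed box, where \<open>leibniz_rule\<close> applies; \<open>D\<close> is
  the derivative of the integrand as a bounded linear map, the form in which that rule takes
  it.\<close>

lemma GDERIV_conv:
  fixes f :: "real ^ 'n \<Rightarrow> real"
  assumes f: "continuous_on UNIV f" "bounded {x. f x \<noteq> 0}" and g: "Ck (Suc 0) g"
  shows "GDERIV (conv f g) x :> (\<chi> i. conv f (\<lambda>u. grad g u $ i) x)"
proof -
  obtain a where a: "{x. f x \<noteq> 0} \<subseteq> cbox (-a) a"
    using bounded_subset_cbox_symmetric[OF f(2)] by blast
  have gc: "continuous_on UNIV g" using g by (rule Ck_continuous)
  have dg: "continuous_on UNIV (grad g)" using g by (rule Ck_1_continuous_grad)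
  have dgi: "continuous_on UNIV (\<lambda>u. grad g u $ i)" for i by (intro continuous_intros dg)
  define D where "D = (\<lambda>x t. f t *\<^sub>R blinfun_inner_left (grad g (x - t)))"
  have cD: "continuous_on S (\<lambda>(x, t). D x t)" for S
    unfolding D_def case_prod_beta
    by (intro continuous_on_scaleR bounded_linear.continuous_on[OF bounded_linear_blinfun_inner_left]
        continuous_on_compose2[OF f(1), where f=snd]
        continuous_on_compose2[OF dg, where f="\<lambda>p. fst p - snd p"] continuous_intros; simp)
  have cDx: "continuous_on S (D x)" for x S
    unfolding D_def
    by (intro continuous_on_scaleR bounded_linear.continuous_on[OF bounded_linear_blinfun_inner_left]
        continuous_on_subset[OF f(1)] continuous_on_compose2[OF dg, where f="\<lambda>t. x - t"] continuous_intros; simp)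
  have "((\<lambda>x. integral (cbox (-a) a) (\<lambda>y. f y * g (x - y))) has_derivative
      blinfun_apply (integral (cbox (-a) a) (D x))) (at x within UNIV)"
  proof (rule leibniz_rule)
    fix x t
    have "(g has_derivative (\<lambda>h. h \<bullet> grad g (x - t))) (at (x - t))"
      using Ck_GDERIV[OF g] by (simp add: gderiv_def)
    moreover have "((\<lambda>x. x - t) has_derivative (\<lambda>h. h)) (at x)"
      using has_derivative_diff[OF has_derivative_ident has_derivative_const] by simp
    ultimately have "((\<lambda>x. g (x - t)) has_derivative (\<lambda>h. h \<bullet> grad g (x - t))) (at x)"
      using has_derivative_compose[where f="\<lambda>x. x - t" and g=g] by blast
    then have "((\<lambda>x. f t * g (x - t)) has_derivative (\<lambda>h. f t * (h \<bullet> grad g (x - t)))) (at x)"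
      by (rule has_derivative_mult_right)
    then show "((\<lambda>x. f t * g (x - t)) has_derivative blinfun_apply (D x t)) (at x within UNIV)"
      by (rule has_derivative_eq_rhs) (simp add: D_def blinfun.scaleR_left inner_commute fun_eq_iff)
  next
    show "(\<lambda>y. f y * g (x - y)) integrable_on cbox (-a) a" for x
      by (intro integrable_continuous continuous_on_mult continuous_on_subset[OF f(1)]
          continuous_on_compose2[OF gc, where f="\<lambda>t. x - t"] continuous_intros; simp)
  qed (use cD in auto)
  moreover have "(\<lambda>x. integral (cbox (-a) a) (\<lambda>y. f y * g (x - y))) = conv f g"
    using conv_eq_integral[OF f(1) gc a] by auto
  moreover have "blinfun_apply (integral (cbox (-a) a) (D x)) h = h \<bullet> (\<chi> i. conv f (\<lambda>u. grad g u $ i) x)" for h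
  proof -
    have "blinfun_apply (integral (cbox (-a) a) (D x)) h = integral (cbox (-a) a) (\<lambda>t. blinfun_apply (D x t) h)"
      by (rule blinfun_apply_integral) (rule integrable_continuous[OF cDx])
    also have "\<dots> = integral (cbox (-a) a) (\<lambda>t. \<Sum>i\<in>UNIV. h $ i * (f t * grad g (x - t) $ i))"
      by (simp add: D_def blinfun.scaleR_left inner_vec_def sum_distrib_left mult_ac)
    also have "\<dots> = (\<Sum>i\<in>UNIV. integral (cbox (-a) a) (\<lambda>t. h $ i * (f t * grad g (x - t) $ i)))"
      by (intro integral_sum integrable_continuous continuous_on_mult continuous_on_subset[OF f(1)]
          continuous_on_compose2[OF dgi, where f="\<lambda>t. x - t"] continuous_intros; simp)
    also have "\<dots> = (\<Sum>i\<in>UNIV. h $ i * conv f (\<lambda>u. grad g u $ i) x)"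
      by (simp add: conv_eq_integral[OF f(1) dgi a])
    finally show ?thesis by (simp add: inner_vec_def)
  qed
  then have "blinfun_apply (integral (cbox (-a) a) (D x)) = (\<lambda>h. h \<bullet> (\<chi> i. conv f (\<lambda>u. grad g u $ i) x))" ..
  ultimately show ?thesis unfolding gderiv_def by simp
qed

lemma Ck_conv:
  assumes "continuous_on UNIV f" "bounded {x. f x \<noteq> 0}" "Ck k g"
  shows "Ck k (conv f g)"
  using assms(3)
proof (induction k arbitrary: g)
  case 0
  then show ?case using assms by (auto intro: continuous_conv)
next
  case (Suc k)
  have "Ck (Suc 0) g" using Suc.prems by (auto intro: Ck_continuous)
  then show ?case
    using Suc by (intro Ck_SucI[OF GDERIV_conv[OF assms(1,2)]]) auto
qed

section \<open>Mollifiers and averaging estimates\<close>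

lemma mollifier_exists:
  fixes e :: real
  assumes e: "0 < e"
  obtains \<eta> :: "real ^ 'n \<Rightarrow> real"
  where "\<And>k. Ck k \<eta>" "\<And>x. 0 \<le> \<eta> x" "\<And>x. e \<le> norm x \<Longrightarrow> \<eta> x = 0" "(LINT x|lborel. \<eta> x) = 1"
proof -
  define f where "f = (\<lambda>x :: real ^ 'n. flat_exp 0 (e\<^sup>2 - x \<bullet> x))"
  have Ckf: "Ck k f" for k unfolding f_def by (rule Ck_flat_exp_radial)
  have nn: "0 \<le> f x" for x by (simp add: f_def flat_exp_def)
  have pos: "0 < f x \<longleftrightarrow> norm x < e" for x
    using e by (simp add: f_def flat_exp_def power2_norm_eq_inner[symmetric] abs_square_less_1 flip: abs_le_square_iff)
      (metis abs_norm_cancel abs_of_pos linorder_not_le abs_le_square_iff)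
  have bnd: "bounded {x. f x \<noteq> 0}"
    using pos nn by (intro boundedI[of _ e]) (auto simp: less_le)
  have int: "integrable lborel f"
    by (rule integrable_lborel_compact_support[OF Ck_continuous[OF Ckf[of 0]] bnd])
  \<comment> \<open>Were the integral 0, \<open>f\<close> would vanish almost everywhere and the
    ball of radius \<open>e\<close>, on which it is positive, would be a null set.\<close>
  have "(LINT x|lborel. f x) \<noteq> 0"
  proof
    assume "(LINT x|lborel. f x) = 0"
    then have "AE x in lborel. f x = 0" using integral_nonneg_eq_0_iff_AE[OF int] nn by auto
    then have "AE x in lborel. x \<notin> ball (0 :: real ^ 'n) e"
    proof eventually_elim
      case (elim x)
      then show ?case using pos[of x] by auto
    qed
    then have "ball (0 :: real ^ 'n) e \<in> null_sets lborel"
      by (simp add: AE_iff_null_sets)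
    then show False
      using e unit_ball_vol_pos[of "real CARD('n)"] by (simp add: null_sets_def emeasure_ball)
  qed
  moreover have "0 \<le> (LINT x|lborel. f x)" using nn by (intro Bochner_Integration.integral_nonneg) auto
  ultimately have Z: "0 < (LINT x|lborel. f x)" by simp
  show ?thesis
  proof (rule that[of "\<lambda>x. f x * inverse (LINT x|lborel. f x)"])
    show "Ck k (\<lambda>x. f x * inverse (LINT x|lborel. f x))" for k
      by (intro Ck_mult Ckf Ck_const)
    show "f x * inverse (LINT x|lborel. f x) = 0" if "e \<le> norm x" for x
      using pos[of x] nn[of x] that by (simp add: less_le)
  qed (use Z nn in auto)
qed

context
  fixes \<eta> :: "'a::euclidean_space \<Rightarrow> real" and e :: real
  assumes eta: "continuous_on UNIV \<eta>" "\<And>x. 0 \<le> \<eta> x" "\<And>x. e \<le> norm x \<Longrightarrow> \<eta> x = 0" "(LINT x|lborel. \<eta> x) = 1"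
begin

lemma mollifier_bounded_support: "bounded {x. \<eta> x \<noteq> 0}"
proof (rule boundedI[of _ e])
  fix x assume "x \<in> {x. \<eta> x \<noteq> 0}"
  then show "norm x \<le> e" using eta(3)[of x] by force
qed

lemma mollify_integrable:
  assumes "continuous_on UNIV f"
  shows "integrable lborel (\<lambda>y. f y * \<eta> y)"
  by (intro integrable_lborel_compact_support continuous_on_mult assms eta(1) bounded_subset[OF mollifier_bounded_support]) auto

lemma mollify_bound:
  assumes f: "continuous_on UNIV f" and le: "\<And>y. norm y \<le> e \<Longrightarrow> \<bar>f y\<bar> \<le> c"
  shows "\<bar>LINT y|lborel. f y * \<eta> y\<bar> \<le> c"
proof -
  have "norm (LINT y|lborel. f y * \<eta> y) \<le> (LINT y|lborel. norm (f y * \<eta> y))"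
    by (rule integral_norm_bound)
  also have "\<dots> \<le> (LINT y|lborel. c * \<eta> y)"
  proof (rule integral_mono)
    show "norm (f y * \<eta> y) \<le> c * \<eta> y" for y
      using eta(2)[of y] eta(3)[of y] le[of y] by (cases "norm y \<le> e") (auto simp: abs_mult mult_right_mono)
  qed (use mollify_integrable[OF f] mollify_integrable[OF continuous_on_const] in auto)
  finally show ?thesis using eta(4) by simp
qed

text \<open>The convolution at \<open>x\<close> is a weighted mean of the values of \<open>f\<close>
  in the ball of radius \<open>e\<close> about \<open>x\<close>. With suitable \<open>c\<close> and
  \<open>\<kappa>\<close> this one estimate gives uniform approximation, preservation of bounds, and
  vanishing away from the support.\<close>

lemma conv_mollifier_close:
  assumes f: "continuous_on UNIV f" and le: "\<And>y. dist y x \<le> e \<Longrightarrow> \<bar>f y - c\<bar> \<le> \<kappa>"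
  shows "\<bar>conv f \<eta> x - c\<bar> \<le> \<kappa>"
proof -
  have cf: "continuous_on UNIV (\<lambda>y. f (x - y))"
    by (intro continuous_on_compose2[OF f] continuous_intros) auto
  have "conv f \<eta> x - c = (LINT y|lborel. \<eta> y * f (x - y)) - (LINT y|lborel. c * \<eta> y)"
    using eta(4) by (simp add: conv_commute[OF f eta(1)] conv_def)
  also have "\<dots> = (LINT y|lborel. (f (x - y) - c) * \<eta> y)"
    using mollify_integrable[OF cf] mollify_integrable[OF continuous_on_const, of c]
    by (subst Bochner_Integration.integral_diff[symmetric]) (auto simp: algebra_simps)
  finally show ?thesis
    using mollify_bound[of "\<lambda>y. f (x - y) - c" \<kappa>] cf le by (simp add: continuous_on_diff dist_norm)
qed

text \<open>Translates of \<open>f\<close> have the same Lipschitz constant, and so has a weighted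
  mean of them.\<close>

lemma conv_mollifier_Lipschitz:
  assumes f: "continuous_on UNIV f" and le: "\<And>x y. \<bar>f x - f y\<bar> \<le> \<Lambda> * dist x y"
  shows "\<bar>conv f \<eta> x - conv f \<eta> x'\<bar> \<le> \<Lambda> * dist x x'"
proof -
  have cf: "continuous_on UNIV (\<lambda>y. f (x - y))" for x
    by (intro continuous_on_compose2[OF f] continuous_intros) auto
  have "conv f \<eta> x - conv f \<eta> x' = (LINT y|lborel. (f (x - y) - f (x' - y)) * \<eta> y)"
    using mollify_integrable[OF cf[of x]] mollify_integrable[OF cf[of x']]
    by (simp add: conv_commute[OF f eta(1)] conv_def algebra_simps)
  moreover have "\<bar>f (x - y) - f (x' - y)\<bar> \<le> \<Lambda> * dist x x'" for y
    using le[of "x - y" "x' - y"] by (simp add: dist_norm)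
  ultimately show ?thesis
    using mollify_bound[of "\<lambda>y. f (x - y) - f (x' - y)" "\<Lambda> * dist x x'"] cf
    by (simp add: continuous_on_diff)
qed

end

text \<open>The derivative in the direction \<open>D\<close> itself gives
  \<open>D \<bullet> D \<le> \<Lambda> * norm D\<close>.\<close>

lemma norm_grad_le_Lipschitz:
  fixes f :: "real ^ 'n \<Rightarrow> real"
  assumes D: "GDERIV f x :> D" and le: "\<And>y. \<bar>f y - f x\<bar> \<le> \<Lambda> * dist y x"
  shows "norm D \<le> \<Lambda>"
proof -
  have "((\<lambda>t. f (x + t *\<^sub>R D)) has_real_derivative (D \<bullet> D)) (at 0)"
  proof -
    have 1: "((\<lambda>t. x + t *\<^sub>R D) has_derivative (\<lambda>t. t *\<^sub>R D)) (at 0)"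
      by (auto intro!: derivative_eq_intros)
    have 2: "(f has_derivative (\<lambda>h. h \<bullet> D)) (at (x + 0 *\<^sub>R D))"
      using D by (simp add: gderiv_def)
    from has_derivative_compose[where f="\<lambda>t. x + t *\<^sub>R D" and g=f, OF 1 2] show ?thesis
      by (simp add: has_field_derivative_def mult_commute_abs)
  qed
  then have "((\<lambda>h. (f (x + h *\<^sub>R D) - f x) / h) \<longlongrightarrow> D \<bullet> D) (at 0)"
    by (simp add: DERIV_def)
  moreover have "(f (x + h *\<^sub>R D) - f x) / h \<le> \<Lambda> * norm D" if "h \<noteq> 0" for h
  proof -
    have "\<bar>f (x + h *\<^sub>R D) - f x\<bar> / \<bar>h\<bar> \<le> \<Lambda> * norm D"
      using le[of "x + h *\<^sub>R D"] that by (simp add: dist_norm field_simps)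
    then show ?thesis by (metis abs_divide abs_le_D1)
  qed
  ultimately have "D \<bullet> D \<le> \<Lambda> * norm D"
    by (intro tendsto_upperbound[of _ _ "at 0"]) (auto simp: eventually_at_filter)
  then have "norm D * norm D \<le> \<Lambda> * norm D" by (simp add: power2_norm_eq_inner[symmetric] power2_eq_square)
  \<comment> \<open>Any point at distance 1 from \<open>x\<close> shows this. It settles the case
    \<open>D = 0\<close>, in which nothing can be cancelled.\<close>
  moreover have "0 \<le> \<Lambda>" using le[of "x + axis undefined 1"] by (simp add: dist_norm)
  ultimately show ?thesis by (cases "D = 0") auto
qed

section \<open>Supports, cutoff functions and smooth approximation\<close>

lemma compact_fun_support_iff: "compact (fun_support f) \<longleftrightarrow> bounded {x. f x \<noteq> 0}"
  by (simp add: fun_support_def)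

lemma fun_support_mono: "{x. f x \<noteq> 0} \<subseteq> {x. g x \<noteq> 0} \<Longrightarrow> fun_support f \<subseteq> fun_support g"
  unfolding fun_support_def by (rule closure_mono)

lemma nonzero_in_fun_support: "f x \<noteq> 0 \<Longrightarrow> x \<in> fun_support f"
  unfolding fun_support_def using closure_subset[of "{x. f x \<noteq> 0}"] by auto

lemma grad_outside_support:
  fixes f :: "real ^ 'n \<Rightarrow> real"
  assumes "x \<notin> fun_support f"
  shows "GDERIV f x :> 0" "grad f x = 0"
proof -
  have "((\<lambda>_. 0) has_derivative (\<lambda>h. h \<bullet> 0)) (at x)" by auto
  then have "(f has_derivative (\<lambda>h. h \<bullet> 0)) (at x)"
    by (rule has_derivative_transform_within_open[of _ _ _ _ "- fun_support f"])
       (use assms closure_subset[of "{x. f x \<noteq> 0}"] in \<open>auto simp: fun_support_def\<close>)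
  then show "GDERIV f x :> 0" by (simp add: gderiv_def)
  then show "grad f x = 0" by (rule GDERIV_imp_grad)
qed

lemma continuous_compact_support_bounded:
  fixes f :: "'a::euclidean_space \<Rightarrow> real"
  assumes "continuous_on UNIV f" "bounded {x. f x \<noteq> 0}"
  obtains c where "0 \<le> c" "\<And>x. \<bar>f x\<bar> \<le> c"
proof -
  obtain R where R: "\<And>x. f x \<noteq> 0 \<Longrightarrow> norm x \<le> R" using assms(2) by (auto simp: bounded_iff)
  have "compact (f ` cball 0 R)" by (intro compact_continuous_image continuous_on_subset[OF assms(1)]) auto
  then obtain c where c: "\<And>x. norm x \<le> R \<Longrightarrow> \<bar>f x\<bar> \<le> c"
    using compact_imp_bounded by (force simp: bounded_iff)
  have "\<bar>f x\<bar> \<le> max c 0" for x using R[of x] c[of x] by (cases "f x = 0") auto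
  then show ?thesis using that[of "max c 0"] by simp
qed

lemma cutoff_exists:
  fixes S :: "(real ^ 'n) set"
  assumes S: "compact S" "S \<noteq> {}" and r: "0 < r"
  obtains \<theta> where "\<And>k. Ck k \<theta>" "compact (fun_support \<theta>)" "\<And>x. 0 \<le> \<theta> x" "\<And>x. \<theta> x \<le> 1"
    "\<And>x. infdist x S \<le> r / 4 \<Longrightarrow> \<theta> x = 1" "\<And>x. r \<le> infdist x S \<Longrightarrow> \<theta> x = 0"
    "\<And>x. norm (grad \<theta> x) \<le> 4 / r"
proof -
  \<comment> \<open>Equal to 1 where the distance to \<open>S\<close> is at most
    \<open>r / 2\<close>, equal to 0 from \<open>3 * r / 4\<close> on, with slope
    \<open>4 / r\<close> in between. Mollification at radius \<open>r / 4\<close> uses up the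
    remaining margins and keeps the Lipschitz constant.\<close>
  define f where "f = (\<lambda>x. max 0 (min 1 (3 - 4 / r * infdist x S)))"
  have lip: "\<bar>f x - f y\<bar> \<le> 4 / r * dist x y" for x y
  proof -
    have "\<bar>infdist x S - infdist y S\<bar> \<le> dist x y" by (rule infdist_triangle_abs)
    then have "\<bar>4 / r * infdist x S - 4 / r * infdist y S\<bar> \<le> 4 / r * dist x y"
      using r mult_left_mono[of "\<bar>infdist x S - infdist y S\<bar>" "dist x y" "4 / r"]
      by (simp only: right_diff_distrib[symmetric] abs_mult) simp
    then show ?thesis unfolding f_def by linarith
  qed
  have cf: "continuous_on UNIV f" unfolding f_def by (intro continuous_intros)
  obtain B where B: "\<And>x. x \<in> S \<Longrightarrow> norm x \<le> B" using compact_imp_bounded[OF S(1)] by (auto simp: bounded_iff)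
  have near: "infdist x S < r \<Longrightarrow> norm x \<le> B + r" for x
  proof -
    assume "infdist x S < r"
    then obtain a where "a \<in> S" "dist x a < r"
      using S(2) by (metis infdist_attains_inf compact_imp_closed S(1))
    then show ?thesis using B[of a] norm_triangle_sub[of x a] by (simp add: dist_norm)
  qed
  have bf: "bounded {x. f x \<noteq> 0}"
  proof (rule boundedI[of _ "B + r"])
    fix x assume "x \<in> {x. f x \<noteq> 0}"
    then have "4 / r * infdist x S < 3" by (simp add: f_def max_def min_def split: if_splits)
    then have "infdist x S < r" using r by (simp add: field_simps)
    then show "norm x \<le> B + r" by (rule near)
  qed
  obtain \<eta> :: "real ^ 'n \<Rightarrow> real" where eta: "\<And>k. Ck k \<eta>" "\<And>x. 0 \<le> \<eta> x" "\<And>x. r / 4 \<le> norm x \<Longrightarrow> \<eta> x = 0" "(LINT x|lborel. \<eta> x) = 1"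
    using mollifier_exists[of "r/4"] r by (metis zero_less_divide_iff zero_less_numeral)
  note eta' = Ck_continuous[OF eta(1)[of 0]] eta(2-4)
  define \<theta> where "\<theta> = conv f \<eta>"
  have close: "(\<And>y. dist y x \<le> r / 4 \<Longrightarrow> \<bar>f y - c\<bar> \<le> \<kappa>) \<Longrightarrow> \<bar>\<theta> x - c\<bar> \<le> \<kappa>" for x c \<kappa>
    unfolding \<theta>_def by (rule conv_mollifier_close[OF eta' cf])
  have tri: "infdist y S \<le> infdist x S + dist y x" for x y by (rule infdist_triangle)
  have zero: "\<theta> x = 0" if "r \<le> infdist x S" for x
  proof -
    have "\<bar>f y - 0\<bar> \<le> 0" if "dist y x \<le> r / 4" for y
    proof -
      have "3/4 * r \<le> infdist y S" using that tri[of x y] \<open>r \<le> infdist x S\<close> by (simp add: dist_commute)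
      then have "3 \<le> 4 / r * infdist y S" using r by (simp add: field_simps)
      then show ?thesis by (simp add: f_def)
    qed
    from close[OF this] show ?thesis by simp
  qed
  show ?thesis
  proof (rule that)
    show Ck: "Ck k \<theta>" for k unfolding \<theta>_def by (intro Ck_conv cf bf eta)
    show "compact (fun_support \<theta>)" unfolding compact_fun_support_iff
      using zero by (intro boundedI[of _ "B + r"] near) (auto simp: not_le[symmetric])
    \<comment> \<open>Both bounds at once: lying in the unit interval means being within
      \<open>1 / 2\<close> of \<open>1 / 2\<close>.\<close>
    have half: "\<bar>\<theta> x - 1/2\<bar> \<le> 1/2" for x
    proof (rule close)
      fix y
      have "0 \<le> f y" "f y \<le> 1" by (auto simp: f_def)
      then show "\<bar>f y - 1/2\<bar> \<le> 1/2" by linarith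
    qed
    show "0 \<le> \<theta> x" "\<theta> x \<le> 1" for x using half[of x] by linarith+
    show "\<theta> x = 1" if "infdist x S \<le> r / 4" for x
    proof -
      have "\<bar>f y - 1\<bar> \<le> 0" if "dist y x \<le> r / 4" for y
      proof -
        have "infdist y S \<le> r / 2" using that tri[of y x] \<open>infdist x S \<le> r / 4\<close> by simp
        then have "4 / r * infdist y S \<le> 2" using r by (simp add: field_simps)
        then show ?thesis by (simp add: f_def)
      qed
      from close[OF this] show ?thesis by simp
    qed
    show "\<theta> x = 0" if "r \<le> infdist x S" for x using zero that .
    show "norm (grad \<theta> x) \<le> 4 / r" for x
    proof (rule norm_grad_le_Lipschitz)
      show "GDERIV \<theta> x :> grad \<theta> x" using Ck_GDERIV[OF Ck[of "Suc 0"]] .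
      show "\<bar>\<theta> y - \<theta> x\<bar> \<le> 4 / r * dist y x" for y
        unfolding \<theta>_def by (rule conv_mollifier_Lipschitz[OF eta' cf lip])
    qed
  qed
qed

lemma uniformly_continuous_compact_support:
  fixes f :: "'a::euclidean_space \<Rightarrow> real"
  assumes f: "continuous_on UNIV f" "bounded {x. f x \<noteq> 0}" and e: "0 < e"
  obtains d where "0 < d" "\<And>x y. dist y x \<le> d \<Longrightarrow> \<bar>f y - f x\<bar> \<le> e"
proof -
  obtain R where R: "\<And>x. f x \<noteq> 0 \<Longrightarrow> norm x \<le> R" using f(2) by (auto simp: bounded_iff)
  have "uniformly_continuous_on (cball 0 (R + 1)) f"
    by (intro compact_uniformly_continuous continuous_on_subset[OF f(1)]) auto
  then obtain d where d: "0 < d" "\<And>x y. x \<in> cball 0 (R + 1) \<Longrightarrow> y \<in> cball 0 (R + 1) \<Longrightarrow> dist y x < d \<Longrightarrow> dist (f y) (f x) < e"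
    using e unfolding uniformly_continuous_on_def by metis
  show ?thesis
  proof (rule that[of "min (d/2) 1"])
    fix x y :: 'a assume xy: "dist y x \<le> min (d/2) 1"
    show "\<bar>f y - f x\<bar> \<le> e"
    proof (cases "f y = 0 \<and> f x = 0")
      case False
      have "norm x \<le> norm y + 1" "norm y \<le> norm x + 1"
        using xy norm_triangle_sub[of x y] norm_triangle_sub[of y x] by (auto simp: dist_norm norm_minus_commute)
      then have "norm x \<le> R + 1" "norm y \<le> R + 1" using False R[of x] R[of y] by auto
      then show ?thesis using d(2)[of x y] d(1) xy by (force simp: dist_norm)
    qed (use e in auto)
  qed (use d in auto)
qed

text \<open>\<open>distributional_div\<close> admits smooth test functions, whereas those of the
  normal trace are merely continuously differentiable; this bridges the gap. The gradient commutes
  with mollification, so it is approximated uniformly as well.\<close>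

lemma smooth_approximation_C1:
  fixes \<psi> :: "real ^ 'n \<Rightarrow> real"
  assumes psi: "Ck 1 \<psi>" "compact (fun_support \<psi>)" and e: "0 < e"
  obtains \<theta> where "\<And>k. Ck k \<theta>" "\<And>x. \<theta> x \<noteq> 0 \<Longrightarrow> \<exists>y \<in> fun_support \<psi>. dist x y \<le> e"
    "\<And>x. \<bar>\<theta> x - \<psi> x\<bar> \<le> e" "\<And>x. norm (grad \<theta> x - grad \<psi> x) \<le> e"
proof -
  have cpsi: "continuous_on UNIV \<psi>" using psi(1) by (rule Ck_continuous)
  have bpsi: "bounded {x. \<psi> x \<noteq> 0}" using psi(2) by (simp add: compact_fun_support_iff)
  have cg: "continuous_on UNIV (\<lambda>x. grad \<psi> x $ i)" for i
    using psi(1) by auto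
  have bg: "bounded {x. grad \<psi> x $ i \<noteq> 0}" for i
    by (rule bounded_subset[OF compact_imp_bounded[OF psi(2)]]) (use grad_outside_support(2)[of _ \<psi>] in fastforce)
  \<comment> \<open>The norm of a vector is at most the sum of the moduli of its \<open>n\<close>
    components.\<close>
  define e' where "e' = e / real CARD('n)"
  have e': "0 < e'" using e by (simp add: e'_def)
  obtain d0 where d0: "0 < d0" "\<And>x y. dist y x \<le> d0 \<Longrightarrow> \<bar>\<psi> y - \<psi> x\<bar> \<le> e"
    using uniformly_continuous_compact_support[OF cpsi bpsi e] by blast
  have "\<exists>d>0. \<forall>x y. dist y x \<le> d \<longrightarrow> \<bar>grad \<psi> y $ i - grad \<psi> x $ i\<bar> \<le> e'" for i
    using uniformly_continuous_compact_support[OF cg bg e', of i] by metis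
  then obtain d where d: "\<And>i. 0 < d i" "\<And>i x y. dist y x \<le> d i \<Longrightarrow> \<bar>grad \<psi> y $ i - grad \<psi> x $ i\<bar> \<le> e'"
    by metis
  define r where "r = Min ({e, d0} \<union> range d)"
  have r: "0 < r" "r \<le> e" "r \<le> d0" "\<And>i. r \<le> d i"
    unfolding r_def using d(1) d0(1) e by (simp, (intro Min_le; simp)+)
  obtain \<eta> :: "real ^ 'n \<Rightarrow> real" where eta: "\<And>k. Ck k \<eta>" "\<And>x. 0 \<le> \<eta> x" "\<And>x. r \<le> norm x \<Longrightarrow> \<eta> x = 0" "(LINT x|lborel. \<eta> x) = 1"
    using mollifier_exists[OF r(1)] by metis
  note eta' = Ck_continuous[OF eta(1)[of 0]] eta(2-4)
  \<comment> \<open>\<open>GDERIV_conv\<close> differentiates the second factor, so the factors are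
    exchanged to bring \<open>\<psi>\<close> there and exchanged back afterwards.\<close>
  have grad_conv: "grad (conv \<psi> \<eta>) x = (\<chi> i. conv (\<lambda>u. grad \<psi> u $ i) \<eta> x)" for x
  proof -
    have "GDERIV (conv \<eta> \<psi>) x :> (\<chi> i. conv \<eta> (\<lambda>u. grad \<psi> u $ i) x)"
      using psi(1) by (intro GDERIV_conv eta'(1) mollifier_bounded_support[OF eta']) auto
    then show ?thesis
      using GDERIV_imp_grad conv_commute[OF cpsi eta'(1)] conv_commute[OF cg eta'(1)] by simp
  qed
  show ?thesis
  proof (rule that)
    show "Ck k (conv \<psi> \<eta>)" for k by (intro Ck_conv cpsi bpsi eta)
    show "\<exists>y \<in> fun_support \<psi>. dist x y \<le> e" if "conv \<psi> \<eta> x \<noteq> 0" for x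
    proof (rule ccontr)
      assume "\<not> ?thesis"
      then have "\<psi> y = 0" if "dist y x \<le> r" for y
        using that r(2) closure_subset[of "{x. \<psi> x \<noteq> 0}"] by (force simp: fun_support_def dist_commute)
      then have "\<bar>conv \<psi> \<eta> x - 0\<bar> \<le> 0" by (intro conv_mollifier_close[OF eta' cpsi]) auto
      then show False using that by simp
    qed
    show "\<bar>conv \<psi> \<eta> x - \<psi> x\<bar> \<le> e" for x
      using r(3) d0(2) by (intro conv_mollifier_close[OF eta' cpsi]) auto
    show "norm (grad (conv \<psi> \<eta>) x - grad \<psi> x) \<le> e" for x
    proof -
      have "\<bar>conv (\<lambda>u. grad \<psi> u $ i) \<eta> x - grad \<psi> x $ i\<bar> \<le> e'" for i
        by (rule conv_mollifier_close[where e=r, OF eta' cg]) (assumption, rule d(2)[OF order_trans[OF _ r(4)]])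
      then have "(\<Sum>i\<in>UNIV. \<bar>(grad (conv \<psi> \<eta>) x - grad \<psi> x) $ i\<bar>) \<le> (\<Sum>i\<in>(UNIV :: 'n set). e')"
        by (intro sum_mono) (simp add: grad_conv)
      also have "\<dots> = e" by (simp add: e'_def)
      finally show ?thesis using norm_le_l1_cart order_trans by blast
    qed
  qed
qed

section \<open>Bounded functionals on $L^1$\<close>

text \<open>Adding \<open>C\<close> times the measure makes the set function given by
  \<open>T (indicator A)\<close> nonnegative, so that the Radon-Nikodym theorem applies without a
  decomposition of signed measures. \<open>C\<close> is subtracted from the density
  afterwards.\<close>

lemma (in finite_measure) bounded_functional_L1_representation:
  fixes T :: "('a \<Rightarrow> real) \<Rightarrow> real"
  assumes C: "0 \<le> C"
    and add: "\<And>f g. integrable M f \<Longrightarrow> integrable M g \<Longrightarrow> T (\<lambda>x. f x + g x) = T f + T g"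
    and scale: "\<And>c f. integrable M f \<Longrightarrow> T (\<lambda>x. c * f x) = c * T f"
    and bound: "\<And>f. integrable M f \<Longrightarrow> \<bar>T f\<bar> \<le> C * (LINT x|M. \<bar>f x\<bar>)"
  obtains g where "g \<in> borel_measurable M" "\<And>x. \<bar>g x\<bar> \<le> C"
    "\<And>f. integrable M f \<Longrightarrow> T f = (LINT x|M. f x * g x)"
proof -
  have int_ind [simp]: "integrable M (indicator A :: 'a \<Rightarrow> real)" if "A \<in> sets M" for A
    using that emeasure_finite[of A] by (intro integrable_real_indicator) (auto simp flip: less_top)
  define \<nu> where "\<nu> A = T (indicator A) + C * measure M A" for A
  have T_ind: "\<bar>T (indicator A)\<bar> \<le> C * measure M A" if "A \<in> sets M" for A
    using bound[OF int_ind[OF that]] that by (simp add: Int_absorb2 sets.sets_into_space)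
  have nu_nn: "0 \<le> \<nu> A" and nu_le: "\<nu> A \<le> 2 * C * measure M A" if "A \<in> sets M" for A
    using T_ind[OF that] unfolding \<nu>_def by linarith+
  have nu_add: "\<nu> (A \<union> B) = \<nu> A + \<nu> B" if AB: "A \<in> sets M" "B \<in> sets M" "A \<inter> B = {}" for A B
  proof -
    have "(indicator (A \<union> B) :: 'a \<Rightarrow> real) = (\<lambda>x. indicator A x + indicator B x)"
      using AB(3) by (auto simp: indicator_def fun_eq_iff)
    then have "T (indicator (A \<union> B)) = T (indicator A) + T (indicator B)"
      using add[OF int_ind[OF AB(1)] int_ind[OF AB(2)]] by simp
    then show ?thesis
      using AB by (simp add: \<nu>_def finite_measure_Union algebra_simps)
  qed
  have nu_empty: "\<nu> {} = 0" using nu_nn[of "{}"] nu_le[of "{}"] by simp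
  define N where "N = measure_of (space M) (sets M) (\<lambda>A. ennreal (\<nu> A))"
  have ca: "countably_additive (sets M) (\<lambda>A. ennreal (\<nu> A))"
  proof (rule sets.empty_continuous_imp_countably_additive)
    show "positive (sets M) (\<lambda>A. ennreal (\<nu> A))" by (simp add: positive_def nu_empty)
    show "additive (sets M) (\<lambda>A. ennreal (\<nu> A))" by (auto simp: additive_def nu_add nu_nn)
    fix A :: "nat \<Rightarrow> 'a set" assume A: "range A \<subseteq> sets M" "decseq A" "(\<Inter>i. A i) = {}"
    have "(\<lambda>i. measure M (A i)) \<longlonglongrightarrow> measure M (\<Inter>i. A i)"
      using A by (intro finite_Lim_measure_decseq) auto
    then have "(\<lambda>i. 2 * C * measure M (A i)) \<longlonglongrightarrow> 2 * C * 0"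
      unfolding A(3) by (intro tendsto_mult tendsto_const) simp
    then have lim: "(\<lambda>i. 2 * C * measure M (A i)) \<longlonglongrightarrow> 0" by simp
    have "(\<lambda>i. \<nu> (A i)) \<longlonglongrightarrow> 0"
      by (rule tendsto_sandwich[OF _ _ tendsto_const lim])
         (use A nu_nn nu_le in \<open>auto intro!: always_eventually\<close>)
    then show "(\<lambda>i. ennreal (\<nu> (A i))) \<longlonglongrightarrow> 0" using tendsto_ennrealI by fastforce
  qed auto
  have N: "emeasure N A = ennreal (\<nu> A)" if "A \<in> sets M" for A
    unfolding N_def using ca that
    by (intro emeasure_measure_of_sigma sets.sigma_algebra_axioms) (auto simp: positive_def nu_empty)
  have sets_N [simp]: "sets N = sets M" by (simp add: N_def)
  have [simp]: "space N = space M" by (simp add: N_def)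
  have "absolutely_continuous M N"
  proof (unfold absolutely_continuous_def, rule subsetI)
    fix A assume A: "A \<in> null_sets M"
    then have "\<nu> A = 0" using nu_nn[of A] nu_le[of A] by (auto simp: null_sets_def measure_def)
    then show "A \<in> null_sets N" using A by (auto simp: null_sets_def N)
  qed
  moreover have "finite_measure N" by (rule finite_measureI) (simp add: N)
  ultimately obtain f where f [measurable]: "f \<in> borel_measurable M" and dens: "density M f = N"
    using Radon_Nikodym_finite_measure[of N] sets_N by blast
  have f_int: "(\<integral>\<^sup>+x. f x * indicator A x \<partial>M) = ennreal (\<nu> A)" if "A \<in> sets M" for A
    using N[OF that] emeasure_density[OF f that] by (simp add: dens)
  \<comment> \<open>\<open>\<nu>\<close> is at most \<open>2 * C\<close> times the measure, so its
    density is at most \<open>2 * C\<close>: on the set where it is larger, the strict inequality of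
    the integrals would be violated.\<close>
  have f_le: "AE x in M. f x \<le> ennreal (2 * C)"
  proof -
    define E where "E = {x\<in>space M. ennreal (2 * C) < f x}"
    have E [measurable]: "E \<in> sets M" unfolding E_def by measurable
    have iE: "(\<integral>\<^sup>+x. ennreal (2 * C) * indicator E x \<partial>M) = ennreal (2 * C * measure M E)"
      using C by (simp add: nn_integral_cmult_indicator emeasure_eq_measure ennreal_mult')
    have "AE x in M. f x * indicator E x \<le> ennreal (2 * C) * indicator E x"
    proof (rule ccontr)
      assume "\<not> ?thesis"
      then have "(\<integral>\<^sup>+x. ennreal (2 * C) * indicator E x \<partial>M) < (\<integral>\<^sup>+x. f x * indicator E x \<partial>M)"
        using iE by (intro nn_integral_less) (auto simp: E_def indicator_def)
      also have "\<dots> \<le> ennreal (2 * C * measure M E)"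
        using nu_le[OF E] by (simp add: f_int ennreal_leI)
      finally show False using iE by simp
    qed
    then show ?thesis
      by (rule AE_mp) (rule AE_I2, auto simp: E_def indicator_def not_less)
  qed
  \<comment> \<open>The truncation is inactive almost everywhere; it makes the bound hold at every
    point.\<close>
  define g where "g = (\<lambda>x. max (- C) (min C (enn2real (f x) - C)))"
  have gm [measurable]: "g \<in> borel_measurable M" unfolding g_def by measurable
  have g_le: "\<bar>g x\<bar> \<le> C" for x using C by (auto simp: g_def max_def min_def abs_le_iff)
  have fg: "AE x in M. f x = ennreal (g x + C)"
    using f_le
  proof eventually_elim
    case (elim x)
    then obtain a where a: "f x = ennreal a" "0 \<le> a" by (cases "f x") (auto simp: top_unique)
    then have "a \<le> 2 * C" using elim C by simp
    then show ?case using a by (simp add: g_def)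
  qed
  have mult_int: "integrable M (\<lambda>x. f x * g x)" if "integrable M f" for f :: "'a \<Rightarrow> real"
  proof (rule Bochner_Integration.integrable_bound)
    show "integrable M (\<lambda>x. C * f x)" using that by simp
    show "AE x in M. norm (f x * g x) \<le> norm (C * f x)"
    proof (rule AE_I2)
      fix x
      show "norm (f x * g x) \<le> norm (C * f x)"
        using mult_left_mono[OF g_le[of x], of "\<bar>f x\<bar>"] C by (simp add: abs_mult mult.commute)
    qed
    show "(\<lambda>x. f x * g x) \<in> borel_measurable M" using that by measurable
  qed
  have rep: "T f = (LINT x|M. f x * g x)" if "integrable M f" for f
    using that
  proof (induction rule: integrable_induct)
    case (base A c)
    have "ennreal (\<nu> A) = (\<integral>\<^sup>+x. ennreal ((g x + C) * indicator A x) \<partial>M)"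
      unfolding f_int[OF base(1), symmetric] using fg
      by (intro nn_integral_cong_AE) (auto elim!: eventually_mono simp: indicator_def)
    also have "\<dots> = ennreal (LINT x|M. (g x + C) * indicator A x)"
    proof (rule nn_integral_eq_integral)
      show "integrable M (\<lambda>x. (g x + C) * indicator A x)"
        using mult_int[OF int_ind[OF base(1)]] int_ind[OF base(1)] by (simp add: algebra_simps)
      have "0 \<le> g x + C" for x using g_le[of x] by (auto simp: abs_le_iff)
      then show "AE x in M. 0 \<le> (g x + C) * indicator A x" by simp
    qed
    finally have "\<nu> A = (LINT x|M. (g x + C) * indicator A x)"
    proof (subst (asm) ennreal_inj)
      have "0 \<le> g x + C" for x using g_le[of x] by (auto simp: abs_le_iff)
      then show "0 \<le> (LINT x|M. (g x + C) * indicator A x)" by (intro Bochner_Integration.integral_nonneg) auto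
    qed (use nu_nn base in auto)
    also have "\<dots> = (LINT x|M. indicator A x * g x) + C * measure M A"
      using mult_int[OF int_ind[OF base(1)]] int_ind[OF base(1)] base(1)
      by (simp add: algebra_simps Int_absorb2 sets.sets_into_space)
    finally have *: "T (indicator A) = (LINT x|M. indicator A x * g x)" by (simp add: \<nu>_def)
    have "T (\<lambda>x. indicator A x *\<^sub>R c) = T (\<lambda>x. c * indicator A x)" by (simp add: mult.commute)
    also have "\<dots> = c * T (indicator A)" by (rule scale[OF int_ind[OF base(1)]])
    also have "\<dots> = (LINT x|M. c * (indicator A x * g x))" by (simp add: *)
    finally show ?case by (simp add: mult_ac)
  next
    case (add f g')
    then show ?case using mult_int by (simp add: assms(2) distrib_right)
  next
    \<comment> \<open>Both sides are Lipschitz continuous in the \<open>L1\<close> norm with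
      constant \<open>C\<close>, so the identity passes from the \<open>s i\<close> to
      \<open>f\<close>. The factor 3 in the dominating function is 2 for \<open>s i\<close> plus 1
      for \<open>f\<close>.\<close>
    case (lim f s)
    have [measurable]: "f \<in> borel_measurable M" "\<And>i. s i \<in> borel_measurable M" using lim by auto
    have tend: "(\<lambda>i. s i x) \<longlonglongrightarrow> f x" if "x \<in> space M" for x using lim that by blast
    have dom: "norm (s i x) \<le> 2 * norm (f x)" if "x \<in> space M" for i x using lim that by blast
    have IH: "T (s i) = (LINT x|M. s i x * g x)" for i using lim by blast
    have d0: "(\<lambda>i. LINT x|M. \<bar>s i x - f x\<bar>) \<longlonglongrightarrow> (LINT x|M. 0)"
    proof (rule integral_dominated_convergence[where w="\<lambda>x. 3 * \<bar>f x\<bar>"])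
      show "AE x in M. (\<lambda>i. \<bar>s i x - f x\<bar>) \<longlonglongrightarrow> 0"
        using tend by (intro AE_I2 tendsto_rabs_zero) (simp add: LIM_zero_iff)
      show "AE x in M. norm \<bar>s i x - f x\<bar> \<le> 3 * \<bar>f x\<bar>" for i
        using dom[of _ i] by (intro AE_I2) (fastforce simp: abs_if split: if_splits)
    qed (use lim in auto)
    have "\<bar>T f - (LINT x|M. f x * g x)\<bar> \<le> 2 * C * (LINT x|M. \<bar>s i x - f x\<bar>)" for i
    proof -
      have int: "integrable M (\<lambda>x. s i x - f x)" using lim by auto
      have "T (\<lambda>x. s i x + (-1) * f x) = T (s i) + T (\<lambda>x. (-1) * f x)"
        using lim by (intro assms(2)) auto
      then have "T (s i) - T f = T (\<lambda>x. s i x - f x)" using scale[of f "-1"] lim by simp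
      then have 1: "\<bar>T (s i) - T f\<bar> \<le> C * (LINT x|M. \<bar>s i x - f x\<bar>)"
        using bound[OF int] by simp
      have "(LINT x|M. s i x * g x) - (LINT x|M. f x * g x) = (LINT x|M. (s i x - f x) * g x)"
        using mult_int lim by (simp add: left_diff_distrib)
      also have "\<bar>\<dots>\<bar> \<le> (LINT x|M. C * \<bar>s i x - f x\<bar>)"
      proof (rule order_trans[OF integral_abs_bound integral_mono])
        show "\<bar>(s i x - f x) * g x\<bar> \<le> C * \<bar>s i x - f x\<bar>" for x
          using g_le[of x] by (simp add: abs_mult mult.commute mult_right_mono)
      qed (use int mult_int[OF int] in auto)
      finally have 2: "\<bar>(LINT x|M. s i x * g x) - (LINT x|M. f x * g x)\<bar> \<le> C * (LINT x|M. \<bar>s i x - f x\<bar>)" by simp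
      show ?thesis using 1 2 IH[of i] by linarith
    qed
    moreover have "(\<lambda>i. 2 * C * (LINT x|M. \<bar>s i x - f x\<bar>)) \<longlonglongrightarrow> 2 * C * 0"
      using d0 by (intro tendsto_mult tendsto_const) simp
    ultimately have "\<bar>T f - (LINT x|M. f x * g x)\<bar> \<le> 2 * C * 0"
      by (intro LIMSEQ_le_const) auto
    then show ?case by simp
  qed
  show ?thesis using that[OF gm g_le rep] .
qed

text \<open>Reduction to a finite measure: multiplication by a positive integrable \<open>h\<close>
  maps \<open>L1\<close> of the measure with density \<open>h\<close> isometrically onto
  \<open>L1\<close> of \<open>M\<close>, so the bound \<open>C\<close> survives the
  transport.\<close>

lemma (in sigma_finite_measure) bounded_functional_L1_representation_sigma_finite:
  fixes T :: "('a \<Rightarrow> real) \<Rightarrow> real"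
  assumes C: "0 \<le> C"
    and add: "\<And>f g. integrable M f \<Longrightarrow> integrable M g \<Longrightarrow> T (\<lambda>x. f x + g x) = T f + T g"
    and scale: "\<And>c f. integrable M f \<Longrightarrow> T (\<lambda>x. c * f x) = c * T f"
    and bound: "\<And>f. integrable M f \<Longrightarrow> \<bar>T f\<bar> \<le> C * (LINT x|M. \<bar>f x\<bar>)"
  obtains g where "g \<in> borel_measurable M" "\<And>x. \<bar>g x\<bar> \<le> C"
    "\<And>f. integrable M f \<Longrightarrow> T f = (LINT x|M. f x * g x)"
proof -
  obtain h0 where h0: "h0 \<in> borel_measurable M" "integral\<^sup>N M h0 \<noteq> \<infinity>" "\<And>x. x \<in> space M \<Longrightarrow> 0 < h0 x \<and> h0 x < \<infinity>"
    using Ex_finite_integrable_function by blast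
  \<comment> \<open>The value 1 outside the space makes \<open>h\<close> positive everywhere, so
    that dividing by \<open>h x\<close> needs no side condition.\<close>
  define h where "h = (\<lambda>x. if x \<in> space M then enn2real (h0 x) else 1)"
  have h [measurable]: "h \<in> borel_measurable M"
    unfolding h_def using h0(1) by measurable
  have h_pos: "0 < h x" for x using h0(3) by (auto simp: h_def enn2real_positive_iff)
  have h_eq: "ennreal (h x) = h0 x" if "x \<in> space M" for x
    using h0(3)[OF that] that by (simp add: h_def)
  define N where "N = density M (\<lambda>x. ennreal (h x))"
  have "finite_measure N"
  proof (rule finite_measureI)
    have "emeasure N (space N) = (\<integral>\<^sup>+x. ennreal (h x) \<partial>M)"
      by (simp add: N_def emeasure_density cong: nn_integral_cong)
    also have "\<dots> = integral\<^sup>N M h0" by (intro nn_integral_cong h_eq)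
    finally show "emeasure N (space N) \<noteq> \<infinity>" using h0(2) by simp
  qed
  then interpret N: finite_measure N .
  have mN [simp]: "f \<in> borel_measurable N \<longleftrightarrow> f \<in> borel_measurable M" for f :: "'a \<Rightarrow> real"
    by (simp add: N_def)
  have intN: "integrable N f \<longleftrightarrow> integrable M (\<lambda>x. h x * f x)" if "f \<in> borel_measurable M" for f
    unfolding N_def using that h_pos
    by (subst integrable_real_density) (auto intro: less_imp_le)
  have LintN: "(LINT x|N. f x) = (LINT x|M. h x * f x)" if "f \<in> borel_measurable M" for f
    unfolding N_def using that h_pos
    by (subst integral_real_density) (auto intro: less_imp_le)
  have intN': "integrable N f \<Longrightarrow> integrable M (\<lambda>x. h x * f x)" for f
    using intN borel_measurable_integrable[of N f] by simp
  obtain g where g: "g \<in> borel_measurable N" "\<And>x. \<bar>g x\<bar> \<le> C"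
    "\<And>f. integrable N f \<Longrightarrow> T (\<lambda>x. h x * f x) = (LINT x|N. f x * g x)"
  proof (rule N.bounded_functional_L1_representation[of C "\<lambda>f. T (\<lambda>x. h x * f x)"])
    show "T (\<lambda>x. h x * (f x + f' x)) = T (\<lambda>x. h x * f x) + T (\<lambda>x. h x * f' x)"
      if "integrable N f" "integrable N f'" for f f'
      using add[OF intN'[OF that(1)] intN'[OF that(2)]] by (simp add: algebra_simps)
    show "T (\<lambda>x. h x * (c * f x)) = c * T (\<lambda>x. h x * f x)" if "integrable N f" for c f
      using scale[OF intN'[OF that], of c] by (simp add: algebra_simps)
    show "\<bar>T (\<lambda>x. h x * f x)\<bar> \<le> C * (LINT x|N. \<bar>f x\<bar>)" if "integrable N f" for f
    proof -
      have "f \<in> borel_measurable M" using that borel_measurable_integrable[of N f] by simp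
      then show ?thesis using bound[OF intN'[OF that]] h_pos
        by (simp add: LintN abs_mult less_imp_le)
    qed
  qed (use C in auto)
  show ?thesis
  proof (rule that)
    show gm [measurable]: "g \<in> borel_measurable M" using g(1) by simp
    show "T f = (LINT x|M. f x * g x)" if f: "integrable M f" for f
    proof -
      have [measurable]: "f \<in> borel_measurable M" using f by auto
      have eq: "h x * (f x / h x) = f x" for x using h_pos[of x] by simp
      have "integrable N (\<lambda>x. f x / h x)"
        using f by (subst intN) (simp_all only: eq, measurable)
      then have "T (\<lambda>x. h x * (f x / h x)) = (LINT x|N. f x / h x * g x)" by (rule g(3))
      then have "T f = (LINT x|N. f x / h x * g x)" by (simp only: eq)
      also have "\<dots> = (LINT x|M. h x * (f x / h x * g x))" by (rule LintN) measurable
      also have "\<dots> = (LINT x|M. f x * g x)" by (simp only: eq flip: mult.assoc)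
      finally show ?thesis .
    qed
  qed (rule g(2))
qed

text \<open>For a functional that is known on test functions only: it is extended to
  \<open>L1\<close> by density, and the extension is represented.\<close>

lemma (in sigma_finite_measure) bounded_functional_dense_representation:
  fixes T :: "('a \<Rightarrow> real) \<Rightarrow> real" and A :: "('a \<Rightarrow> real) set"
  assumes C: "0 \<le> C"
    and A_int: "\<And>f. f \<in> A \<Longrightarrow> integrable M f"
    and A_add: "\<And>f g. f \<in> A \<Longrightarrow> g \<in> A \<Longrightarrow> (\<lambda>x. f x + g x) \<in> A"
    and A_scale: "\<And>c f. f \<in> A \<Longrightarrow> (\<lambda>x. c * f x) \<in> A"
    and dense: "\<And>f e. integrable M f \<Longrightarrow> 0 < e \<Longrightarrow> \<exists>a\<in>A. (LINT x|M. \<bar>a x - f x\<bar>) < e"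
    and add: "\<And>f g. f \<in> A \<Longrightarrow> g \<in> A \<Longrightarrow> T (\<lambda>x. f x + g x) = T f + T g"
    and scale: "\<And>c f. f \<in> A \<Longrightarrow> T (\<lambda>x. c * f x) = c * T f"
    and bound: "\<And>f. f \<in> A \<Longrightarrow> \<bar>T f\<bar> \<le> C * (LINT x|M. \<bar>f x\<bar>)"
  obtains g where "g \<in> borel_measurable M" "\<And>x. \<bar>g x\<bar> \<le> C"
    "\<And>f. f \<in> A \<Longrightarrow> T f = (LINT x|M. f x * g x)"
proof -
  define n1 where "n1 = (\<lambda>f. LINT x|M. \<bar>f x\<bar> :: real)"
  have n1_tri: "n1 (\<lambda>x. f x + g x) \<le> n1 f + n1 g" if "integrable M f" "integrable M g" for f g
  proof -
    have "n1 (\<lambda>x. f x + g x) \<le> (LINT x|M. \<bar>f x\<bar> + \<bar>g x\<bar>)"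
      unfolding n1_def using that by (intro integral_mono) auto
    then show ?thesis using that by (simp add: n1_def)
  qed
  have n1_diff: "n1 (\<lambda>x. f x - g x) \<le> n1 (\<lambda>x. f x - k x) + n1 (\<lambda>x. g x - k x)"
    if "integrable M f" "integrable M g" "integrable M k" for f g k
  proof -
    have "n1 (\<lambda>x. f x - g x) \<le> (LINT x|M. \<bar>f x - k x\<bar> + \<bar>g x - k x\<bar>)"
      unfolding n1_def using that by (intro integral_mono) auto
    then show ?thesis using that by (simp add: n1_def)
  qed
  have T_diff: "\<bar>T a - T b\<bar> \<le> C * n1 (\<lambda>x. a x - b x)" if "a \<in> A" "b \<in> A" for a b
  proof -
    have mb: "(\<lambda>x. (-1) * b x) \<in> A" by (rule A_scale[OF that(2)])
    have "T a - T b = T (\<lambda>x. a x + (-1) * b x)"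
      using add[OF that(1) mb] scale[OF that(2), of "-1"] by simp
    then show ?thesis using bound[OF A_add[OF that(1) mb]] by (simp add: n1_def)
  qed
  \<comment> \<open>This compares the value at \<open>f\<close> with the values on all of
    \<open>A\<close> at once, so that linearity and the bound follow from approximation without
    carrying a chosen sequence along.\<close>
  define ext where "ext = (\<lambda>f \<tau>. \<forall>a\<in>A. \<bar>T a - \<tau>\<bar> \<le> C * n1 (\<lambda>x. a x - f x))"
  have ex: "\<exists>\<tau>. ext f \<tau>" if f: "integrable M f" for f
  proof -
    have "\<exists>a. \<forall>k. a k \<in> A \<and> n1 (\<lambda>x. a k x - f x) < inverse (real (Suc k))"
      using dense[OF f] unfolding n1_def by (intro choice allI) (simp add: Bex_def)
    then obtain a where a: "\<And>k. a k \<in> A" "\<And>k. n1 (\<lambda>x. a k x - f x) < inverse (real (Suc k))" by blast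
    have ad: "\<bar>T b - T (a k)\<bar> \<le> C * (n1 (\<lambda>x. b x - f x) + inverse (real (Suc k)))" if "b \<in> A" for b k
    proof -
      have "\<bar>T b - T (a k)\<bar> \<le> C * n1 (\<lambda>x. b x - a k x)" by (rule T_diff[OF that a(1)])
      also have "n1 (\<lambda>x. b x - a k x) \<le> n1 (\<lambda>x. b x - f x) + n1 (\<lambda>x. a k x - f x)"
        using that a(1) A_int f by (intro n1_diff) auto
      also have "\<dots> \<le> n1 (\<lambda>x. b x - f x) + inverse (real (Suc k))" using a(2)[of k] by simp
      finally show ?thesis using C by (simp add: mult_left_mono)
    qed
    have "Cauchy (\<lambda>k. T (a k))"
    proof (rule metric_CauchyI)
      fix e :: real assume e: "0 < e"
      \<comment> \<open>The denominator contains \<open>C + 1\<close> because \<open>C\<close> may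
        be 0.\<close>
      obtain K where K: "inverse (real (Suc K)) < e / (2 * (C + 1))"
        using reals_Archimedean[of "e / (2 * (C + 1))"] e C by auto
      have "dist (T (a m)) (T (a n)) < e" if mn: "K \<le> m" "K \<le> n" for m n
      proof -
        have i: "inverse (real (Suc j)) < e / (2 * (C + 1))" if "K \<le> j" for j
          using K that by (smt (verit) inverse_le_imp_le le_imp_inverse_le of_nat_0_less_iff of_nat_mono Suc_le_mono zero_less_Suc)
        have "\<bar>T (a m) - T (a n)\<bar> \<le> C * (n1 (\<lambda>x. a m x - f x) + inverse (real (Suc n)))"
          by (rule ad[OF a(1)])
        also have "\<dots> \<le> C * (2 * (e / (2 * (C + 1))))"
          using a(2)[of m] i[OF mn(1)] i[OF mn(2)] C by (intro mult_left_mono) linarith+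
        also have "\<dots> < e" using C e by (simp add: field_simps)
        finally show ?thesis by (simp add: dist_real_def)
      qed
      then show "\<exists>K. \<forall>m\<ge>K. \<forall>n\<ge>K. dist (T (a m)) (T (a n)) < e" by blast
    qed
    then obtain \<tau> where \<tau>: "(\<lambda>k. T (a k)) \<longlonglongrightarrow> \<tau>" using convergent_eq_Cauchy by blast
    have "\<bar>T b - \<tau>\<bar> \<le> C * n1 (\<lambda>x. b x - f x)" if "b \<in> A" for b
    proof (rule LIMSEQ_le)
      show "(\<lambda>k. \<bar>T b - T (a k)\<bar>) \<longlonglongrightarrow> \<bar>T b - \<tau>\<bar>" by (intro tendsto_intros \<tau>)
      have "(\<lambda>k. C * (n1 (\<lambda>x. b x - f x) + inverse (real (Suc k)))) \<longlonglongrightarrow> C * (n1 (\<lambda>x. b x - f x) + 0)"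
        by (intro tendsto_intros LIMSEQ_inverse_real_of_nat)
      then show "(\<lambda>k. C * (n1 (\<lambda>x. b x - f x) + inverse (real (Suc k)))) \<longlonglongrightarrow> C * n1 (\<lambda>x. b x - f x)" by simp
    qed (use ad[OF that] in auto)
    then show ?thesis unfolding ext_def by blast
  qed
  define U where "U = (\<lambda>f. SOME \<tau>. ext f \<tau>)"
  have U: "\<bar>T a - U f\<bar> \<le> C * n1 (\<lambda>x. a x - f x)" if "integrable M f" "a \<in> A" for a f
    using someI_ex[OF ex[OF that(1)]] that(2) unfolding U_def ext_def by blast
  have UT: "U a = T a" if "a \<in> A" for a
    using U[OF A_int[OF that] that] by (simp add: n1_def)
  have dense': "\<exists>a\<in>A. C * n1 (\<lambda>x. a x - f x) \<le> e" if fe: "integrable M f" "0 < e" for f e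
  proof -
    obtain a where a: "a \<in> A" "n1 (\<lambda>x. a x - f x) < e / (C + 1)"
      using dense[OF fe(1), of "e / (C + 1)"] fe(2) C unfolding n1_def by auto
    have "C * n1 (\<lambda>x. a x - f x) \<le> C * (e / (C + 1))" using a C by (intro mult_left_mono) auto
    also have "\<dots> \<le> e" using C fe by (simp add: field_simps)
    finally show ?thesis using a by blast
  qed
  obtain g where g: "g \<in> borel_measurable M" "\<And>x. \<bar>g x\<bar> \<le> C"
    "\<And>f. integrable M f \<Longrightarrow> U f = (LINT x|M. f x * g x)"
  proof (rule bounded_functional_L1_representation_sigma_finite[OF C, of U])
    fix f g :: "'a \<Rightarrow> real" assume fg: "integrable M f" "integrable M g"
    have "\<bar>U (\<lambda>x. f x + g x) - (U f + U g)\<bar> \<le> e" if e: "0 < e" for e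
    proof -
      obtain a where a: "a \<in> A" "C * n1 (\<lambda>x. a x - f x) \<le> e / 4" using dense'[OF fg(1), of "e/4"] e by auto
      obtain b where b: "b \<in> A" "C * n1 (\<lambda>x. b x - g x) \<le> e / 4" using dense'[OF fg(2), of "e/4"] e by auto
      have ab: "\<bar>T (\<lambda>x. a x + b x) - U (\<lambda>x. f x + g x)\<bar> \<le> C * n1 (\<lambda>x. (a x + b x) - (f x + g x))"
        using fg by (intro U A_add a b) auto
      have "n1 (\<lambda>x. (a x + b x) - (f x + g x)) \<le> n1 (\<lambda>x. a x - f x) + n1 (\<lambda>x. b x - g x)"
        using n1_tri[of "\<lambda>x. a x - f x" "\<lambda>x. b x - g x"] fg a b A_int by (simp add: algebra_simps)
      then have "C * n1 (\<lambda>x. (a x + b x) - (f x + g x)) \<le> C * (n1 (\<lambda>x. a x - f x) + n1 (\<lambda>x. b x - g x))"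
        using C by (rule mult_left_mono)
      then show ?thesis
        using ab U[OF fg(1) a(1)] U[OF fg(2) b(1)] a(2) b(2) add[OF a(1) b(1)]
        unfolding distrib_left by linarith
    qed
    then have "\<bar>U (\<lambda>x. f x + g x) - (U f + U g)\<bar> \<le> 0" by (rule field_le_epsilon[of _ 0, simplified])
    then show "U (\<lambda>x. f x + g x) = U f + U g" by simp
  next
    fix c and f :: "'a \<Rightarrow> real" assume f: "integrable M f"
    have "\<bar>U (\<lambda>x. c * f x) - c * U f\<bar> \<le> e" if e: "0 < e" for e
    proof -
      obtain a where a: "a \<in> A" "C * n1 (\<lambda>x. a x - f x) \<le> e / (2 * (\<bar>c\<bar> + 1))"
        using dense'[OF f, of "e / (2 * (\<bar>c\<bar> + 1))"] e by (auto simp: pos_add_strict)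
      have ca: "\<bar>T (\<lambda>x. c * a x) - U (\<lambda>x. c * f x)\<bar> \<le> C * n1 (\<lambda>x. c * a x - c * f x)"
        using f by (intro U A_scale a) auto
      have "n1 (\<lambda>x. c * a x - c * f x) = \<bar>c\<bar> * n1 (\<lambda>x. a x - f x)"
        unfolding n1_def by (simp add: abs_mult flip: right_diff_distrib)
      then have 1: "\<bar>c * T a - U (\<lambda>x. c * f x)\<bar> \<le> \<bar>c\<bar> * (C * n1 (\<lambda>x. a x - f x))"
        using ca scale[OF a(1)] by (simp add: mult_ac)
      have "\<bar>c * T a - c * U f\<bar> = \<bar>c\<bar> * \<bar>T a - U f\<bar>" by (simp add: abs_mult flip: right_diff_distrib)
      also have "\<dots> \<le> \<bar>c\<bar> * (C * n1 (\<lambda>x. a x - f x))" by (intro mult_left_mono U f a) auto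
      finally have 2: "\<bar>c * T a - c * U f\<bar> \<le> \<bar>c\<bar> * (C * n1 (\<lambda>x. a x - f x))" .
      have "\<bar>c\<bar> * (C * n1 (\<lambda>x. a x - f x)) \<le> \<bar>c\<bar> * (e / (2 * (\<bar>c\<bar> + 1)))" by (intro mult_left_mono a) auto
      also have "\<dots> \<le> e / 2" using e by (simp add: field_simps)
      finally show ?thesis using 1 2 by linarith
    qed
    then have "\<bar>U (\<lambda>x. c * f x) - c * U f\<bar> \<le> 0" by (rule field_le_epsilon[of _ 0, simplified])
    then show "U (\<lambda>x. c * f x) = c * U f" by simp
  next
    fix f :: "'a \<Rightarrow> real" assume f: "integrable M f"
    have "\<bar>U f\<bar> \<le> C * n1 f + e" if e: "0 < e" for e
    proof -
      obtain a where a: "a \<in> A" "C * n1 (\<lambda>x. a x - f x) \<le> e / 2" using dense'[OF f, of "e/2"] e by auto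
      have "n1 a \<le> n1 f + n1 (\<lambda>x. a x - f x)"
        using n1_tri[of f "\<lambda>x. a x - f x"] f a A_int by simp
      then have "C * n1 a \<le> C * (n1 f + n1 (\<lambda>x. a x - f x))" using C by (rule mult_left_mono)
      moreover have "\<bar>T a\<bar> \<le> C * n1 a" using bound[OF a(1)] by (simp add: n1_def)
      ultimately show ?thesis using U[OF f a(1)] a(2)
        unfolding distrib_left by linarith
    qed
    then have "\<bar>U f\<bar> \<le> C * n1 f" by (rule field_le_epsilon)
    then show "\<bar>U f\<bar> \<le> C * (LINT x|M. \<bar>f x\<bar>)" by (simp add: n1_def)
  qed blast
  show ?thesis using that[OF g(1,2)] g(3) UT A_int by metis
qed

section \<open>Lipschitz graphs\<close>

text \<open>For a unit vector \<open>e\<close> this is the orthogonal projection to the hyperplane,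
  that is, the part \<open>x'\<close> of the local coordinates; \<open>x \<bullet> e\<close> is the
  remaining coordinate.\<close>

definition perp :: "'a::real_inner \<Rightarrow> 'a \<Rightarrow> 'a" where
  "perp e x = x - (x \<bullet> e) *\<^sub>R e"

lemma perp_inner: "norm e = 1 \<Longrightarrow> perp e x \<bullet> e = 0"
  by (simp add: perp_def inner_diff_left norm_eq_1)

lemma perp_decomp: "perp e x + (x \<bullet> e) *\<^sub>R e = x"
  by (simp add: perp_def)

lemma perp_diff: "perp e (x - y) = perp e x - perp e y"
  by (simp add: perp_def inner_diff_left scaleR_diff_left)

lemma perp_add_scaled: "norm e = 1 \<Longrightarrow> perp e (x + t *\<^sub>R e) = perp e x"
  by (simp add: perp_def inner_add_left scaleR_add_left norm_eq_1)

lemma perp_of_orthogonal: "y \<bullet> e = 0 \<Longrightarrow> perp e y = y"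
  by (simp add: perp_def)

lemma norm_perp_le:
  assumes "norm e = 1"
  shows "norm (perp e x) \<le> norm x"
proof -
  have "(norm x)\<^sup>2 = (norm (perp e x))\<^sup>2 + (norm ((x \<bullet> e) *\<^sub>R e))\<^sup>2"
    using norm_add_Pythagorean[of "perp e x" "(x \<bullet> e) *\<^sub>R e"] perp_inner[OF assms]
    by (simp add: orthogonal_def perp_decomp)
  then show ?thesis by (smt (verit) norm_ge_zero power2_le_imp_le zero_le_power2)
qed

lemma abs_inner_unit_le: "norm e = 1 \<Longrightarrow> \<bar>x \<bullet> e\<bar> \<le> norm x"
  using Cauchy_Schwarz_ineq2[of x e] by simp

text \<open>The part of the graph condition that the proof uses: near \<open>z\<close> the set \<open>\<Gamma>\<close> is the graph of an
  \<open>L\<close>-Lipschitz function over the hyperplane orthogonal to \<open>e\<close>.\<close>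

definition Lipschitz_graph_at ::
    "real \<Rightarrow> real \<Rightarrow> (real ^ 'n) set \<Rightarrow> real ^ 'n \<Rightarrow> real ^ 'n \<Rightarrow> (real ^ 'n \<Rightarrow> real) \<Rightarrow> bool" where
  "Lipschitz_graph_at L R \<Gamma> z e h \<longleftrightarrow>
     norm e = 1 \<and> h 0 = 0 \<and>
     (\<forall>y \<in> hyper_disc e R. \<forall>y' \<in> hyper_disc e R. \<bar>h y - h y'\<bar> \<le> L * norm (y - y')) \<and>
     (\<forall>x. dist z x < R \<longrightarrow> (x \<in> \<Gamma> \<longleftrightarrow> (x - z) \<bullet> e = h (perp e (x - z))))"

text \<open>The mean value inequality on the disc, which is convex as the intersection of a
  hyperplane and a ball.\<close>

lemma C1_Hoelder_graph_function_Lipschitz: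
  assumes h: "C1_Hoelder_graph_function \<beta> r L e h"
    and y: "y \<in> hyper_disc e r" "y' \<in> hyper_disc e r"
  shows "\<bar>h y - h y'\<bar> \<le> L * norm (y - y')"
proof -
  obtain G where G: "\<And>y. y \<in> hyper_disc e r \<Longrightarrow> (h has_derivative (\<lambda>k. G y \<bullet> k)) (at y within hyper_disc e r)"
    "\<And>y. y \<in> hyper_disc e r \<Longrightarrow> norm (G y) \<le> L"
    using h unfolding C1_Hoelder_graph_function_def by blast
  have cvx: "convex (hyper_disc e r)"
  proof -
    have "hyper_disc e r = {y. e \<bullet> y = 0} \<inter> cball 0 r"
      by (auto simp: hyper_disc_def inner_commute)
    then show ?thesis by (simp add: convex_Int convex_hyperplane)
  qed
  have "norm (h y - h y') \<le> L * norm (y - y')"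
  proof (rule differentiable_bound[OF cvx G(1)])
    fix x assume x: "x \<in> hyper_disc e r"
    show "onorm (\<lambda>k. G x \<bullet> k) \<le> L"
    proof (rule onorm_bound)
      show "0 \<le> L" using G(2)[OF x] norm_ge_zero order_trans by blast
      show "norm (G x \<bullet> k) \<le> L * norm k" for k
        using Cauchy_Schwarz_ineq2[of "G x" k] mult_right_mono[OF G(2)[OF x], of "norm k"] by simp
    qed
  qed (use y in auto)
  then show ?thesis by simp
qed

lemma uniformly_C1_Hoelder_domain_Lipschitz:
  assumes "uniformly_C1_Hoelder_domain \<beta> \<Omega>"
  obtains L R where "0 < L" "0 < R" "\<And>z. z \<in> frontier \<Omega> \<Longrightarrow> \<exists>e h. Lipschitz_graph_at L R (frontier \<Omega>) z e h"
proof -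
  from assms have "\<exists>r d L. r > 0 \<and> d > 0 \<and> L > 0 \<and>
       (\<forall>z \<in> frontier \<Omega>. \<exists>e h.
          norm e = 1 \<and> C1_Hoelder_graph_function \<beta> r L e h \<and>
          (let U = graph_slab z e r (\<lambda>y t. h y - d < t \<and> t < h y + d) in
             \<Omega> \<inter> U = graph_slab z e r (\<lambda>y t. h y < t \<and> t < h y + d) \<and>
             frontier \<Omega> \<inter> U = graph_slab z e r (\<lambda>y t. t = h y)))"
    unfolding uniformly_C1_Hoelder_domain_def by (elim conjE)
  then obtain r d L where pos: "0 < r" "0 < d" "0 < L" and charts: "\<forall>z \<in> frontier \<Omega>. \<exists>e h.
          norm e = 1 \<and> C1_Hoelder_graph_function \<beta> r L e h \<and>
          (let U = graph_slab z e r (\<lambda>y t. h y - d < t \<and> t < h y + d) in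
             \<Omega> \<inter> U = graph_slab z e r (\<lambda>y t. h y < t \<and> t < h y + d) \<and>
             frontier \<Omega> \<inter> U = graph_slab z e r (\<lambda>y t. t = h y))"
    by (elim exE conjE)
  \<comment> \<open>A point at distance less than \<open>R\<close> from \<open>z\<close> differs in
    height from the graph by less than \<open>(1 + L) * R \<le> d\<close>. So the ball of radius
    \<open>R\<close> lies in the slab in which the graph describes the boundary.\<close>
  define R where "R = min r (d / (1 + L))"
  have R: "0 < R" "R \<le> r" "(1 + L) * R \<le> d"
  proof -
    have "(1 + L) * R \<le> (1 + L) * (d / (1 + L))" unfolding R_def using pos by (intro mult_left_mono) auto
    then show "(1 + L) * R \<le> d" using pos by simp
  qed (use pos in \<open>auto simp: R_def\<close>)
  show ?thesis
  proof (rule that[OF pos(3) R(1)])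
    fix z assume "z \<in> frontier \<Omega>"
    from bspec[OF charts this] obtain e h where e: "norm e = 1" and h: "C1_Hoelder_graph_function \<beta> r L e h" and
      fr: "frontier \<Omega> \<inter> graph_slab z e r (\<lambda>y t. h y - d < t \<and> t < h y + d) = graph_slab z e r (\<lambda>y t. t = h y)"
      unfolding Let_def by (elim exE conjE)
    have h0: "h 0 = 0" using h by (auto simp: C1_Hoelder_graph_function_def)
    have lip: "\<bar>h y - h y'\<bar> \<le> L * norm (y - y')" if "y \<in> hyper_disc e R" "y' \<in> hyper_disc e R" for y y'
      by (rule C1_Hoelder_graph_function_Lipschitz[OF h]) (use that R(2) in \<open>auto simp: hyper_disc_def\<close>)
    have slab: "z + v \<in> graph_slab z e r P \<longleftrightarrow> norm (perp e v) < r \<and> P (perp e v) (v \<bullet> e)" for v P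
    proof
      assume "z + v \<in> graph_slab z e r P"
      then obtain y t where *: "z + v = z + y + t *\<^sub>R e" "y \<bullet> e = 0" "norm y < r" "P y t"
        unfolding graph_slab_def by blast
      then have "v = y + t *\<^sub>R e" by (simp add: add.assoc)
      then have "perp e v = y" "v \<bullet> e = t"
        using e *(2) by (auto simp: perp_add_scaled perp_of_orthogonal inner_add_left norm_eq_1)
      then show "norm (perp e v) < r \<and> P (perp e v) (v \<bullet> e)" using * by simp
    next
      assume *: "norm (perp e v) < r \<and> P (perp e v) (v \<bullet> e)"
      have "z + v = z + perp e v + (v \<bullet> e) *\<^sub>R e" by (simp add: perp_decomp add.assoc)
      then show "z + v \<in> graph_slab z e r P"
        unfolding graph_slab_def using * perp_inner[OF e] by blast
    qed
    have "x \<in> frontier \<Omega> \<longleftrightarrow> (x - z) \<bullet> e = h (perp e (x - z))" if "dist z x < R" for x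
    proof -
      define v where "v = x - z"
      have v: "norm v < R" using that by (simp add: v_def dist_norm norm_minus_commute)
      have pv: "norm (perp e v) \<le> norm v" by (rule norm_perp_le[OF e])
      have "perp e v \<in> hyper_disc e R" "0 \<in> hyper_disc e R"
        using pv v R(1) perp_inner[OF e] by (auto simp: hyper_disc_def)
      from lip[OF this] h0 have "\<bar>h (perp e v)\<bar> \<le> L * norm (perp e v)" by simp
      also have "\<dots> \<le> L * norm v" using pv pos(3) by (intro mult_left_mono) auto
      finally have "\<bar>v \<bullet> e - h (perp e v)\<bar> \<le> (1 + L) * norm v"
        using abs_inner_unit_le[OF e, of v] by (simp add: algebra_simps)
      also have "\<dots> < (1 + L) * R" using v pos(3) by simp
      finally have "\<bar>v \<bullet> e - h (perp e v)\<bar> < d" using R(3) by linarith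
      then have "z + v \<in> graph_slab z e r (\<lambda>y t. h y - d < t \<and> t < h y + d)"
        unfolding slab using pv v R(2) by (auto simp: abs_less_iff)
      moreover have "z + v \<in> graph_slab z e r (\<lambda>y t. t = h y) \<longleftrightarrow> v \<bullet> e = h (perp e v)"
        unfolding slab using pv v R(2) by auto
      ultimately have "z + v \<in> frontier \<Omega> \<longleftrightarrow> v \<bullet> e = h (perp e v)" using fr by blast
      then show ?thesis by (simp add: v_def)
    qed
    then show "\<exists>e h. Lipschitz_graph_at L R (frontier \<Omega>) z e h"
      unfolding Lipschitz_graph_at_def using e h0 lip by (intro exI[of _ e] exI[of _ h]) simp
  qed
qed

section \<open>Lower bound for the Hausdorff measure of a graph\<close>

text \<open>Sweeping \<open>C\<close> along \<open>e\<close> by the length \<open>r\<close> in both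
  directions gives a tube. With \<open>d = diameter C\<close>, about \<open>r / d\<close> balls of
  radius \<open>2 * d\<close> cover it, and their total volume is of order
  \<open>r * d ^ (n - 1)\<close>: up to a constant, \<open>r\<close> times the weight of
  \<open>C\<close> in the Hausdorff measure.\<close>

lemma tube_measure_le:
  fixes e :: "'a::euclidean_space"
  assumes C: "C \<noteq> {}" "bounded C" "diameter C \<le> r" and r: "0 < r" and e: "norm e = 1" and n: "2 \<le> DIM('a)"
  obtains T where "T \<in> sets borel" "\<And>p s. p \<in> C \<Longrightarrow> \<bar>s\<bar> \<le> r \<Longrightarrow> p + s *\<^sub>R e \<in> T"
    "emeasure lborel T \<le> ennreal (5 * 2 ^ DIM('a) * unit_ball_vol (real DIM('a)) * r * diameter C ^ (DIM('a) - 1))"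
proof -
  define d where "d = diameter C"
  obtain p0 where p0: "p0 \<in> C" using C(1) by blast
  have pd: "dist p p0 \<le> d" if "p \<in> C" for p
    unfolding d_def by (rule diameter_bounded_bound[OF C(2) that p0])
  show ?thesis
  \<comment> \<open>For a single point the claimed bound is 0. Its tube is a segment, which is a
    null set in dimension at least 2.\<close>
  proof (cases "d = 0")
    case True
    define T where "T = closed_segment (p0 + (- r) *\<^sub>R e) (p0 + r *\<^sub>R e)"
    have "negligible T"
      unfolding T_def using n by (intro negligible_convex_interior[THEN iffD2] interior_closed_segment_ge2) auto
    then have "emeasure lborel T = 0"
      by (simp add: T_def negligible_iff_emeasure0)
    moreover have "p + s *\<^sub>R e \<in> T" if "p \<in> C" "\<bar>s\<bar> \<le> r" for p s
    proof -
      have "p = p0" using pd[OF that(1)] True by simp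
      moreover have "p0 + s *\<^sub>R e = (1 - (s + r) / (2 * r)) *\<^sub>R (p0 + (- r) *\<^sub>R e) + ((s + r) / (2 * r)) *\<^sub>R (p0 + r *\<^sub>R e)"
      proof -
        have "(1 - c) *\<^sub>R (p0 + (- r) *\<^sub>R e) + c *\<^sub>R (p0 + r *\<^sub>R e)
            = ((1 - c) + c) *\<^sub>R p0 + ((1 - c) * (- r) + c * r) *\<^sub>R e" for c
          by (simp only: scaleR_add_right scaleR_add_left scaleR_scaleR add_ac)
        moreover have "(1 - (s + r) / (2 * r)) * (- r) + (s + r) / (2 * r) * r = s" using r by (simp add: field_simps)
        ultimately show ?thesis by simp
      qed
      moreover have "0 \<le> (s + r) / (2 * r)" "(s + r) / (2 * r) \<le> 1" using r that(2) by (auto simp: abs_le_iff)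
      ultimately show ?thesis unfolding T_def closed_segment_def by blast
    qed
    ultimately show ?thesis by (intro that[of T]) (auto simp: T_def)
  next
    case False
    then have d: "0 < d" unfolding d_def using diameter_ge_0[OF C(2)] by linarith
    have dr: "d \<le> r" using C(3) by (simp add: d_def)
    define m where "m = \<lceil>r / d\<rceil>"
    define T where "T = (\<Union>k\<in>{-m..m}. cball (p0 + (of_int k * d) *\<^sub>R e) (2 * d))"
    have m: "0 \<le> m" "of_int m \<le> r / d + 1" unfolding m_def using divide_pos_pos[OF r d] by linarith+
    have "p + s *\<^sub>R e \<in> T" if "p \<in> C" "\<bar>s\<bar> \<le> r" for p s
    proof -
      define k where "k = \<lfloor>s / d\<rfloor>"
      have sd: "- (r / d) \<le> s / d" "s / d \<le> r / d" using that(2) d by (auto simp: field_simps)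
      have k: "k \<in> {-m..m}"
        unfolding k_def m_def using sd by (auto simp: le_floor_iff) (linarith, linarith)
      have "of_int k \<le> s / d" "s / d \<le> of_int k + 1" unfolding k_def by linarith+
      then have "of_int k * d \<le> s" "s \<le> of_int k * d + d" using d by (auto simp: field_simps)
      then have sk: "\<bar>of_int k * d - s\<bar> \<le> d" by linarith
      have "p0 + (of_int k * d) *\<^sub>R e - (p + s *\<^sub>R e) = (p0 - p) + (of_int k * d - s) *\<^sub>R e"
        by (simp add: scaleR_diff_left)
      then have "dist (p0 + (of_int k * d) *\<^sub>R e) (p + s *\<^sub>R e) = norm ((p0 - p) + (of_int k * d - s) *\<^sub>R e)"
        by (simp only: dist_norm)
      also have "\<dots> \<le> norm (p0 - p) + \<bar>of_int k * d - s\<bar>"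
        using norm_triangle_ineq[of "p0 - p" "(of_int k * d - s) *\<^sub>R e"] e by simp
      also have "\<dots> \<le> 2 * d" using sk pd[OF that(1)] by (simp add: dist_norm norm_minus_commute)
      finally show ?thesis unfolding T_def using k by auto
    qed
    moreover have "T \<in> sets borel" unfolding T_def by (intro sets.finite_UN) auto
    moreover have "emeasure lborel T \<le> ennreal (5 * 2 ^ DIM('a) * unit_ball_vol (real DIM('a)) * r * diameter C ^ (DIM('a) - 1))"
    proof -
      have "emeasure lborel T \<le> (\<Sum>k\<in>{-m..m}. emeasure lborel (cball (p0 + (of_int k * d) *\<^sub>R e) (2 * d)))"
        unfolding T_def by (intro emeasure_subadditive_finite) auto
      also have "\<dots> = (\<Sum>k\<in>{-m..m}. ennreal (unit_ball_vol (real DIM('a)) * (2 * d) ^ DIM('a)))"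
        using d by (simp add: emeasure_cball)
      also have "\<dots> = ennreal (\<Sum>k\<in>{-m..m}. unit_ball_vol (real DIM('a)) * (2 * d) ^ DIM('a))"
        using d by (intro sum_ennreal) auto
      also have "(\<Sum>k\<in>{-m..m}. unit_ball_vol (real DIM('a)) * (2 * d) ^ DIM('a))
          = (2 * of_int m + 1) * (unit_ball_vol (real DIM('a)) * (2 * d) ^ DIM('a))"
        using m(1) by simp
      \<comment> \<open>\<open>2 * m + 1 \<le> 2 * r / d + 3 \<le> 5 * r / d\<close>, since
        \<open>d \<le> r\<close>.\<close>
      also have "\<dots> \<le> (5 * r / d) * (unit_ball_vol (real DIM('a)) * (2 * d) ^ DIM('a))"
      proof (rule mult_right_mono)
        have "1 \<le> r / d" using dr d by simp
        then show "2 * of_int m + 1 \<le> 5 * r / d" using m(2) by simp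
      qed (use d in auto)
      also have "\<dots> = 5 * 2 ^ DIM('a) * unit_ball_vol (real DIM('a)) * r * d ^ (DIM('a) - 1)"
        using d n by (cases "DIM('a)") (auto simp: power_mult_distrib)
      finally show ?thesis by (simp add: d_def ennreal_leI)
    qed
    ultimately show ?thesis by (intro that[of T]) auto
  qed
qed

text \<open>The tubes over any cover of the graph piece by small sets fill a solid ball. By
  \<open>tube_measure_le\<close> the volume of this ball is therefore a lower bound, up to constants
  and a factor \<open>r\<close>, for the sum of the weights.\<close>

lemma Lipschitz_graph_hausdorff_lower:
  fixes z :: "real ^ 'n"
  assumes G: "Lipschitz_graph_at L R \<Gamma> z e h" and L: "0 < L" and r: "0 < r" "r \<le> R" and n: "2 \<le> CARD('n)"
  shows "ennreal (unit_ball_vol (real (CARD('n) - 1)) / (5 * 4 ^ CARD('n) * (1 + L) ^ CARD('n)) * r ^ (CARD('n) - 1))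
    \<le> hausdorff_outer (CARD('n) - 1) (\<Gamma> \<inter> cball z r)"
proof -
  let ?n = "CARD('n)" let ?s = "CARD('n) - 1"
  define \<omega> where "\<omega> = unit_ball_vol (real ?n)"
  define \<omega>' where "\<omega>' = unit_ball_vol (real ?s)"
  have om: "0 < \<omega>" "0 < \<omega>'" by (simp_all add: \<omega>_def \<omega>'_def)
  \<comment> \<open>A point within \<open>a\<close> of \<open>z\<close> has a graph point on its
    vertical line that is within \<open>(1 + L) * a = r\<close> of \<open>z\<close> and at a
    vertical distance of at most \<open>r\<close>.\<close>
  define a where "a = r / (1 + L)"
  have a: "0 < a" "(1 + L) * a = r" using r L by (auto simp: a_def)
  have e: "norm e = 1" and h0: "h 0 = 0" using G by (auto simp: Lipschitz_graph_at_def)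
  have tube: "\<exists>p\<in>\<Gamma> \<inter> cball z r. \<exists>s. \<bar>s\<bar> \<le> r \<and> x = p + s *\<^sub>R e" if x: "x \<in> ball z a" for x
  proof -
    define v where "v = x - z"
    define y where "y = perp e v"
    have v: "norm v < a" using x by (simp add: v_def dist_norm norm_minus_commute)
    have y: "norm y \<le> norm v" "y \<bullet> e = 0" unfolding y_def using norm_perp_le[OF e] perp_inner[OF e] by auto
    have "a \<le> r" using a L by (simp add: a_def field_simps)
    then have "y \<in> hyper_disc e R" "0 \<in> hyper_disc e R" using y v r by (auto simp: hyper_disc_def)
    then have "\<bar>h y - h 0\<bar> \<le> L * norm (y - 0)" using G unfolding Lipschitz_graph_at_def by blast
    then have "\<bar>h y\<bar> \<le> L * norm y" using h0 by simp
    also have "\<dots> \<le> L * norm v" using y(1) L by simp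
    finally have hv: "\<bar>h y\<bar> \<le> L * norm v" .
    have lt: "(1 + L) * norm v < r" using mult_strict_left_mono[OF v, of "1 + L"] L a(2) by simp
    define p where "p = z + y + h y *\<^sub>R e"
    have "norm (p - z) \<le> norm y + \<bar>h y\<bar>" using norm_triangle_ineq[of y "h y *\<^sub>R e"] e by (simp add: p_def)
    also have "\<dots> \<le> (1 + L) * norm v" using y(1) hv by (simp add: algebra_simps)
    finally have pz: "dist z p < r" using lt by (simp add: dist_norm norm_minus_commute)
    have "perp e (p - z) = y" "(p - z) \<bullet> e = h y"
      using y e by (auto simp: p_def perp_add_scaled perp_of_orthogonal inner_add_left norm_eq_1)
    moreover have "dist z p < R" using pz r by simp
    ultimately have "p \<in> \<Gamma>" using G unfolding Lipschitz_graph_at_def by metis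
    moreover have "x = p + (v \<bullet> e - h y) *\<^sub>R e"
      using perp_decomp[of e v] by (simp add: p_def y_def v_def algebra_simps)
    moreover have "\<bar>v \<bullet> e - h y\<bar> \<le> r"
      using abs_inner_unit_le[OF e, of v] hv lt by (simp add: algebra_simps)
    ultimately show ?thesis using pz by (metis IntI mem_cball less_imp_le)
  qed
  define K where "K = 5 * 2 ^ ?n * \<omega> * r"
  have K: "0 < K" using om r by (simp add: K_def)
  \<comment> \<open>The premeasure at scale \<open>r\<close> is a lower bound for the Hausdorff
    measure, and its covers have the diameters that the tube estimate demands.\<close>
  have "ennreal (\<omega>' / (5 * 4 ^ ?n * (1 + L) ^ ?n) * r ^ ?s) \<le> hausdorff_pre ?s r (\<Gamma> \<inter> cball z r)"
  proof (rule hausdorff_pre_greatest)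
    fix C :: "nat \<Rightarrow> (real ^ 'n) set"
    assume C: "\<Gamma> \<inter> cball z r \<subseteq> (\<Union>i. C i)" "\<And>i. bounded (C i)" "\<And>i. diameter (C i) \<le> r"
    have "\<exists>T. T \<in> sets borel \<and> (\<forall>p s. p \<in> C i \<longrightarrow> \<bar>s\<bar> \<le> r \<longrightarrow> p + s *\<^sub>R e \<in> T) \<and>
        emeasure lborel T \<le> ennreal (K * 2 ^ ?s / \<omega>') * hausdorff_weight ?s (C i)" for i
    proof (cases "C i = {}")
      case False
      obtain T where T: "T \<in> sets borel" "\<And>p s. p \<in> C i \<Longrightarrow> \<bar>s\<bar> \<le> r \<Longrightarrow> p + s *\<^sub>R e \<in> T"
        "emeasure lborel T \<le> ennreal (5 * 2 ^ DIM(real^'n) * unit_ball_vol (real DIM(real^'n)) * r * diameter (C i) ^ (DIM(real^'n) - 1))"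
        by (rule tube_measure_le[OF False C(2,3) r(1) e]) (use n in auto)
      have "ennreal (K * 2 ^ ?s / \<omega>') * hausdorff_weight ?s (C i) = ennreal (K * 2 ^ ?s / \<omega>' * (\<omega>' * (diameter (C i) / 2) ^ ?s))"
      proof -
        have "hausdorff_weight ?s (C i) = ennreal (\<omega>' * (diameter (C i) / 2) ^ ?s)"
          by (simp only: hausdorff_weight_def False if_False \<omega>'_def)
        then show ?thesis
          using K om diameter_ge_0[OF C(2)[of i]] ennreal_mult[of "K * 2 ^ ?s / \<omega>'" "\<omega>' * (diameter (C i) / 2) ^ ?s"]
          by simp
      qed
      also have "K * 2 ^ ?s / \<omega>' * (\<omega>' * (diameter (C i) / 2) ^ ?s) = K * diameter (C i) ^ ?s"
        using om by (simp add: power_divide)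
      finally show ?thesis using T by (intro exI[of _ T]) (auto simp: K_def \<omega>_def)
    qed (auto intro!: exI[of _ "{}"])
    then obtain T where T: "\<And>i. T i \<in> sets borel" "\<And>i p s. p \<in> C i \<Longrightarrow> \<bar>s\<bar> \<le> r \<Longrightarrow> p + s *\<^sub>R e \<in> T i"
      "\<And>i. emeasure lborel (T i) \<le> ennreal (K * 2 ^ ?s / \<omega>') * hausdorff_weight ?s (C i)" by metis
    have "ennreal (\<omega> * a ^ ?n) = emeasure lborel (ball z a)"
      using a by (simp add: emeasure_ball \<omega>_def)
    also have "\<dots> \<le> emeasure lborel (\<Union>i. T i)"
    proof (rule emeasure_mono)
      show "ball z a \<subseteq> (\<Union>i. T i)"
      proof
        fix x assume "x \<in> ball z a"
        from tube[OF this] obtain p s where p: "p \<in> \<Gamma> \<inter> cball z r" "\<bar>s\<bar> \<le> r" "x = p + s *\<^sub>R e" by blast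
        then obtain i where "p \<in> C i" using subsetD[OF C(1) p(1)] by blast
        then show "x \<in> (\<Union>i. T i)" using T(2)[of p i s] p by blast
      qed
    qed (use T(1) in auto)
    also have "\<dots> \<le> (\<Sum>i. emeasure lborel (T i))"
      using T(1) by (intro emeasure_subadditive_countably) auto
    also have "\<dots> \<le> (\<Sum>i. ennreal (K * 2 ^ ?s / \<omega>') * hausdorff_weight ?s (C i))"
      by (rule suminf_le[OF T(3)]) (rule summableI)+
    also have "\<dots> = ennreal (K * 2 ^ ?s / \<omega>') * (\<Sum>i. hausdorff_weight ?s (C i))"
      by (rule ennreal_suminf_cmult)
    finally have le: "ennreal (\<omega> * a ^ ?n) \<le> ennreal (K * 2 ^ ?s / \<omega>') * (\<Sum>i. hausdorff_weight ?s (C i))" .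
    have "\<omega>' / (5 * 4 ^ ?n * (1 + L) ^ ?n) * r ^ ?s \<le> \<omega>' / (K * 2 ^ ?s) * (\<omega> * a ^ ?n)"
    proof -
      obtain k where k: "?n = Suc k" using n by (cases ?n) auto
      \<comment> \<open>The computation yields exactly twice the constant of the statement; the
        factor 2 is given away for a simpler denominator.\<close>
      have "\<omega>' / (K * 2 ^ ?s) * (\<omega> * a ^ ?n) = 2 * (\<omega>' / (5 * 4 ^ ?n * (1 + L) ^ ?n) * r ^ ?s)"
      proof -
        have "(4 :: real) ^ k = 2 ^ k * 2 ^ k" by (simp flip: power_mult_distrib)
        moreover define q where "q = 1 + L"
        moreover have "0 < q" using L by (simp add: q_def)
        ultimately show ?thesis
          using om r unfolding K_def a_def k q_def[symmetric] by (simp add: power_divide field_simps)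
      qed
      moreover have "0 \<le> \<omega>' / (5 * 4 ^ ?n * (1 + L) ^ ?n) * r ^ ?s" using om L r by simp
      ultimately show ?thesis by linarith
    qed
    then have "ennreal (\<omega>' / (5 * 4 ^ ?n * (1 + L) ^ ?n) * r ^ ?s) \<le> ennreal (\<omega>' / (K * 2 ^ ?s)) * ennreal (\<omega> * a ^ ?n)"
      using om K a by (simp add: ennreal_leI flip: ennreal_mult)
    also have "\<dots> \<le> ennreal (\<omega>' / (K * 2 ^ ?s)) * (ennreal (K * 2 ^ ?s / \<omega>') * (\<Sum>i. hausdorff_weight ?s (C i)))"
      by (intro mult_left_mono le) auto
    also have "\<dots> = (\<Sum>i. hausdorff_weight ?s (C i))"
      using om K by (simp add: mult.assoc[symmetric] flip: ennreal_mult)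
    finally show "ennreal (\<omega>' / (5 * 4 ^ ?n * (1 + L) ^ ?n) * r ^ ?s) \<le> (\<Sum>i. hausdorff_weight ?s (C i))" .
  qed
  also have "\<dots> \<le> hausdorff_outer ?s (\<Gamma> \<inter> cball z r)" by (rule hausdorff_pre_le_outer[OF r(1)])
  finally show ?thesis unfolding \<omega>'_def .
qed

section \<open>Covering, packing and local finiteness of the surface\<close>

lemma compact_finite_ball_cover:
  fixes S :: "'a::metric_space set"
  assumes "compact S" "0 < r"
  shows "\<exists>F. F \<subseteq> S \<and> finite F \<and> S \<subseteq> (\<Union>x\<in>F. ball x r)"
proof (rule compactE_image[OF assms(1), of S "\<lambda>x. ball x r"])
  show "S \<subseteq> (\<Union>x\<in>S. ball x r)" using assms(2) by auto
qed auto

text \<open>Vitali's lemma for equal radii, with dilation factor 5. Compactness of the closure gives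
  a finite cover to start from, hence a finite disjoint subfamily.\<close>

lemma finite_separated_net:
  fixes A :: "'a::euclidean_space set"
  assumes "bounded A" "0 < \<rho>"
  obtains Z where "finite Z" "Z \<subseteq> A" "A \<subseteq> (\<Union>z\<in>Z. cball z (5 * \<rho>))"
    "pairwise (\<lambda>z z'. disjnt (cball z \<rho>) (cball z' \<rho>)) Z"
proof -
  have "closure A \<subseteq> (\<Union>a\<in>A. ball a \<rho>)"
    using assms(2) by (force simp: closure_approachable dist_commute)
  then obtain F where F: "F \<subseteq> A" "finite F" "closure A \<subseteq> (\<Union>a\<in>F. ball a \<rho>)"
    using compactE_image[of "closure A" A "\<lambda>a. ball a \<rho>"] assms(1) by auto
  have "A \<subseteq> (\<Union>a\<in>F. cball a \<rho>)" using F(3) closure_subset[of A] ball_subset_cball by blast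
  then obtain C where "C \<subseteq> F" "pairwise (\<lambda>i j. disjnt (cball i \<rho>) (cball j \<rho>)) C" "A \<subseteq> (\<Union>i\<in>C. cball i (5 * \<rho>))"
    by (rule Vitali_covering_lemma_cballs[where a="\<lambda>x. x" and r="\<lambda>_. \<rho>" and B=\<rho>])
      (use assms(2) in auto)
  then show ?thesis using F that[of C] finite_subset by blast
qed

lemma hausdorff_pre_le_cball_cover:
  assumes Z: "finite Z" "A \<subseteq> (\<Union>z\<in>Z. cball z \<rho>)" and \<rho>: "0 < \<rho>" "2 * \<rho> \<le> \<epsilon>"
  shows "hausdorff_pre s \<epsilon> (A :: 'a::euclidean_space set) \<le> ennreal (real (card Z) * (unit_ball_vol (real s) * \<rho> ^ s))"
proof -
  obtain f where f: "bij_betw f {0..<card Z} Z" using ex_bij_betw_nat_finite[OF Z(1)] by blast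
  define C where "C = (\<lambda>i. if i < card Z then cball (f i) \<rho> else {})"
  have "hausdorff_pre s \<epsilon> A \<le> (\<Sum>i. hausdorff_weight s (C i))"
  proof (rule hausdorff_pre_le)
    show "A \<subseteq> (\<Union>i. C i)"
    proof
      fix x assume "x \<in> A"
      then obtain z where "z \<in> Z" "x \<in> cball z \<rho>" using Z(2) by blast
      moreover from this obtain i where "i < card Z" "z = f i"
        using f unfolding bij_betw_def by (metis atLeastLessThan_iff imageE)
      ultimately show "x \<in> (\<Union>i. C i)" by (auto simp: C_def)
    qed
  qed (use \<rho> in \<open>auto simp: C_def diameter_cball\<close>)
  also have "\<dots> = (\<Sum>i<card Z. hausdorff_weight s (C i))"
    by (rule suminf_finite) (auto simp: C_def hausdorff_weight_def)
  also have "\<dots> = (\<Sum>i<card Z. ennreal (unit_ball_vol (real s) * \<rho> ^ s))"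
    using \<rho> by (intro sum.cong) (auto simp: C_def hausdorff_weight_def diameter_cball)
  also have "\<dots> = ennreal (\<Sum>i<card Z. unit_ball_vol (real s) * \<rho> ^ s)"
    using \<rho> by (intro sum_ennreal) auto
  finally show ?thesis by simp
qed

text \<open>A packing argument that counts net points by volume. Distinct net points have
  projections more than \<open>2 * b\<close> apart, so stacks of balls of radius \<open>b\<close>
  can be erected over them in direction \<open>e\<close> without overlap. A stack of
  \<open>M\<close> balls, with \<open>M\<close> about \<open>1 / b\<close>, has bounded height, and
  comparing volumes bounds the number of net points by a multiple of
  \<open>1 / b ^ (n - 1)\<close>.\<close>

lemma Lipschitz_graph_hausdorff_finite:
  fixes z :: "real ^ 'n"
  assumes G: "Lipschitz_graph_at L R \<Gamma> z e h" and L: "0 < L" and R: "0 < R"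
  shows "hausdorff_outer (CARD('n) - 1) (\<Gamma> \<inter> ball z R) < \<infinity>"
proof -
  let ?n = "CARD('n)" let ?s = "CARD('n) - 1"
  define A where "A = \<Gamma> \<inter> ball z R"
  have e: "norm e = 1" using G by (auto simp: Lipschitz_graph_at_def)
  have lip: "norm (p - q) \<le> (1 + L) * norm (perp e (p - q))" if "p \<in> A" "q \<in> A" for p q
  proof -
    have disc: "perp e (x - z) \<in> hyper_disc e R" if "x \<in> A" for x
      using that norm_perp_le[OF e, of "x - z"] perp_inner[OF e]
      by (auto simp: hyper_disc_def A_def dist_norm norm_minus_commute)
    have eq: "(x - z) \<bullet> e = h (perp e (x - z))" if "x \<in> A" for x
      using that G unfolding Lipschitz_graph_at_def A_def by auto
    have pq: "perp e (p - q) = perp e (p - z) - perp e (q - z)" by (simp add: perp_diff)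
    have "\<bar>(p - q) \<bullet> e\<bar> = \<bar>h (perp e (p - z)) - h (perp e (q - z))\<bar>"
      using eq[OF that(1)] eq[OF that(2)] by (simp add: inner_diff_left)
    also have "\<dots> \<le> L * norm (perp e (p - q))"
      using G disc[OF that(1)] disc[OF that(2)] unfolding Lipschitz_graph_at_def pq by blast
    finally have "\<bar>(p - q) \<bullet> e\<bar> \<le> L * norm (perp e (p - q))" .
    moreover have "norm (p - q) \<le> norm (perp e (p - q)) + \<bar>(p - q) \<bullet> e\<bar>"
      using norm_triangle_ineq[of "perp e (p - q)" "((p - q) \<bullet> e) *\<^sub>R e"] e by (simp add: perp_decomp)
    ultimately show ?thesis by (simp add: algebra_simps)
  qed
  \<comment> \<open>The bound must be the same for all \<open>\<epsilon>\<close>. It belongs to a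
    cover by \<open>card Z\<close> balls of radius
    \<open>5 * \<rho> = 5 * (1 + L) * b\<close>.\<close>
  define V where "V = unit_ball_vol (real ?s) * (5 * (1 + L)) ^ ?s * (R + 5) ^ ?n"
  have pre: "hausdorff_pre ?s \<epsilon> A \<le> ennreal V" if eps: "0 < \<epsilon>" for \<epsilon>
  proof -
    \<comment> \<open>The covering balls of radius \<open>5 * \<rho>\<close> have diameter at most
      \<open>\<epsilon>\<close>, and \<open>\<rho> \<le> 1\<close> keeps all stacks in a fixed
      ball.\<close>
    define \<rho> where "\<rho> = min 1 (\<epsilon> / 10)"
    have \<rho>: "0 < \<rho>" "\<rho> \<le> 1" "10 * \<rho> \<le> \<epsilon>" using eps by (auto simp: \<rho>_def)
    have "bounded A" unfolding A_def by (simp add: bounded_Int)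
    then obtain Z where Z: "finite Z" "Z \<subseteq> A" "A \<subseteq> (\<Union>z\<in>Z. cball z (5 * \<rho>))"
      "pairwise (\<lambda>z z'. disjnt (cball z \<rho>) (cball z' \<rho>)) Z"
      using finite_separated_net[OF _ \<rho>(1)] by metis
    define b where "b = \<rho> / (1 + L)"
    have b: "0 < b" "b \<le> 1" "(1 + L) * b = \<rho>" using \<rho> L by (auto simp: b_def field_simps)
    \<comment> \<open>The centres in a stack are \<open>2 * b\<close> apart, so this number of balls
      makes a stack of height about 2.\<close>
    define M where "M = nat \<lceil>1 / b\<rceil>"
    have M: "1 / b \<le> real M" "real M \<le> 1 / b + 1" unfolding M_def using b(1) by (auto simp: of_nat_nat ceiling_le_iff)
    define c where "c = (\<lambda>(p, k). p + (2 * real k * b) *\<^sub>R e)"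
    \<comment> \<open>Within a stack the spacing separates the centres; for different stacks it is
      the projections, on which the shift along \<open>e\<close> has no effect.\<close>
    have far: "2 * b \<le> dist (c x) (c y)" if xy: "x \<in> Z \<times> {..<M}" "y \<in> Z \<times> {..<M}" "x \<noteq> y" for x y
    proof -
      obtain p k q l where x: "x = (p, k)" and y: "y = (q, l)" by force
      show ?thesis
      proof (cases "p = q")
        case True
        then have "k \<noteq> l" using xy x y by auto
        then have "1 \<le> \<bar>real k - real l\<bar>" by linarith
        then have "2 * b * 1 \<le> 2 * b * \<bar>real k - real l\<bar>" using b(1) by (intro mult_left_mono) auto
        also have "\<dots> = norm ((2 * b * (real k - real l)) *\<^sub>R e)" using b(1) e by (simp add: abs_mult)
        also have "\<dots> = dist (c x) (c y)" using True by (simp add: x y c_def dist_norm algebra_simps)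
        finally show ?thesis by simp
      next
        case False
        have pq: "p \<in> A" "q \<in> A" "p \<in> Z" "q \<in> Z" using xy Z(2) by (auto simp: x y)
        have "disjnt (cball p \<rho>) (cball q \<rho>)" using Z(4) False pq by (auto simp: pairwise_def)
        moreover have "midpoint p q \<in> cball p \<rho> \<inter> cball q \<rho>" if "dist p q \<le> 2 * \<rho>"
          using that by (simp add: dist_midpoint)
        ultimately have "2 * \<rho> < dist p q" by (auto simp: disjnt_def not_le[symmetric])
        then have "2 * ((1 + L) * b) < (1 + L) * norm (perp e (p - q))"
          using lip[OF pq(1,2)] b(3) by (simp add: dist_norm)
        then have "(1 + L) * (2 * b) < (1 + L) * norm (perp e (p - q))" by (simp add: algebra_simps)
        then have "2 * b < norm (perp e (p - q))" using L by (simp add: mult_less_cancel_left_pos)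
        also have "perp e (p - q) = perp e (c x - c y)"
        proof -
          have "c x - c y = (p - q) + (2 * real k * b - 2 * real l * b) *\<^sub>R e" by (simp add: x y c_def algebra_simps)
          then show ?thesis by (simp add: perp_add_scaled[OF e])
        qed
        also have "norm (perp e (c x - c y)) \<le> dist (c x) (c y)" using norm_perp_le[OF e] by (simp add: dist_norm)
        finally show ?thesis by simp
      qed
    qed
    have disj: "disjoint_family_on (\<lambda>x. ball (c x) b) (Z \<times> {..<M})"
      unfolding disjoint_family_on_def
    proof (intro ballI impI)
      fix x y assume "x \<in> Z \<times> {..<M}" "y \<in> Z \<times> {..<M}" "x \<noteq> y"
      from far[OF this] show "ball (c x) b \<inter> ball (c y) b = {}"
        by (metis disjoint_ballI mult_2)
    qed
    \<comment> \<open>The 5 is made of a height \<open>2 * k * b \<le> 4\<close> of a centre above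
      its net point and a radius \<open>b \<le> 1\<close>.\<close>
    have sub: "(\<Union>x\<in>Z \<times> {..<M}. ball (c x) b) \<subseteq> ball z (R + 5)"
    proof
      fix x assume "x \<in> (\<Union>x\<in>Z \<times> {..<M}. ball (c x) b)"
      then obtain p k where p: "p \<in> Z" and k: "k \<in> {..<M}" and x: "x \<in> ball (c (p, k)) b" by blast
      have "dist z p < R" using p Z(2) by (auto simp: A_def)
      moreover have "dist p (c (p, k)) = 2 * real k * b" using b(1) e by (simp add: c_def dist_norm)
      moreover have "real k * b \<le> 2"
      proof -
        have "real k * b \<le> (1 / b + 1) * b" using k M(2) b(1) by (intro mult_right_mono) auto
        also have "\<dots> = 1 + b" using b(1) by (simp add: field_simps)
        finally show ?thesis using b(2) by simp
      qed
      moreover have "dist (c (p, k)) x < 1" using x b(2) by simp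
      ultimately show "x \<in> ball z (R + 5)"
        using dist_triangle[of z x p] dist_triangle[of p x "c (p, k)"] by simp
    qed
    have "ennreal (real (card (Z \<times> {..<M})) * (unit_ball_vol (real ?n) * b ^ ?n)) = (\<Sum>x\<in>Z \<times> {..<M}. ennreal (unit_ball_vol (real ?n) * b ^ ?n))"
      using b(1) by (subst sum_ennreal) auto
    also have "\<dots> = (\<Sum>x\<in>Z \<times> {..<M}. emeasure lborel (ball (c x) b))"
      using b(1) by (simp add: emeasure_ball)
    also have "\<dots> = emeasure lborel (\<Union>x\<in>Z \<times> {..<M}. ball (c x) b)"
      by (rule sum_emeasure) (use disj Z(1) in auto)
    also have "\<dots> \<le> emeasure lborel (ball z (R + 5))" by (rule emeasure_mono[OF sub]) auto
    also have "\<dots> = ennreal (unit_ball_vol (real ?n) * (R + 5) ^ ?n)" using R by (simp add: emeasure_ball)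
    finally have "real (card (Z \<times> {..<M})) * (unit_ball_vol (real ?n) * b ^ ?n) \<le> unit_ball_vol (real ?n) * (R + 5) ^ ?n"
      using R by (subst (asm) ennreal_le_iff) auto
    then have "unit_ball_vol (real ?n) * (real (card Z) * real M * b ^ ?n) \<le> unit_ball_vol (real ?n) * (R + 5) ^ ?n"
      by (simp add: card_cartesian_product mult_ac)
    then have cnt: "real (card Z) * real M * b ^ ?n \<le> (R + 5) ^ ?n"
      by (simp add: mult_le_cancel_left_pos)
    have "real (card Z) * b ^ ?s = real (card Z) * (1 / b) * b ^ ?n"
      using b(1) by (cases ?n) auto
    also have "\<dots> \<le> real (card Z) * real M * b ^ ?n"
      using M(1) b(1) by (intro mult_right_mono mult_left_mono) auto
    finally have cZ: "real (card Z) * b ^ ?s \<le> (R + 5) ^ ?n" using cnt by linarith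
    have "hausdorff_pre ?s \<epsilon> A \<le> ennreal (real (card Z) * (unit_ball_vol (real ?s) * (5 * \<rho>) ^ ?s))"
      using Z(1,3) \<rho> by (intro hausdorff_pre_le_cball_cover) auto
    also have "real (card Z) * (unit_ball_vol (real ?s) * (5 * \<rho>) ^ ?s) = unit_ball_vol (real ?s) * (5 * (1 + L)) ^ ?s * (real (card Z) * b ^ ?s)"
      by (simp add: b(3)[symmetric] power_mult_distrib mult_ac)
    also have "\<dots> \<le> V" unfolding V_def using cZ L by (intro mult_left_mono) auto
    finally show ?thesis by (simp add: ennreal_leI)
  qed
  have "hausdorff_outer ?s A \<le> ennreal V"
    unfolding hausdorff_outer_eq_SUP by (rule SUP_least) (use pre in auto)
  then show ?thesis unfolding A_def by (simp add: le_less_trans)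
qed

lemma emeasure_hausdorff_bounded_finite:
  fixes \<Gamma> :: "(real ^ 'n) set"
  assumes "closed \<Gamma>" "0 < L" "0 < R" "\<And>z. z \<in> \<Gamma> \<Longrightarrow> \<exists>e h. Lipschitz_graph_at L R \<Gamma> z e h"
    and K: "bounded K"
  shows "emeasure (hausdorff_measure (CARD('n) - 1)) (\<Gamma> \<inter> closure K) < \<infinity>"
proof -
  let ?H = "hausdorff_measure (CARD('n) - 1) :: (real ^ 'n) measure"
  have "compact (\<Gamma> \<inter> closure K)" using assms by (intro closed_Int_compact) auto
  moreover have "\<Gamma> \<inter> closure K \<subseteq> (\<Union>z\<in>\<Gamma>. ball z R)" using assms(3) by auto
  ultimately obtain F where F: "F \<subseteq> \<Gamma>" "finite F" "\<Gamma> \<inter> closure K \<subseteq> (\<Union>z\<in>F. ball z R)"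
    using compactE_image[of "\<Gamma> \<inter> closure K" \<Gamma> "\<lambda>z. ball z R"] by auto
  have b: "\<Gamma> \<inter> ball z R \<in> sets borel" for z using assms(1) by auto
  have "emeasure ?H (\<Gamma> \<inter> closure K) \<le> emeasure ?H (\<Union>z\<in>F. \<Gamma> \<inter> ball z R)"
  proof (rule emeasure_mono)
    show "(\<Union>z\<in>F. \<Gamma> \<inter> ball z R) \<in> sets ?H"
      unfolding sets_hausdorff_measure using F(2) b by (intro sets.finite_UN) auto
  qed (use F(3) in auto)
  also have "\<dots> \<le> (\<Sum>z\<in>F. emeasure ?H (\<Gamma> \<inter> ball z R))"
    using F(2) b by (intro emeasure_subadditive_finite) auto
  also have "\<dots> < \<infinity>"
  proof -
    have "emeasure ?H (\<Gamma> \<inter> ball z R) < \<infinity>" if zF: "z \<in> F" for z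
    proof -
      obtain e h where "Lipschitz_graph_at L R \<Gamma> z e h" using assms(4)[of z] zF F(1) by blast
      from Lipschitz_graph_hausdorff_finite[OF this assms(2,3)] show ?thesis
        using b by (simp add: emeasure_hausdorff_measure)
    qed
    then show ?thesis by (simp add: F(2))
  qed
  finally show ?thesis .
qed

section \<open>Surface measure and test functions\<close>

lemma space_surface_measure [simp]: "space (surface_measure \<Omega>) = frontier \<Omega>"
  by (simp add: surface_measure_def space_restrict_space)

lemma sets_surface_measure_iff: "A \<in> sets (surface_measure \<Omega>) \<longleftrightarrow> A \<subseteq> frontier \<Omega> \<and> A \<in> sets borel"
  unfolding surface_measure_def
  by (subst sets_restrict_space_iff) auto

lemma emeasure_surface_measure:
  "A \<subseteq> frontier \<Omega> \<Longrightarrow> A \<in> sets borel \<Longrightarrow>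
    emeasure (surface_measure \<Omega>) A = hausdorff_outer (CARD('n) - 1) A" for \<Omega> :: "(real ^ 'n) set"
  unfolding surface_measure_def
  by (subst emeasure_restrict_space) (auto simp: emeasure_hausdorff_measure)

lemma borel_measurable_surface_measure:
  "f \<in> borel_measurable borel \<Longrightarrow> f \<in> borel_measurable (surface_measure \<Omega>)"
  unfolding surface_measure_def
  by (rule measurable_restrict_space1) (simp cong: measurable_cong_sets)

text \<open>\<open>M\<close> may be infinite, so inner regularity is applied to \<open>N\<close>,
  the restriction of \<open>M\<close> to the single set \<open>E\<close> of finite measure.\<close>

lemma compact_inner_approximation:
  fixes M :: "'a::{second_countable_topology, complete_space} measure"
  assumes sb: "sets M = sets borel" and E: "E \<in> sets borel" "emeasure M E < \<infinity>" and e: "0 < e"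
  obtains K where "compact K" "K \<subseteq> E" "emeasure M (E - K) < ennreal e"
proof -
  define N where "N = density M (indicator E)"
  have N: "emeasure N A = emeasure M (A \<inter> E)" if "A \<in> sets borel" for A
    using that E sb by (simp add: N_def emeasure_density nn_integral_set_ennreal[symmetric] Int_commute flip: indicator_inter_arith)
  have sN: "sets N = sets borel" by (simp add: N_def sb)
  have spM: "space M = UNIV" using sets_eq_imp_space_eq[OF sb] by simp
  have "emeasure N (space N) \<noteq> \<infinity>"
    using N[of UNIV] E(2) by (simp add: N_def spM)
  from inner_regular[OF sN this, of E] E(1)
  have eq: "emeasure M E = (SUP K \<in> {K. K \<subseteq> E \<and> compact K}. emeasure N K)"
    using N[of E] by simp
  show ?thesis
  proof (cases "emeasure M E = 0")
    case True
    then show ?thesis using that[of "{}"] e by simp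
  next
    case False
    have "emeasure M E - ennreal e < emeasure M E"
      using False E(2) e by (intro ennreal_between) (auto simp: zero_less_iff_neq_zero)
    then obtain K where K: "K \<subseteq> E" "compact K" "emeasure M E - ennreal e < emeasure N K"
      unfolding eq less_SUP_iff by auto
    have Kb: "K \<in> sets borel" using K(2) by (simp add: borel_compact)
    have NK: "emeasure N K = emeasure M K" using N[OF Kb] K(1) by (simp add: Int_absorb2)
    have fK: "emeasure M K < \<infinity>" using emeasure_mono[OF K(1), of M] E sb by (auto simp: le_less_trans)
    have "emeasure M (E - K) = emeasure M E - emeasure M K"
      using K(1) Kb E(1) fK sb by (intro emeasure_Diff) auto
    also have "\<dots> < ennreal e"
    proof -
      obtain a b where ab: "emeasure M E = ennreal a" "0 \<le> a" "emeasure M K = ennreal b" "0 \<le> b"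
        using E(2) fK by (cases "emeasure M E"; cases "emeasure M K") auto
      have "a - e < b"
      proof (rule ccontr)
        assume "\<not> a - e < b"
        then have "ennreal b \<le> ennreal a - ennreal e" using e by (simp add: ennreal_minus ennreal_leI)
        then show False using K(3) ab NK by simp
      qed
      then show ?thesis using e ab by (simp add: ennreal_minus ennreal_lessI)
    qed
    finally show ?thesis using that K by blast
  qed
qed

section \<open>Test functions of the normal trace\<close>

definition trace_test :: "(real ^ 'n) set \<Rightarrow> ennreal \<Rightarrow> (real ^ 'n \<Rightarrow> real) \<Rightarrow> bool" where
  "trace_test \<Omega> \<delta> \<phi> \<longleftrightarrow> Ck 1 \<phi> \<and> compact (fun_support \<phi>) \<and>
     (\<exists>\<delta>'. 0 < \<delta>' \<and> \<delta>' < \<delta> \<and> (\<forall>x \<in> \<Omega> - bdry_layer \<Omega> \<delta>'. \<phi> x = 0))"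

lemma trace_test_continuous: "trace_test \<Omega> \<delta> \<phi> \<Longrightarrow> continuous_on UNIV \<phi>"
  unfolding trace_test_def using Ck_continuous by blast

lemma bdry_layer_mono: "a \<le> b \<Longrightarrow> bdry_layer \<Omega> a \<subseteq> bdry_layer \<Omega> b"
  by (auto simp: bdry_layer_def top_unique)

lemma trace_test_add:
  assumes "trace_test \<Omega> \<delta> f" "trace_test \<Omega> \<delta> g"
  shows "trace_test \<Omega> \<delta> (\<lambda>x. f x + g x)"
proof -
  obtain a b where a: "0 < a" "a < \<delta>" "\<forall>x \<in> \<Omega> - bdry_layer \<Omega> a. f x = 0"
    and b: "0 < b" "b < \<delta>" "\<forall>x \<in> \<Omega> - bdry_layer \<Omega> b. g x = 0"
    using assms unfolding trace_test_def by blast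
  have "\<forall>x \<in> \<Omega> - bdry_layer \<Omega> (max a b). f x + g x = 0"
  proof
    fix x assume "x \<in> \<Omega> - bdry_layer \<Omega> (max a b)"
    then have "x \<in> \<Omega> - bdry_layer \<Omega> a" "x \<in> \<Omega> - bdry_layer \<Omega> b"
      using bdry_layer_mono[of a "max a b" \<Omega>] bdry_layer_mono[of b "max a b" \<Omega>] by auto
    then show "f x + g x = 0" using a(3) b(3) by simp
  qed
  moreover have "bounded {x. f x + g x \<noteq> 0}"
    by (rule bounded_subset[of "{x. f x \<noteq> 0} \<union> {x. g x \<noteq> 0}"])
       (use assms in \<open>auto simp: trace_test_def compact_fun_support_iff\<close>)
  moreover have "Ck 1 (\<lambda>x. f x + g x)" using assms unfolding trace_test_def by (intro Ck_add) auto
  moreover have "0 < max a b" "max a b < \<delta>" using a b by (auto simp: less_max_iff_disj)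
  ultimately show ?thesis unfolding trace_test_def compact_fun_support_iff by blast
qed

lemma trace_test_scale:
  assumes "trace_test \<Omega> \<delta> f"
  shows "trace_test \<Omega> \<delta> (\<lambda>x. c * f x)"
proof -
  have "bounded {x. c * f x \<noteq> 0}"
    by (rule bounded_subset[of "{x. f x \<noteq> 0}"])
       (use assms in \<open>auto simp: trace_test_def compact_fun_support_iff\<close>)
  moreover have "Ck 1 (\<lambda>x. c * f x)" using assms unfolding trace_test_def by (intro Ck_mult Ck_const) auto
  moreover have "\<exists>\<delta>'. 0 < \<delta>' \<and> \<delta>' < \<delta> \<and> (\<forall>x \<in> \<Omega> - bdry_layer \<Omega> \<delta>'. c * f x = 0)"
    using assms unfolding trace_test_def by (metis mult_zero_right)
  ultimately show ?thesis unfolding trace_test_def compact_fun_support_iff by blast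
qed

text \<open>A point of the domain outside the layer of width \<open>r\<close> has distance at least
  \<open>r\<close> from the whole boundary, hence from \<open>K\<close>.\<close>

lemma trace_test_cutoff:
  assumes K: "K \<subseteq> frontier \<Omega>" "K \<noteq> {}" and r: "0 < r" "ennreal r < \<delta>"
    and \<theta>: "Ck 1 \<theta>" "compact (fun_support \<theta>)" "\<And>x. r \<le> infdist x K \<Longrightarrow> \<theta> x = 0"
  shows "trace_test \<Omega> \<delta> \<theta>"
proof -
  have "\<theta> x = 0" if "x \<in> \<Omega> - bdry_layer \<Omega> (ennreal r)" for x
  proof (rule \<theta>(3))
    have "ennreal r \<le> bdry_dist \<Omega> x" using that by (auto simp: bdry_layer_def not_less)
    then have "ennreal r \<le> ennreal (dist x y)" if "y \<in> frontier \<Omega>" for y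
      using that unfolding bdry_dist_def by (metis INF_lower order_trans)
    then have "r \<le> dist x y" if "y \<in> K" for y using that K(1) r(1) by (force simp: ennreal_le_iff)
    then show "r \<le> infdist x K" using K(2) by (simp add: infdist_def cINF_greatest)
  qed
  then show ?thesis unfolding trace_test_def using \<theta> r by (intro conjI exI[of _ "ennreal r"]) auto
qed

lemma trace_test_mult:
  assumes \<phi>: "trace_test \<Omega> \<delta> \<phi>" and h: "Ck 1 h"
  shows "trace_test \<Omega> \<delta> (\<lambda>x. \<phi> x * h x)"
proof -
  have "bounded {x. \<phi> x * h x \<noteq> 0}"
    by (rule bounded_subset[of "{x. \<phi> x \<noteq> 0}"])
       (use \<phi> in \<open>auto simp: trace_test_def compact_fun_support_iff\<close>)
  moreover have "Ck 1 (\<lambda>x. \<phi> x * h x)" using \<phi> h unfolding trace_test_def by (intro Ck_mult) auto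
  moreover have "\<exists>\<delta>'. 0 < \<delta>' \<and> \<delta>' < \<delta> \<and> (\<forall>x \<in> \<Omega> - bdry_layer \<Omega> \<delta>'. \<phi> x * h x = 0)"
    using \<phi> unfolding trace_test_def by (metis mult_zero_left)
  ultimately show ?thesis unfolding trace_test_def compact_fun_support_iff by blast
qed

lemma ennreal_real_below:
  assumes "0 < (a :: ennreal)"
  obtains x :: real where "0 < x" "ennreal x < a"
proof (cases a)
  case (real d)
  then have "0 < d" using assms by (auto simp: ennreal_eq_0_iff)
  then show ?thesis using that[of "d/2"] real by (auto simp: ennreal_lessI)
next
  case top
  then show ?thesis using that[of 1] by simp
qed

lemma cutoff_sequence:
  fixes \<Omega> :: "(real ^ 'n) set"
  assumes K: "compact K" "K \<subseteq> frontier \<Omega>" "K \<noteq> {}" and \<delta>: "0 < \<delta>"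
  obtains \<theta> :: "nat \<Rightarrow> real ^ 'n \<Rightarrow> real" and B where
    "\<And>k. trace_test \<Omega> \<delta> (\<theta> k)" "\<And>k x. 0 \<le> \<theta> k x" "\<And>k x. \<theta> k x \<le> 1"
    "\<And>x. (\<lambda>k. \<theta> k x) \<longlonglongrightarrow> indicator K x" "\<And>k x. \<theta> k x \<noteq> 0 \<Longrightarrow> norm x \<le> B"
proof -
  obtain r1 where r1: "0 < r1" "ennreal r1 < \<delta>" using ennreal_real_below[OF \<delta>] by blast
  \<comment> \<open>The bound \<open>r1\<close> keeps the functions in the admissible layer, the
    bound 1 keeps all their supports in one ball.\<close>
  define r0 where "r0 = min 1 r1"
  have r0: "0 < r0" "r0 \<le> 1" "ennreal r0 < \<delta>"
    using r1 le_less_trans[OF ennreal_leI r1(2), of r0] by (auto simp: r0_def)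
  define r where "r = (\<lambda>k. r0 / real (Suc k))"
  have r: "0 < r k" "r k \<le> r0" for k using r0 by (auto simp: r_def field_simps)
  have "\<exists>\<theta>. (\<forall>k. Ck k \<theta>) \<and> compact (fun_support \<theta>) \<and> (\<forall>x. 0 \<le> \<theta> x) \<and> (\<forall>x. \<theta> x \<le> 1) \<and>
    (\<forall>x. infdist x K \<le> r k / 4 \<longrightarrow> \<theta> x = 1) \<and> (\<forall>x. r k \<le> infdist x K \<longrightarrow> \<theta> x = 0)" for k
    by (rule cutoff_exists[OF K(1,3) r(1)[of k]]) blast
  then obtain \<theta> where \<theta>: "\<And>k j. Ck j (\<theta> k)" "\<And>k. compact (fun_support (\<theta> k))" "\<And>k x. 0 \<le> \<theta> k x" "\<And>k x. \<theta> k x \<le> 1"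
    "\<And>k x. infdist x K \<le> r k / 4 \<Longrightarrow> \<theta> k x = 1" "\<And>k x. r k \<le> infdist x K \<Longrightarrow> \<theta> k x = 0"
    by metis
  obtain C where C: "\<And>x. x \<in> K \<Longrightarrow> norm x \<le> C" using compact_imp_bounded[OF K(1)] by (auto simp: bounded_iff)
  show ?thesis
  proof (rule that)
    have "ennreal (r k) < \<delta>" for k using r(2)[of k] r0(3) le_less_trans[OF ennreal_leI] by blast
    then show "trace_test \<Omega> \<delta> (\<theta> k)" for k
      using trace_test_cutoff[OF K(2,3) r(1), of k \<delta> "\<theta> k"] \<theta> by blast
    show "(\<lambda>k. \<theta> k x) \<longlonglongrightarrow> indicator K x" for x
    proof (cases "x \<in> K")
      case True
      then have "\<theta> k x = 1" for k using \<theta>(5)[of x k] r(1)[of k] by simp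
      then show ?thesis using True by simp
    next
      case False
      then have d: "0 < infdist x K" using K by (simp add: infdist_pos_not_in_closed compact_imp_closed)
      have "r \<longlonglongrightarrow> 0" unfolding r_def by (rule LIMSEQ_Suc[OF lim_const_over_n])
      from order_tendstoD(2)[OF this d] have "\<forall>\<^sub>F k in sequentially. \<theta> k x = 0"
        by eventually_elim (use \<theta>(6) in auto)
      then show ?thesis using False by (simp add: tendsto_eventually)
    qed
    show "norm x \<le> C + 1" if "\<theta> k x \<noteq> 0" for k x
    proof -
      have "infdist x K < 1" using \<theta>(6)[of k x] that r(2)[of k] r0(2) by force
      moreover obtain a where "a \<in> K" "infdist x K = dist x a"
        using infdist_attains_inf[OF compact_imp_closed[OF K(1)] K(3)] by metis
      ultimately show ?thesis using C[of a] norm_triangle_sub[of x a] by (simp add: dist_norm)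
    qed
  qed (use \<theta> in auto)
qed

section \<open>Duality between test functions and functions on the boundary\<close>

text \<open>Separates the measure theory on the boundary from its geometry: local finiteness makes
  the surface measure sigma-finite and bounded functions of bounded support integrable.\<close>

locale locally_finite_boundary =
  fixes \<Omega> :: "(real ^ 'n) set" and \<delta> :: ennreal
  assumes finite_cball: "\<And>R. emeasure (surface_measure \<Omega>) (frontier \<Omega> \<inter> cball 0 R) < \<infinity>"
    and delta_pos: "0 < \<delta>"
begin

abbreviation "\<Gamma> \<equiv> frontier \<Omega>"
abbreviation "\<sigma> \<equiv> surface_measure \<Omega>"

lemma Gamma_cball_sets [measurable]: "\<Gamma> \<inter> cball 0 R \<in> sets \<sigma>"
  by (auto simp: sets_surface_measure_iff borel_closed closed_Int)

lemma sigma_finite_surface_measure: "sigma_finite_measure \<sigma>"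
proof
  show "\<exists>A. countable A \<and> A \<subseteq> sets \<sigma> \<and> \<Union>A = space \<sigma> \<and> (\<forall>a\<in>A. emeasure \<sigma> a \<noteq> \<infinity>)"
  proof (intro exI[of _ "range (\<lambda>k::nat. \<Gamma> \<inter> cball 0 (real k))"] conjI)
    show "\<Union> (range (\<lambda>k::nat. \<Gamma> \<inter> cball 0 (real k))) = space \<sigma>"
      using real_arch_simple by (auto simp: dist_norm)
  qed (use finite_cball in \<open>auto simp: less_top[symmetric] intro: Gamma_cball_sets\<close>)
qed

lemma integrable_bounded_support:
  fixes f :: "real ^ 'n \<Rightarrow> real"
  assumes f: "f \<in> borel_measurable \<sigma>" and le: "\<And>x. x \<in> \<Gamma> \<Longrightarrow> \<bar>f x\<bar> \<le> c"
    and supp: "\<And>x. x \<in> \<Gamma> \<Longrightarrow> f x \<noteq> 0 \<Longrightarrow> norm x \<le> R"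
  shows "integrable \<sigma> f"
proof (rule Bochner_Integration.integrable_bound)
  show "integrable \<sigma> (\<lambda>x. c * indicator (\<Gamma> \<inter> cball 0 R) x)"
    using finite_cball[of R] by (intro integrable_mult_right integrable_real_indicator) auto
  show "AE x in \<sigma>. norm (f x) \<le> norm (c * indicator (\<Gamma> \<inter> cball 0 R) x)"
  proof (rule AE_I2)
    fix x assume "x \<in> space \<sigma>"
    then show "norm (f x) \<le> norm (c * indicator (\<Gamma> \<inter> cball 0 R) x)"
      using le[of x] supp[of x] by (cases "f x = 0") (auto simp: indicator_def)
  qed
qed (rule f)

lemma trace_test_borel: "trace_test \<Omega> \<delta> \<phi> \<Longrightarrow> \<phi> \<in> borel_measurable \<sigma>"
  by (intro borel_measurable_surface_measure borel_measurable_continuous_onI trace_test_continuous)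

lemma trace_test_bounded:
  assumes "trace_test \<Omega> \<delta> \<phi>"
  obtains c R where "\<And>x. \<bar>\<phi> x\<bar> \<le> c" "\<And>x. \<phi> x \<noteq> 0 \<Longrightarrow> norm x \<le> R"
proof -
  have b: "bounded {x. \<phi> x \<noteq> 0}" using assms by (simp add: trace_test_def compact_fun_support_iff)
  obtain c where "\<And>x. \<bar>\<phi> x\<bar> \<le> c"
    using continuous_compact_support_bounded[OF trace_test_continuous[OF assms] b] by blast
  moreover obtain R where "\<And>x. \<phi> x \<noteq> 0 \<Longrightarrow> norm x \<le> R" using b by (auto simp: bounded_iff)
  ultimately show ?thesis using that by blast
qed

lemma trace_test_integrable: "trace_test \<Omega> \<delta> \<phi> \<Longrightarrow> integrable \<sigma> \<phi>"
  by (metis integrable_bounded_support trace_test_borel trace_test_bounded)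

text \<open>For an indicator two approximations are combined: from inside by a compact set, through
  regularity of the measure, and then by cutoffs around this compact set.\<close>

lemma trace_test_dense:
  assumes "integrable \<sigma> f" "0 < e"
  shows "\<exists>\<phi>. trace_test \<Omega> \<delta> \<phi> \<and> (LINT x|\<sigma>. \<bar>\<phi> x - f x\<bar>) < e"
  using assms
proof (induction arbitrary: e rule: integrable_induct)
  case (base A c)
  have A: "A \<subseteq> \<Gamma>" "A \<in> sets borel" using base(1) by (auto simp: sets_surface_measure_iff)
  define e' where "e' = e / (2 * (\<bar>c\<bar> + 1))"
  have e': "0 < e'" "\<bar>c\<bar> * e' < e / 2" using base by (auto simp: e'_def field_simps add_pos_nonneg)
  \<comment> \<open>Regularity is applied to the Hausdorff measure of the whole space, whose
    measurable sets are all Borel sets; on Borel subsets of \<open>\<Gamma>\<close> it agrees with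
    \<open>\<sigma>\<close>.\<close>
  let ?H = "hausdorff_measure (CARD('n) - 1) :: (real ^ 'n) measure"
  have eH: "emeasure \<sigma> X = emeasure ?H X" if "X \<subseteq> A" "X \<in> sets borel" for X
    using that A by (simp add: emeasure_surface_measure emeasure_hausdorff_measure)
  obtain K where K: "compact K" "K \<subseteq> A" "emeasure ?H (A - K) < ennreal e'"
    by (rule compact_inner_approximation[of ?H A e'])
       (use A base(2) e' eH[of A] in auto)
  have Ks: "K \<in> sets \<sigma>" "A - K \<in> sets \<sigma>"
    using K A by (auto simp: sets_surface_measure_iff borel_compact)
  have AK: "emeasure \<sigma> (A - K) < ennreal e'" using K(3) eH[of "A - K"] A borel_compact[OF K(1)] by auto
  have intA: "integrable \<sigma> (indicator A :: _ \<Rightarrow> real)" and intK: "integrable \<sigma> (indicator K :: _ \<Rightarrow> real)"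
    using base(1,2) Ks emeasure_mono[OF K(2) base(1)]
    by (auto intro!: integrable_real_indicator intro: le_less_trans)
  have 1: "(LINT x|\<sigma>. \<bar>c * indicator K x - c * indicator A x\<bar>) < e / 2"
  proof -
    have "(LINT x|\<sigma>. \<bar>c * indicator K x - c * indicator A x\<bar>) = (LINT x|\<sigma>. \<bar>c\<bar> * indicator (A - K) x)"
      using K(2) by (intro Bochner_Integration.integral_cong) (auto simp: indicator_def)
    also have "\<dots> = \<bar>c\<bar> * measure \<sigma> (A - K)"
      using Ks A by (simp add: Int_absorb2 Diff_subset subset_trans[of "A - K" A])
    also have "\<dots> \<le> \<bar>c\<bar> * e'"
      using AK e' by (intro mult_left_mono) (auto simp: measure_def enn2real_leI less_imp_le)
    finally show ?thesis using e' by simp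
  qed
  show ?case
  proof (cases "K = {}")
    case True
    have "trace_test \<Omega> \<delta> (\<lambda>x. 0)"
    proof -
      obtain d where "0 < d" "d < \<delta>" using delta_pos dense by blast
      then show ?thesis unfolding trace_test_def by (auto simp: Ck_const fun_support_def simp del: Ck.simps)
    qed
    moreover have "(LINT x|\<sigma>. \<bar>0 - indicator A x *\<^sub>R c\<bar>) < e" using 1 base(3) True by (simp add: mult.commute abs_minus_commute)
    ultimately show ?thesis by blast
  next
    case False
    obtain \<theta> B where \<theta>: "\<And>k. trace_test \<Omega> \<delta> (\<theta> k)" "\<And>k x. 0 \<le> \<theta> k x" "\<And>k x. \<theta> k x \<le> 1"
      "\<And>x. (\<lambda>k. \<theta> k x) \<longlonglongrightarrow> indicator K x" "\<And>k x. \<theta> k x \<noteq> 0 \<Longrightarrow> norm x \<le> B"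
      by (rule cutoff_sequence[OF K(1) subset_trans[OF K(2) A(1)] False delta_pos]) blast
    have [measurable]: "\<And>k. \<theta> k \<in> borel_measurable \<sigma>" using trace_test_borel[OF \<theta>(1)] .
    \<comment> \<open>The functions \<open>\<theta> k\<close> tend to 1 on \<open>K\<close>, so the
      ball that contains all the sets where they are nonzero contains \<open>K\<close> too.\<close>
    have nK: "norm x \<le> B" if "x \<in> K" for x
    proof (rule ccontr)
      assume "\<not> norm x \<le> B"
      then have "\<theta> k x = 0" for k using \<theta>(5)[of k x] by blast
      then have "(\<lambda>k. \<theta> k x) \<longlonglongrightarrow> 0" by simp
      then show False using \<theta>(4)[of x] that LIMSEQ_unique by fastforce
    qed
    have "(\<lambda>k. LINT x|\<sigma>. \<bar>c * \<theta> k x - c * indicator K x\<bar>) \<longlonglongrightarrow> (LINT x|\<sigma>. 0)"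
    proof (rule integral_dominated_convergence[where w="\<lambda>x. \<bar>c\<bar> * indicator (\<Gamma> \<inter> cball 0 B) x"])
      show "integrable \<sigma> (\<lambda>x. \<bar>c\<bar> * indicator (\<Gamma> \<inter> cball 0 B) x)"
        using finite_cball[of B] by (intro integrable_mult_right integrable_real_indicator) auto
      show "AE x in \<sigma>. (\<lambda>k. \<bar>c * \<theta> k x - c * indicator K x\<bar>) \<longlonglongrightarrow> 0"
      proof (rule AE_I2)
        fix x
        have "(\<lambda>k. \<bar>c * \<theta> k x - c * indicator K x\<bar>) \<longlonglongrightarrow> \<bar>c * indicator K x - c * indicator K x\<bar>"
          by (intro tendsto_intros \<theta>(4))
        then show "(\<lambda>k. \<bar>c * \<theta> k x - c * indicator K x\<bar>) \<longlonglongrightarrow> 0" by simp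
      qed
      show "AE x in \<sigma>. norm \<bar>c * \<theta> k x - c * indicator K x\<bar> \<le> \<bar>c\<bar> * indicator (\<Gamma> \<inter> cball 0 B) x" for k
      proof (rule AE_I2)
        fix x assume x: "x \<in> space \<sigma>"
        have "\<bar>\<theta> k x - indicator K x\<bar> \<le> indicator (\<Gamma> \<inter> cball 0 B) x"
          using \<theta>(2,3,5)[of k x] nK[of x] x by (auto simp: indicator_def split: if_splits)
        then have "\<bar>c\<bar> * \<bar>\<theta> k x - indicator K x\<bar> \<le> \<bar>c\<bar> * indicator (\<Gamma> \<inter> cball 0 B) x"
          by (intro mult_left_mono) auto
        then show "norm \<bar>c * \<theta> k x - c * indicator K x\<bar> \<le> \<bar>c\<bar> * indicator (\<Gamma> \<inter> cball 0 B) x"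
          by (simp add: abs_mult flip: right_diff_distrib)
      qed
    qed (use Ks in measurable)
    then have "\<forall>\<^sub>F k in sequentially. (LINT x|\<sigma>. \<bar>c * \<theta> k x - c * indicator K x\<bar>) < e / 2"
      by (rule order_tendstoD) (use base(3) in auto)
    then obtain k where k: "(LINT x|\<sigma>. \<bar>c * \<theta> k x - c * indicator K x\<bar>) < e / 2"
      by (auto simp: eventually_sequentially)
    have "(LINT x|\<sigma>. \<bar>c * \<theta> k x - c * indicator A x\<bar>)
        \<le> (LINT x|\<sigma>. \<bar>c * \<theta> k x - c * indicator K x\<bar> + \<bar>c * indicator K x - c * indicator A x\<bar>)"
      using trace_test_integrable[OF \<theta>(1)[of k]] intA intK by (intro integral_mono) auto
    also have "\<dots> = (LINT x|\<sigma>. \<bar>c * \<theta> k x - c * indicator K x\<bar>) + (LINT x|\<sigma>. \<bar>c * indicator K x - c * indicator A x\<bar>)"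
      using trace_test_integrable[OF \<theta>(1)[of k]] intA intK by (intro Bochner_Integration.integral_add) auto
    finally have "(LINT x|\<sigma>. \<bar>c * \<theta> k x - indicator A x *\<^sub>R c\<bar>) < e"
      using 1 k by (simp only: real_scaleR_def mult.commute[of _ c])
    then show ?thesis using trace_test_scale[OF \<theta>(1)[of k], of c] by blast
  qed
next
  case (add f g)
  obtain a where a: "trace_test \<Omega> \<delta> a" "(LINT x|\<sigma>. \<bar>a x - f x\<bar>) < e / 2" using add.IH(1)[of "e/2"] add.prems by auto
  obtain b where b: "trace_test \<Omega> \<delta> b" "(LINT x|\<sigma>. \<bar>b x - g x\<bar>) < e / 2" using add.IH(2)[of "e/2"] add.prems by auto
  note ab = trace_test_integrable[OF a(1)] trace_test_integrable[OF b(1)] add.hyps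
  have "(LINT x|\<sigma>. \<bar>a x + b x - (f x + g x)\<bar>) \<le> (LINT x|\<sigma>. \<bar>a x - f x\<bar> + \<bar>b x - g x\<bar>)"
    using ab by (intro integral_mono) auto
  also have "\<dots> = (LINT x|\<sigma>. \<bar>a x - f x\<bar>) + (LINT x|\<sigma>. \<bar>b x - g x\<bar>)"
    using ab by (intro Bochner_Integration.integral_add) auto
  finally show ?case using a b trace_test_add[OF a(1) b(1)] by (intro exI[of _ "\<lambda>x. a x + b x"]) auto
next
  case (lim f s)
  have tend: "(\<lambda>i. s i x) \<longlonglongrightarrow> f x" if "x \<in> space \<sigma>" for x using lim that by blast
  have dom: "norm (s i x) \<le> 2 * norm (f x)" if "x \<in> space \<sigma>" for i x using lim that by blast
  have [measurable]: "f \<in> borel_measurable \<sigma>" "\<And>i. s i \<in> borel_measurable \<sigma>" using lim by auto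
  have "(\<lambda>i. LINT x|\<sigma>. \<bar>s i x - f x\<bar>) \<longlonglongrightarrow> (LINT x|\<sigma>. 0)"
  proof (rule integral_dominated_convergence[where w="\<lambda>x. 3 * \<bar>f x\<bar>"])
    show "AE x in \<sigma>. (\<lambda>i. \<bar>s i x - f x\<bar>) \<longlonglongrightarrow> 0"
      using tend by (intro AE_I2 tendsto_rabs_zero) (simp add: LIM_zero_iff)
    show "AE x in \<sigma>. norm \<bar>s i x - f x\<bar> \<le> 3 * \<bar>f x\<bar>" for i
      using dom[of _ i] by (intro AE_I2) (fastforce simp: abs_if split: if_splits)
  qed (use lim in auto)
  then have "\<forall>\<^sub>F i in sequentially. (LINT x|\<sigma>. \<bar>s i x - f x\<bar>) < e / 2"
    by (rule order_tendstoD) (use lim.prems in auto)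
  then obtain i where i: "(LINT x|\<sigma>. \<bar>s i x - f x\<bar>) < e / 2" by (auto simp: eventually_sequentially)
  obtain a where a: "trace_test \<Omega> \<delta> a" "(LINT x|\<sigma>. \<bar>a x - s i x\<bar>) < e / 2" using lim.IH[of "e/2" i] lim.prems by auto
  note ab = trace_test_integrable[OF a(1)] lim.hyps(1)[of i] lim.hyps(4)
  have "(LINT x|\<sigma>. \<bar>a x - f x\<bar>) \<le> (LINT x|\<sigma>. \<bar>a x - s i x\<bar> + \<bar>s i x - f x\<bar>)"
    using ab by (intro integral_mono) auto
  also have "\<dots> = (LINT x|\<sigma>. \<bar>a x - s i x\<bar>) + (LINT x|\<sigma>. \<bar>s i x - f x\<bar>)"
    using ab by (intro Bochner_Integration.integral_add) auto
  finally show ?case using a i by (intro exI[of _ a]) auto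
qed

text \<open>One-sided, so that it can be applied to \<open>g\<close> and to \<open>- g\<close>. The
  bound passes from test functions to indicators of compact sets, and a compact set of positive
  measure inside the set where \<open>B < g x\<close> would violate it.\<close>

lemma AE_le_of_trace_test_bound:
  assumes g: "g \<in> borel_measurable \<sigma>" "\<And>K. compact K \<Longrightarrow> K \<subseteq> \<Gamma> \<Longrightarrow> set_integrable \<sigma> K g"
    and B: "0 \<le> B" and bound: "\<And>\<phi>. trace_test \<Omega> \<delta> \<phi> \<Longrightarrow> (LINT x|\<sigma>. g x * \<phi> x) \<le> B * (LINT x|\<sigma>. \<bar>\<phi> x\<bar>)"
  shows "AE x in \<sigma>. g x \<le> B"
proof -
  note [measurable] = g(1)
  have key: "(LINT x|\<sigma>. g x * indicator K x) \<le> B * measure \<sigma> K" if K: "compact K" "K \<subseteq> \<Gamma>" for K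
  proof (cases "K = {}")
    case False
    obtain \<theta> R where \<theta>: "\<And>k. trace_test \<Omega> \<delta> (\<theta> k)" "\<And>k x. 0 \<le> \<theta> k x" "\<And>k x. \<theta> k x \<le> 1"
      "\<And>x. (\<lambda>k. \<theta> k x) \<longlonglongrightarrow> indicator K x" "\<And>k x. \<theta> k x \<noteq> 0 \<Longrightarrow> norm x \<le> R"
      by (rule cutoff_sequence[OF K False delta_pos]) blast
    have [measurable]: "\<And>k. \<theta> k \<in> borel_measurable \<sigma>" using trace_test_borel[OF \<theta>(1)] .
    have Ks [measurable]: "K \<in> sets \<sigma>" using K by (auto simp: sets_surface_measure_iff borel_compact)
    have cR: "compact (\<Gamma> \<inter> cball 0 R)" by (simp add: closed_Int_compact)
    have le_ind: "\<bar>\<theta> k x\<bar> \<le> indicator (\<Gamma> \<inter> cball 0 R) x" if "x \<in> space \<sigma>" for k x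
      using \<theta>(2,3,5)[of k x] that by (auto simp: indicator_def)
    have l1: "(\<lambda>k. LINT x|\<sigma>. g x * \<theta> k x) \<longlonglongrightarrow> (LINT x|\<sigma>. g x * indicator K x)"
    proof (rule integral_dominated_convergence[where w="\<lambda>x. \<bar>indicator (\<Gamma> \<inter> cball 0 R) x *\<^sub>R g x\<bar>"])
      show "integrable \<sigma> (\<lambda>x. \<bar>indicator (\<Gamma> \<inter> cball 0 R) x *\<^sub>R g x\<bar>)"
        using g(2)[OF cR] by (auto simp: set_integrable_def)
      show "AE x in \<sigma>. (\<lambda>k. g x * \<theta> k x) \<longlonglongrightarrow> g x * indicator K x"
        by (intro AE_I2 tendsto_intros \<theta>(4))
      show "AE x in \<sigma>. norm (g x * \<theta> k x) \<le> \<bar>indicator (\<Gamma> \<inter> cball 0 R) x *\<^sub>R g x\<bar>" for k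
      proof (rule AE_I2)
        fix x assume x: "x \<in> space \<sigma>"
        show "norm (g x * \<theta> k x) \<le> \<bar>indicator (\<Gamma> \<inter> cball 0 R) x *\<^sub>R g x\<bar>"
          using mult_left_mono[OF le_ind[OF x, of k], of "\<bar>g x\<bar>"] by (simp add: abs_mult mult.commute)
      qed
    qed measurable
    have l2: "(\<lambda>k. LINT x|\<sigma>. \<bar>\<theta> k x\<bar>) \<longlonglongrightarrow> (LINT x|\<sigma>. indicator K x)"
    proof (rule integral_dominated_convergence[where w="indicator (\<Gamma> \<inter> cball 0 R)"])
      show "integrable \<sigma> (indicator (\<Gamma> \<inter> cball 0 R) :: _ \<Rightarrow> real)"
        using finite_cball[of R] by (intro integrable_real_indicator) auto
      show "AE x in \<sigma>. (\<lambda>k. \<bar>\<theta> k x\<bar>) \<longlonglongrightarrow> indicator K x"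
        using \<theta>(2,4) by (intro AE_I2) simp
      show "AE x in \<sigma>. norm \<bar>\<theta> k x\<bar> \<le> indicator (\<Gamma> \<inter> cball 0 R) x" for k
        using le_ind[of _ k] by (intro AE_I2) simp
    qed measurable
    have "(LINT x|\<sigma>. g x * indicator K x) \<le> B * (LINT x|\<sigma>. indicator K x)"
      by (rule LIMSEQ_le[OF l1 tendsto_mult[OF tendsto_const l2]]) (use bound \<theta>(1) in auto)
    then show ?thesis using K(2) by (simp add: Int_absorb2)
  qed simp
  \<comment> \<open>The intersection with a ball makes the measure finite, as inner approximation
    demands.\<close>
  have null: "emeasure \<sigma> ({x\<in>\<Gamma>. B < g x} \<inter> cball 0 R) = 0" for R
  proof (rule ccontr)
    define E where "E = {x\<in>\<Gamma>. B < g x} \<inter> cball 0 R"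
    assume "emeasure \<sigma> ({x\<in>\<Gamma>. B < g x} \<inter> cball 0 R) \<noteq> 0"
    then have nz: "emeasure \<sigma> E \<noteq> 0" by (simp add: E_def)
    have "{x\<in>space \<sigma>. B < g x} \<inter> (\<Gamma> \<inter> cball 0 R) \<in> sets \<sigma>" by measurable
    moreover have "{x\<in>space \<sigma>. B < g x} \<inter> (\<Gamma> \<inter> cball 0 R) = E" by (auto simp: E_def)
    ultimately have Es: "E \<in> sets \<sigma>" by (simp only:)
    then have E: "E \<subseteq> \<Gamma>" "E \<in> sets borel" by (auto simp: sets_surface_measure_iff)
    have "emeasure \<sigma> E \<le> emeasure \<sigma> (\<Gamma> \<inter> cball 0 R)" by (intro emeasure_mono) (auto simp: E_def)
    then have fE: "emeasure \<sigma> E < \<infinity>" using finite_cball[of R] by (rule le_less_trans)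
    let ?H = "hausdorff_measure (CARD('n) - 1) :: (real ^ 'n) measure"
    have eH: "emeasure \<sigma> X = emeasure ?H X" if "X \<subseteq> E" "X \<in> sets borel" for X
      using that E by (simp add: emeasure_surface_measure emeasure_hausdorff_measure)
    define e where "e = enn2real (emeasure \<sigma> E)"
    have e: "emeasure \<sigma> E = ennreal e" "0 < e"
      using nz fE by (auto simp: e_def enn2real_positive_iff zero_less_iff_neq_zero)
    \<comment> \<open>The tolerance is the whole measure of \<open>E\<close>, so \<open>K\<close>
      cannot be a null set.\<close>
    obtain K where K: "compact K" "K \<subseteq> E" "emeasure ?H (E - K) < ennreal e"
      by (rule compact_inner_approximation[of ?H E e]) (use E fE e eH[of E] in auto)
    have Kb: "K \<in> sets borel" using K(1) by (rule borel_compact)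
    have Ks [measurable]: "K \<in> sets \<sigma>" using K E Kb by (auto simp: sets_surface_measure_iff)
    have Kpos: "emeasure \<sigma> K \<noteq> 0"
    proof
      assume "emeasure \<sigma> K = 0"
      then have "emeasure \<sigma> (E - K) = emeasure \<sigma> E" using Ks Es by (intro emeasure_Diff_null_set) auto
      then show False using K(3) eH[of "E - K"] E Kb e by simp
    qed
    have KG: "K \<subseteq> \<Gamma>" using K E by blast
    have fK: "emeasure \<sigma> K < \<infinity>" using emeasure_mono[OF K(2) Es] fE by (rule le_less_trans)
    have int: "integrable \<sigma> (\<lambda>x. (g x - B) * indicator K x)"
    proof -
      have "integrable \<sigma> (\<lambda>x. indicator K x *\<^sub>R g x)" using g(2)[OF K(1) KG] by (simp add: set_integrable_def)
      moreover have "integrable \<sigma> (\<lambda>x. B * indicator K x)"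
        using fK by (intro integrable_mult_right integrable_real_indicator) auto
      ultimately show ?thesis by (simp add: algebra_simps)
    qed
    have "(LINT x|\<sigma>. (g x - B) * indicator K x) = (LINT x|\<sigma>. g x * indicator K x) - B * measure \<sigma> K"
    proof -
      have "integrable \<sigma> (\<lambda>x. g x * indicator K x)" using g(2)[OF K(1) KG] by (simp add: set_integrable_def mult.commute)
      moreover have "integrable \<sigma> (\<lambda>x. B * indicator K x)"
        using fK by (intro integrable_mult_right integrable_real_indicator) auto
      ultimately show ?thesis using KG by (simp add: left_diff_distrib Int_absorb2)
    qed
    then have le0: "(LINT x|\<sigma>. (g x - B) * indicator K x) \<le> 0" using key[OF K(1) KG] by simp
    have nn: "0 \<le> (g x - B) * indicator K x" for x
      using K(2) by (auto simp: indicator_def E_def less_imp_le)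
    have "(LINT x|\<sigma>. (g x - B) * indicator K x) = 0"
      using nn by (intro antisym[OF le0] integral_nonneg_AE AE_I2)
    then have "AE x in \<sigma>. (g x - B) * indicator K x = 0"
      using integral_nonneg_eq_0_iff_AE[OF int] nn by simp
    then have "AE x in \<sigma>. x \<notin> K"
      by eventually_elim (use K(2) in \<open>auto simp: E_def\<close>)
    then show False using Kpos iffD2[OF AE_iff_null_sets[OF Ks]] by auto
  qed
  have "AE x in \<sigma>. \<forall>k::nat. \<not> (x \<in> {x\<in>\<Gamma>. B < g x} \<inter> cball 0 (real k))"
  proof (subst AE_all_countable, intro allI)
    fix k :: nat
    have "{x\<in>space \<sigma>. B < g x} \<inter> (\<Gamma> \<inter> cball 0 (real k)) \<in> sets \<sigma>" by measurable
    moreover have "{x\<in>space \<sigma>. B < g x} \<inter> (\<Gamma> \<inter> cball 0 (real k)) = {x\<in>\<Gamma>. B < g x} \<inter> cball 0 (real k)" by auto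
    ultimately have "{x\<in>\<Gamma>. B < g x} \<inter> cball 0 (real k) \<in> sets \<sigma>" by (simp only:)
    then have "{x\<in>\<Gamma>. B < g x} \<inter> cball 0 (real k) \<in> null_sets \<sigma>" using null[of "real k"] by (simp add: null_sets_def)
    then show "AE x in \<sigma>. \<not> (x \<in> {x\<in>\<Gamma>. B < g x} \<inter> cball 0 (real k))" by (rule AE_not_in)
  qed
  then show ?thesis
  proof (rule AE_mp, intro AE_I2 impI)
    fix x assume x: "x \<in> space \<sigma>" "\<forall>k::nat. \<not> (x \<in> {x\<in>\<Gamma>. B < g x} \<inter> cball 0 (real k))"
    obtain k :: nat where "norm x \<le> real k" using real_arch_simple by blast
    then show "g x \<le> B" using x by (auto simp: not_less[symmetric])
  qed
qed

end

section \<open>Integrability up to the boundary\<close>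

lemma lebesgue_borel_measurable_continuous [intro]:
  fixes f :: "real ^ 'n \<Rightarrow> real"
  shows "continuous_on UNIV f \<Longrightarrow> f \<in> borel_measurable lebesgue"
  by (intro measurable_completion) (auto intro: borel_measurable_continuous_onI)

text \<open>Measurability is known on \<open>D\<close> only; the extension by zero carries it to the
  whole space.\<close>

lemma set_integrable_of_nn_integral:
  fixes f :: "'a \<Rightarrow> real"
  assumes D: "D \<in> sets M" and f: "f \<in> borel_measurable (restrict_space M D)"
    and S: "S \<in> sets M" "S \<subseteq> D" and fin: "(\<integral>\<^sup>+x\<in>S. ennreal \<bar>f x\<bar> \<partial>M) < \<infinity>"
  shows "set_integrable M S f"
  unfolding set_integrable_def
proof (rule integrableI_bounded)
  have "(\<lambda>x. indicator D x *\<^sub>R f x) \<in> borel_measurable M"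
    using f D by (subst (asm) borel_measurable_restrict_space_iff) auto
  then have "(\<lambda>x. indicator S x *\<^sub>R (indicator D x *\<^sub>R f x)) \<in> borel_measurable M"
    using S(1) by measurable
  moreover have "(\<lambda>x. indicator S x *\<^sub>R (indicator D x *\<^sub>R f x)) = (\<lambda>x. indicator S x *\<^sub>R f x)"
    using S(2) by (auto simp: indicator_def fun_eq_iff)
  ultimately show "(\<lambda>x. indicator S x *\<^sub>R f x) \<in> borel_measurable M" by simp
  have "(\<integral>\<^sup>+x. ennreal (norm (indicator S x *\<^sub>R f x)) \<partial>M) = (\<integral>\<^sup>+x\<in>S. ennreal \<bar>f x\<bar> \<partial>M)"
    by (intro nn_integral_cong) (auto simp: indicator_def)
  then show "(\<integral>\<^sup>+x. ennreal (norm (indicator S x *\<^sub>R f x)) \<partial>M) < \<infinity>" using fin by simp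
qed

lemma bdry_layer_subset: "bdry_layer \<Omega> \<delta> \<subseteq> \<Omega>"
  by (auto simp: bdry_layer_def)

lemma open_bdry_layer:
  assumes "open \<Omega>"
  shows "open (bdry_layer \<Omega> \<delta>)"
proof (cases \<delta>)
  case (real d)
  have "bdry_layer \<Omega> \<delta> = \<Omega> \<inter> (\<Union>y\<in>frontier \<Omega>. ball y d)"
    using real by (auto simp: bdry_layer_def bdry_dist_def INF_less_iff ennreal_less_iff dist_commute)
  then show ?thesis using assms by auto
qed (use assms in \<open>simp add: bdry_layer_def\<close>)

text \<open>The norm controls balls of one fixed radius, and finitely many of them cover a bounded
  set. On each of them \<open>\<bar>w\<bar> \<le> 1 + \<bar>w\<bar> ^ p\<close> turns integrability
  of the power into integrability of \<open>w\<close>.\<close>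

lemma Lp_ul_set_integrable:
  fixes w :: "real ^ 'n \<Rightarrow> real"
  assumes w: "w \<in> Lp_ul p r\<^sub>0 D" and p: "0 < p" and r: "0 < r\<^sub>0" and D: "open D"
  shows "set_integrable lebesgue (D \<inter> cball 0 R) w"
proof -
  have wm: "w \<in> borel_measurable (lebesgue_on D)" using w by (simp add: Lp_ul_def Lp_loc_def)
  have Ds: "D \<in> sets lebesgue" using D by (simp add: borel_open)
  have loc: "set_integrable lebesgue (cball x r\<^sub>0 \<inter> D) w" for x
  proof (rule set_integrable_of_nn_integral[OF Ds wm])
    show S: "cball x r\<^sub>0 \<inter> D \<in> sets lebesgue" using Ds by auto
    have "Lp_norm p (cball x r\<^sub>0 \<inter> D) w \<le> Lp_ul_norm p r\<^sub>0 D w"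
      unfolding Lp_ul_norm_def by (rule SUP_upper) simp
    also have "\<dots> < \<infinity>" using w by (simp add: Lp_ul_def)
    finally have fin: "(\<integral>\<^sup>+y \<in> cball x r\<^sub>0 \<inter> D. ennreal (\<bar>w y\<bar> ^ p) \<partial>lebesgue) < \<infinity>"
      by (auto simp: Lp_norm_def ennreal_root_def less_top split: if_splits)
    have m: "(\<lambda>y. ennreal (\<bar>w y\<bar> ^ p) * indicator (cball x r\<^sub>0 \<inter> D) y) \<in> borel_measurable lebesgue"
    proof -
      have "(\<lambda>y. indicator D y *\<^sub>R w y) \<in> borel_measurable lebesgue"
        using wm Ds by (subst (asm) borel_measurable_restrict_space_iff) auto
      then have "(\<lambda>y. ennreal (\<bar>indicator D y *\<^sub>R w y\<bar> ^ p) * indicator (cball x r\<^sub>0 \<inter> D) y) \<in> borel_measurable lebesgue"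
        using S by measurable
      moreover have "(\<lambda>y. ennreal (\<bar>indicator D y *\<^sub>R w y\<bar> ^ p) * indicator (cball x r\<^sub>0 \<inter> D) y)
          = (\<lambda>y. ennreal (\<bar>w y\<bar> ^ p) * indicator (cball x r\<^sub>0 \<inter> D) y)"
        by (auto simp: indicator_def fun_eq_iff)
      ultimately show ?thesis by simp
    qed
    have "(\<integral>\<^sup>+y \<in> cball x r\<^sub>0 \<inter> D. ennreal \<bar>w y\<bar> \<partial>lebesgue)
        \<le> (\<integral>\<^sup>+y. indicator (cball x r\<^sub>0) y + ennreal (\<bar>w y\<bar> ^ p) * indicator (cball x r\<^sub>0 \<inter> D) y \<partial>lebesgue)"
    proof (rule nn_integral_mono)
      fix y
      have "\<bar>w y\<bar> \<le> 1 + \<bar>w y\<bar> ^ p"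
      proof (cases "\<bar>w y\<bar> \<le> 1")
        case False
        then have "\<bar>w y\<bar> \<le> \<bar>w y\<bar> ^ p" using p by (intro self_le_power) auto
        then show ?thesis by simp
      qed (simp add: add_increasing2)
      then have "ennreal \<bar>w y\<bar> \<le> 1 + ennreal (\<bar>w y\<bar> ^ p)"
        by (metis ennreal_1 ennreal_leI ennreal_plus zero_le_one zero_le_power abs_ge_zero)
      then show "ennreal \<bar>w y\<bar> * indicator (cball x r\<^sub>0 \<inter> D) y
          \<le> indicator (cball x r\<^sub>0) y + ennreal (\<bar>w y\<bar> ^ p) * indicator (cball x r\<^sub>0 \<inter> D) y"
        by (auto simp: indicator_def)
    qed
    also have "\<dots> = emeasure lebesgue (cball x r\<^sub>0) + (\<integral>\<^sup>+y \<in> cball x r\<^sub>0 \<inter> D. ennreal (\<bar>w y\<bar> ^ p) \<partial>lebesgue)"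
    proof (subst nn_integral_add[OF _ m])
      show ball: "(indicator (cball x r\<^sub>0) :: _ \<Rightarrow> ennreal) \<in> borel_measurable lebesgue"
        by (intro borel_measurable_indicator) auto
    qed auto
    also have "\<dots> < \<infinity>" using fin emeasure_lborel_cball_finite[of x r\<^sub>0] by (simp add: less_top)
    finally show "(\<integral>\<^sup>+y \<in> cball x r\<^sub>0 \<inter> D. ennreal \<bar>w y\<bar> \<partial>lebesgue) < \<infinity>" .
  qed auto
  obtain F where "F \<subseteq> cball (0 :: real ^ 'n) R" and F: "finite F" "cball 0 R \<subseteq> (\<Union>x\<in>F. ball x r\<^sub>0)"
    using compact_finite_ball_cover[OF compact_cball[of 0 R] r] by (elim exE conjE)
  have "set_integrable lebesgue (\<Union>x\<in>F. cball x r\<^sub>0 \<inter> D) w"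
    using F(1) loc Ds by (intro set_integrable_UN) auto
  then show ?thesis
  proof (rule set_integrable_subset)
    show "D \<inter> cball 0 R \<subseteq> (\<Union>x\<in>F. cball x r\<^sub>0 \<inter> D)"
    proof
      fix x assume x: "x \<in> D \<inter> cball 0 R"
      then obtain y where y: "y \<in> F" "x \<in> ball y r\<^sub>0" using subsetD[OF F(2), of x] by auto
      then have "x \<in> cball y r\<^sub>0 \<inter> D" using x by simp
      then show "x \<in> (\<Union>x\<in>F. cball x r\<^sub>0 \<inter> D)" using y(1) by blast
    qed
  qed (use Ds in auto)
qed

text \<open>\<open>L1_loc\<close> speaks about compact subsets; an exhaustion of
  \<open>\<Omega>\<close> by such sets gives measurability as a pointwise limit.\<close>

lemma L1_loc_borel_measurable:
  fixes f :: "real ^ 'n \<Rightarrow> real"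
  assumes f: "L1_loc \<Omega> f" and "open \<Omega>"
  shows "f \<in> borel_measurable (lebesgue_on \<Omega>)"
proof -
  obtain C :: "nat \<Rightarrow> (real ^ 'n) set" where C: "\<And>n. compact (C n)" "\<And>n. C n \<subseteq> \<Omega>" "\<And>K. compact K \<Longrightarrow> K \<subseteq> \<Omega> \<Longrightarrow> \<exists>N. \<forall>n\<ge>N. K \<subseteq> C n"
  proof (rule open_Union_compact_subsets[OF assms(2)])
    fix C :: "nat \<Rightarrow> (real ^ 'n) set"
    assume C: "\<And>n. compact (C n)" "\<And>n. C n \<subseteq> \<Omega>" "\<And>K. compact K \<Longrightarrow> K \<subseteq> \<Omega> \<Longrightarrow> \<exists>N. \<forall>n\<ge>N. K \<subseteq> C n"
    show thesis by (rule that[of C]) (fact C)+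
  qed
  have Os: "\<Omega> \<in> sets lebesgue" using assms(2) by (simp add: borel_open)
  have "(\<lambda>x. indicator \<Omega> x *\<^sub>R f x) \<in> borel_measurable lebesgue"
  proof (rule borel_measurable_LIMSEQ_real)
    show "(\<lambda>x. indicator (C n) x *\<^sub>R f x) \<in> borel_measurable lebesgue" for n
      using f C(1,2)[of n] by (auto simp: L1_loc_def set_integrable_def)
    show "(\<lambda>n. indicator (C n) x *\<^sub>R f x) \<longlonglongrightarrow> indicator \<Omega> x *\<^sub>R f x" for x
    proof (cases "x \<in> \<Omega>")
      case True
      then obtain N where "\<And>n. n \<ge> N \<Longrightarrow> x \<in> C n" using C(3)[of "{x}"] by auto
      then have "\<forall>n\<ge>N. indicator (C n) x *\<^sub>R f x = indicator \<Omega> x *\<^sub>R f x" using True by simp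
      then have "\<forall>\<^sub>F n in sequentially. indicator (C n) x *\<^sub>R f x = indicator \<Omega> x *\<^sub>R f x"
        unfolding eventually_sequentially by blast
      then show ?thesis by (rule tendsto_eventually)
    next
      case False
      then have "x \<notin> C n" for n using C(2) by blast
      then show ?thesis using False by simp
    qed
  qed
  then show ?thesis using Os by (subst borel_measurable_restrict_space_iff) auto
qed

lemma b_seminorm_nn_integral_le:
  fixes f :: "real ^ 'n \<Rightarrow> real"
  assumes "z \<in> frontier \<Omega>" "0 < r" "ennreal r < \<nu>"
  shows "(\<integral>\<^sup>+y \<in> \<Omega> \<inter> cball z r. ennreal \<bar>f y\<bar> \<partial>lebesgue) \<le> ennreal (r ^ CARD('n)) * b_seminorm \<Omega> \<nu> f"
proof -
  let ?X = "\<integral>\<^sup>+y \<in> \<Omega> \<inter> cball z r. ennreal \<bar>f y\<bar> \<partial>lebesgue"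
  have "?X = ennreal (r ^ CARD('n)) * (ennreal (1 / r ^ CARD('n)) * ?X)"
    using assms(2) by (simp add: mult.assoc[symmetric] flip: ennreal_mult)
  also have "\<dots> \<le> ennreal (r ^ CARD('n)) * b_seminorm \<Omega> \<nu> f"
    unfolding b_seminorm_def using assms
    by (intro mult_left_mono SUP_upper2[of "(z, r)"]) auto
  finally show ?thesis .
qed

lemma b_seminorm_set_integrable_cball:
  fixes f :: "real ^ 'n \<Rightarrow> real"
  assumes f: "L1_loc \<Omega> f" "b_seminorm \<Omega> \<nu> f < \<infinity>" and "open \<Omega>"
    and z: "z \<in> frontier \<Omega>" "0 < r" "ennreal r < \<nu>"
  shows "set_integrable lebesgue (\<Omega> \<inter> cball z r) f"
    and "(LINT y:\<Omega> \<inter> cball z r|lebesgue. \<bar>f y\<bar>) \<le> r ^ CARD('n) * enn2real (b_seminorm \<Omega> \<nu> f)"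
proof -
  have Os: "\<Omega> \<in> sets lebesgue" using assms(3) by (simp add: borel_open)
  have le: "(\<integral>\<^sup>+y \<in> \<Omega> \<inter> cball z r. ennreal \<bar>f y\<bar> \<partial>lebesgue) \<le> ennreal (r ^ CARD('n)) * b_seminorm \<Omega> \<nu> f"
    by (rule b_seminorm_nn_integral_le[OF z])
  also have eq: "\<dots> = ennreal (r ^ CARD('n) * enn2real (b_seminorm \<Omega> \<nu> f))"
    using f(2) z(2) by (simp add: ennreal_mult less_top)
  also have "\<dots> < \<infinity>" by simp
  finally show int: "set_integrable lebesgue (\<Omega> \<inter> cball z r) f"
    using Os by (intro set_integrable_of_nn_integral[OF Os L1_loc_borel_measurable[OF f(1) assms(3)]]) auto
  have "ennreal (LINT y:\<Omega> \<inter> cball z r|lebesgue. \<bar>f y\<bar>) = (\<integral>\<^sup>+y \<in> \<Omega> \<inter> cball z r. ennreal \<bar>f y\<bar> \<partial>lebesgue)"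
  proof -
    have "(\<integral>\<^sup>+y \<in> \<Omega> \<inter> cball z r. ennreal \<bar>f y\<bar> \<partial>lebesgue) = (\<integral>\<^sup>+y. ennreal (indicator (\<Omega> \<inter> cball z r) y *\<^sub>R \<bar>f y\<bar>) \<partial>lebesgue)"
      by (intro nn_integral_cong) (auto simp: indicator_def)
    also have "\<dots> = ennreal (LINT y:\<Omega> \<inter> cball z r|lebesgue. \<bar>f y\<bar>)"
      unfolding set_lebesgue_integral_def
      using set_integrable_abs[OF int] by (intro nn_integral_eq_integral) (auto simp: set_integrable_def)
    finally show ?thesis ..
  qed
  then have "ennreal (LINT y:\<Omega> \<inter> cball z r|lebesgue. \<bar>f y\<bar>) \<le> ennreal (r ^ CARD('n) * enn2real (b_seminorm \<Omega> \<nu> f))"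
    using le eq by simp
  then show "(LINT y:\<Omega> \<inter> cball z r|lebesgue. \<bar>f y\<bar>) \<le> r ^ CARD('n) * enn2real (b_seminorm \<Omega> \<nu> f)"
    using z(2) by (subst (asm) ennreal_le_iff) auto
qed

text \<open>Finitely many balls centred on the boundary, on which the b-seminorm gives
  integrability, cover the boundary part of the large ball. What remains of the closure of the
  domain is compact and lies in \<open>\<Omega>\<close>, where \<open>L1_loc\<close>
  applies.\<close>

lemma b_seminorm_set_integrable:
  fixes f :: "real ^ 'n \<Rightarrow> real"
  assumes f: "L1_loc \<Omega> f" "b_seminorm \<Omega> \<nu> f < \<infinity>" and op: "open \<Omega>" and \<nu>: "0 < \<nu>"
  shows "set_integrable lebesgue (\<Omega> \<inter> cball 0 R) f"
proof -
  obtain \<rho> where \<rho>: "0 < \<rho>" "ennreal \<rho> < \<nu>" using ennreal_real_below[OF \<nu>] by blast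
  have Os: "\<Omega> \<in> sets lebesgue" using op by (simp add: borel_open)
  have "compact (frontier \<Omega> \<inter> cball 0 R)" by (simp add: closed_Int_compact)
  from compact_finite_ball_cover[OF this \<rho>(1)] obtain F where F: "F \<subseteq> frontier \<Omega> \<inter> cball 0 R" "finite F" "frontier \<Omega> \<inter> cball 0 R \<subseteq> (\<Union>z\<in>F. ball z \<rho>)"
    by (elim exE conjE)
  define K where "K = closure \<Omega> \<inter> cball 0 R - (\<Union>z\<in>F. ball z \<rho>)"
  have cK: "compact K" unfolding K_def by (intro compact_diff closed_Int_compact) auto
  have "K \<subseteq> \<Omega>"
  proof
    fix x assume x: "x \<in> K"
    then have "x \<notin> frontier \<Omega>" using subsetD[OF F(3), of x] unfolding K_def by auto
    then show "x \<in> \<Omega>" using x op unfolding K_def by (simp add: frontier_def interior_open)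
  qed
  then have iK: "set_integrable lebesgue K f" using f(1) cK by (simp add: L1_loc_def)
  have iF: "set_integrable lebesgue (\<Union>z\<in>F. \<Omega> \<inter> cball z \<rho>) f"
    using F(1,2) Os by (intro set_integrable_UN b_seminorm_set_integrable_cball(1)[OF f op _ \<rho>]) auto
  have "set_integrable lebesgue (K \<union> (\<Union>z\<in>F. \<Omega> \<inter> cball z \<rho>)) f"
    using F(2) Os cK by (intro set_integrable_Un iK iF) (auto intro!: sets.finite_UN simp: borel_compact)
  then show ?thesis
  proof (rule set_integrable_subset)
    show "\<Omega> \<inter> cball 0 R \<subseteq> K \<union> (\<Union>z\<in>F. \<Omega> \<inter> cball z \<rho>)"
    proof
      fix x assume x: "x \<in> \<Omega> \<inter> cball 0 R"
      show "x \<in> K \<union> (\<Union>z\<in>F. \<Omega> \<inter> cball z \<rho>)"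
      proof (cases "x \<in> K")
        case False
        then obtain z where z: "z \<in> F" "x \<in> ball z \<rho>"
          using x closure_subset[of \<Omega>] unfolding K_def by auto
        then have "x \<in> \<Omega> \<inter> cball z \<rho>" using x by simp
        then show ?thesis using z(1) by blast
      qed simp
    qed
  qed (use Os in auto)
qed

lemma integrable_mult_bounded:
  fixes f g :: "'a \<Rightarrow> real"
  assumes f: "integrable M f" and g: "g \<in> borel_measurable M" "\<And>x. \<bar>g x\<bar> \<le> c"
  shows "integrable M (\<lambda>x. f x * g x)"
proof (rule Bochner_Integration.integrable_bound)
  show "integrable M (\<lambda>x. c * f x)" using f by simp
  show "(\<lambda>x. f x * g x) \<in> borel_measurable M" using f g(1) by measurable
  show "AE x in M. norm (f x * g x) \<le> norm (c * f x)"
  proof (rule AE_I2)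
    fix x
    have "0 \<le> c" using g(2)[of x] by linarith
    then show "norm (f x * g x) \<le> norm (c * f x)"
      using mult_left_mono[OF g(2)[of x], of "\<bar>f x\<bar>"] by (simp add: abs_mult mult.commute)
  qed
qed

lemma grad_component_facts:
  assumes "Ck 1 f" "compact (fun_support f)"
  shows "continuous_on UNIV (\<lambda>x. grad f x $ i)" "bounded {x. grad f x $ i \<noteq> 0}"
proof -
  show "continuous_on UNIV (\<lambda>x. grad f x $ i)" using assms(1) by simp
  show "bounded {x. grad f x $ i \<noteq> 0}"
  proof (rule bounded_subset[OF compact_imp_bounded[OF assms(2)]], rule subsetI)
    fix x assume "x \<in> {x. grad f x $ i \<noteq> 0}"
    then show "x \<in> fun_support f" using grad_outside_support(2)[of x f] by (cases "x \<in> fun_support f") auto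
  qed
qed

text \<open>The trace functional integrates over all of \<open>\<Omega>\<close>, so integrability is
  required on sets that reach the boundary; for \<open>w\<close> it is required in the layer, where
  the test functions live.\<close>

locale div_field =
  fixes \<Omega> :: "(real ^ 'n) set" and \<delta> :: ennreal and v :: "real ^ 'n \<Rightarrow> real ^ 'n" and w :: "real ^ 'n \<Rightarrow> real"
  assumes open_domain: "open \<Omega>"
    and v_int: "\<And>i R. set_integrable lebesgue (\<Omega> \<inter> cball 0 R) (\<lambda>x. v x $ i)"
    and w_int: "\<And>R. set_integrable lebesgue (bdry_layer \<Omega> \<delta> \<inter> cball 0 R) w"
    and div: "distributional_div (bdry_layer \<Omega> \<delta>) v w"
begin

abbreviation "D \<equiv> bdry_layer \<Omega> \<delta>"

definition trace_functional :: "(real ^ 'n \<Rightarrow> real) \<Rightarrow> real" where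
  "trace_functional \<phi> = (LINT x:\<Omega>|lebesgue. w x * \<phi> x) + (LINT x:\<Omega>|lebesgue. v x \<bullet> grad \<phi> x)"

lemma v_mult_integrable:
  assumes G: "\<And>i. (\<lambda>x. G x $ i) \<in> borel_measurable lebesgue" "\<And>i x. \<bar>G x $ i\<bar> \<le> c"
    and supp: "\<And>x. G x \<noteq> 0 \<Longrightarrow> norm x \<le> R"
  shows "integrable lebesgue (\<lambda>x. indicator \<Omega> x * (v x \<bullet> G x))"
proof -
  have "integrable lebesgue (\<lambda>x. \<Sum>i\<in>UNIV. (indicator (\<Omega> \<inter> cball 0 R) x *\<^sub>R v x $ i) * G x $ i)"
    by (intro Bochner_Integration.integrable_sum integrable_mult_bounded[where c=c] G v_int[unfolded set_integrable_def])
  moreover have "(\<lambda>x. \<Sum>i\<in>UNIV. (indicator (\<Omega> \<inter> cball 0 R) x *\<^sub>R v x $ i) * G x $ i) = (\<lambda>x. indicator \<Omega> x * (v x \<bullet> G x))"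
  proof
    fix x
    show "(\<Sum>i\<in>UNIV. (indicator (\<Omega> \<inter> cball 0 R) x *\<^sub>R v x $ i) * G x $ i) = indicator \<Omega> x * (v x \<bullet> G x)"
      using supp[of x] by (cases "G x = 0") (auto simp: indicator_def inner_vec_def)
  qed
  ultimately show ?thesis by simp
qed

lemma w_mult_integrable:
  assumes g: "g \<in> borel_measurable lebesgue" "\<And>x. \<bar>g x\<bar> \<le> c"
    and supp: "\<And>x. g x \<noteq> 0 \<Longrightarrow> norm x \<le> R" "\<And>x. x \<in> \<Omega> - D \<Longrightarrow> g x = 0"
  shows "integrable lebesgue (\<lambda>x. indicator \<Omega> x * (w x * g x))"
proof -
  have "integrable lebesgue (\<lambda>x. (indicator (D \<inter> cball 0 R) x *\<^sub>R w x) * g x)"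
    by (intro integrable_mult_bounded[where c=c] g w_int[unfolded set_integrable_def])
  moreover have "(\<lambda>x. (indicator (D \<inter> cball 0 R) x *\<^sub>R w x) * g x) = (\<lambda>x. indicator \<Omega> x * (w x * g x))"
  proof
    fix x
    show "(indicator (D \<inter> cball 0 R) x *\<^sub>R w x) * g x = indicator \<Omega> x * (w x * g x)"
      using supp[of x] bdry_layer_subset[of \<Omega> \<delta>] by (cases "g x = 0") (auto simp: indicator_def)
  qed
  ultimately show ?thesis by simp
qed

lemma trace_test_supportD:
  assumes "trace_test \<Omega> \<delta> \<phi>"
  shows "Ck 1 \<phi>" "compact (fun_support \<phi>)" "\<And>x. x \<in> \<Omega> - D \<Longrightarrow> \<phi> x = 0"
  using assms bdry_layer_mono[of _ \<delta> \<Omega>] unfolding trace_test_def by (blast dest: less_imp_le)+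

lemma trace_test_GDERIV: "trace_test \<Omega> \<delta> \<phi> \<Longrightarrow> GDERIV \<phi> x :> grad \<phi> x"
  by (rule Ck_GDERIV[OF trace_test_supportD(1)[unfolded One_nat_def]])

lemma trace_test_w_integrable:
  assumes \<phi>: "trace_test \<Omega> \<delta> \<phi>" and h: "continuous_on UNIV h" "\<And>x. \<bar>h x\<bar> \<le> 1"
  shows "integrable lebesgue (\<lambda>x. indicator \<Omega> x * (w x * (\<phi> x * h x)))"
proof -
  have c: "continuous_on UNIV \<phi>" by (rule trace_test_continuous[OF \<phi>])
  have b: "bounded {x. \<phi> x \<noteq> 0}" using trace_test_supportD(2)[OF \<phi>] by (simp add: compact_fun_support_iff)
  obtain C where C: "0 \<le> C" "\<And>x. \<bar>\<phi> x\<bar> \<le> C" using continuous_compact_support_bounded[OF c b] by blast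
  obtain R where R: "\<And>x. \<phi> x \<noteq> 0 \<Longrightarrow> norm x \<le> R" using b by (auto simp: bounded_iff)
  show ?thesis
  proof (rule w_mult_integrable)
    show "(\<lambda>x. \<phi> x * h x) \<in> borel_measurable lebesgue"
      by (intro lebesgue_borel_measurable_continuous continuous_on_mult c h)
    show "\<bar>\<phi> x * h x\<bar> \<le> C * 1" for x unfolding abs_mult by (intro mult_mono C h) auto
    show "norm x \<le> R" if "\<phi> x * h x \<noteq> 0" for x using R[of x] that by auto
    show "\<phi> x * h x = 0" if "x \<in> \<Omega> - D" for x using trace_test_supportD(3)[OF \<phi> that] by simp
  qed
qed

lemma v_grad_mult_integrable:
  assumes \<phi>: "Ck 1 \<phi>" "compact (fun_support \<phi>)" and h: "continuous_on UNIV h" "\<And>x. \<bar>h x\<bar> \<le> c"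
  shows "integrable lebesgue (\<lambda>x. indicator \<Omega> x * (v x \<bullet> (h x *\<^sub>R grad \<phi> x)))"
proof -
  have c0: "0 \<le> c" using h(2)[of 0] by linarith
  have "\<exists>C. \<forall>x. \<bar>grad \<phi> x $ i\<bar> \<le> C" for i
    using continuous_compact_support_bounded[OF grad_component_facts[OF \<phi>]] by metis
  then obtain C where C: "\<And>i x. \<bar>grad \<phi> x $ i\<bar> \<le> C i" by metis
  obtain R where R: "\<And>x. x \<in> fun_support \<phi> \<Longrightarrow> norm x \<le> R" using compact_imp_bounded[OF \<phi>(2)] by (auto simp: bounded_iff)
  have Cm: "C i \<le> Max (range C)" for i by simp
  show ?thesis
  proof (rule v_mult_integrable)
    show "(\<lambda>x. (h x *\<^sub>R grad \<phi> x) $ i) \<in> borel_measurable lebesgue" for i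
      unfolding vector_scaleR_component real_scaleR_def
      by (intro lebesgue_borel_measurable_continuous continuous_on_mult h grad_component_facts[OF \<phi>])
    show "\<bar>(h x *\<^sub>R grad \<phi> x) $ i\<bar> \<le> c * Max (range C)" for i x
      unfolding vector_scaleR_component real_scaleR_def abs_mult
      by (intro mult_mono h order_trans[OF C Cm] c0) auto
    show "norm x \<le> R" if "h x *\<^sub>R grad \<phi> x \<noteq> 0" for x
    proof (rule R, rule ccontr)
      assume "x \<notin> fun_support \<phi>"
      then show False using grad_outside_support(2)[of x \<phi>] that by simp
    qed
  qed
qed

lemma trace_functional_add:
  assumes "trace_test \<Omega> \<delta> f" "trace_test \<Omega> \<delta> g"
  shows "trace_functional (\<lambda>x. f x + g x) = trace_functional f + trace_functional g"
proof -
  have gr: "grad (\<lambda>x. f x + g x) x = grad f x + grad g x" for x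
    by (intro GDERIV_imp_grad GDERIV_add trace_test_GDERIV assms)
  have "integrable lebesgue (\<lambda>x. indicator \<Omega> x * (w x * (\<phi> x * 1)))" if "trace_test \<Omega> \<delta> \<phi>" for \<phi>
    by (rule trace_test_w_integrable[OF that]) auto
  moreover have "integrable lebesgue (\<lambda>x. indicator \<Omega> x * (v x \<bullet> (1 *\<^sub>R grad \<phi> x)))" if "trace_test \<Omega> \<delta> \<phi>" for \<phi>
    by (rule v_grad_mult_integrable[OF trace_test_supportD(1,2)[OF that], of "\<lambda>_. 1" 1]) auto
  ultimately show ?thesis using assms
    by (simp add: trace_functional_def set_lebesgue_integral_def gr inner_add_right distrib_left)
qed

lemma trace_functional_scale:
  assumes "trace_test \<Omega> \<delta> f"
  shows "trace_functional (\<lambda>x. c * f x) = c * trace_functional f"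
proof -
  have gr: "grad (\<lambda>x. c * f x) x = c *\<^sub>R grad f x" for x
  proof (rule GDERIV_imp_grad)
    have "GDERIV (\<lambda>x. c * f x) x :> c *\<^sub>R grad f x + f x *\<^sub>R 0"
      by (intro GDERIV_mult GDERIV_const trace_test_GDERIV assms)
    then show "GDERIV (\<lambda>x. c * f x) x :> c *\<^sub>R grad f x" by simp
  qed
  have "trace_functional (\<lambda>x. c * f x) = (LINT x|lebesgue. c * (indicator \<Omega> x * (w x * f x))) + (LINT x|lebesgue. c * (indicator \<Omega> x * (v x \<bullet> grad f x)))"
    by (simp add: trace_functional_def set_lebesgue_integral_def gr mult_ac)
  then show ?thesis
    by (simp add: trace_functional_def set_lebesgue_integral_def distrib_left)
qed

end

section \<open>The trace functional near the boundary\<close>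

context div_field
begin

lemma trace_functional_eq_0_off_boundary:
  assumes \<phi>: "trace_test \<Omega> \<delta> \<phi>" and off: "fun_support \<phi> \<inter> frontier \<Omega> = {}"
  shows "trace_functional \<phi> = 0"
proof -
  define \<psi> where "\<psi> = (\<lambda>x. if x \<in> \<Omega> then \<phi> x else 0)"
  define P where "P = fun_support \<phi> \<inter> \<Omega>"
  \<comment> \<open>Since the support misses the boundary, it meets \<open>\<Omega>\<close> and its
    closure in the same set. This makes \<open>P\<close> compact, and \<open>\<phi>\<close> can be
    continued by zero across the boundary without loss of smoothness.\<close>
  have P_eq: "P = fun_support \<phi> \<inter> closure \<Omega>"
    using off open_domain by (auto simp: P_def frontier_def interior_open closure_subset[THEN subsetD])
  have cP: "compact P" unfolding P_eq by (intro compact_Int_closed trace_test_supportD(2)[OF \<phi>]) simp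
  have zero: "\<psi> x = 0" if "x \<notin> P" for x
    using that nonzero_in_fun_support[of \<phi> x] by (auto simp: \<psi>_def P_def)
  have gr: "GDERIV \<psi> x :> (if x \<in> \<Omega> then grad \<phi> x else 0)" for x
  proof (cases "x \<in> \<Omega>")
    case True
    have "(\<phi> has_derivative (\<lambda>h. h \<bullet> grad \<phi> x)) (at x)"
      using trace_test_GDERIV[OF \<phi>] by (simp add: gderiv_def)
    then have "(\<psi> has_derivative (\<lambda>h. h \<bullet> grad \<phi> x)) (at x)"
      by (rule has_derivative_transform_within_open[OF _ open_domain True]) (simp add: \<psi>_def)
    then show ?thesis using True by (simp add: gderiv_def)
  next
    case False
    then have xP: "x \<in> - P" by (simp add: P_def)
    have "((\<lambda>_. 0) has_derivative (\<lambda>h. h \<bullet> 0)) (at x)" by auto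
    then have "(\<psi> has_derivative (\<lambda>h. h \<bullet> 0)) (at x)"
      by (rule has_derivative_transform_within_open[OF _ _ xP]) (use cP zero in \<open>auto simp: compact_imp_closed\<close>)
    then show ?thesis using False by (simp add: gderiv_def)
  qed
  then have gr_eq: "grad \<psi> x = (if x \<in> \<Omega> then grad \<phi> x else 0)" for x
    by (rule GDERIV_imp_grad)
  have Ck: "Ck (Suc 0) \<psi>"
  proof (rule Ck_SucI[OF gr])
    fix i
    let ?g = "\<lambda>x. (if x \<in> \<Omega> then grad \<phi> x else 0) $ i"
    \<comment> \<open>Continuity of the gradient is checked on the open sets \<open>\<Omega>\<close>
      and \<open>- P\<close>, which together cover the space.\<close>
    have c1: "continuous_on \<Omega> ?g"
    proof (subst continuous_on_cong[OF refl])
      show "continuous_on \<Omega> (\<lambda>x. grad \<phi> x $ i)"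
        using grad_component_facts(1)[OF trace_test_supportD(1,2)[OF \<phi>]] continuous_on_subset by blast
    qed simp
    have c2: "continuous_on (- P) ?g"
    proof (subst continuous_on_cong[OF refl])
      show "continuous_on (- P) (\<lambda>x. 0 :: real)" by simp
      show "?g x = 0" if "x \<in> - P" for x
        using that grad_outside_support(2)[of x \<phi>] by (auto simp: P_def)
    qed
    have "continuous_on (\<Omega> \<union> - P) ?g"
      by (rule continuous_on_open_Un[OF open_domain _ c1 c2]) (use cP in \<open>auto simp: compact_imp_closed\<close>)
    moreover have "\<Omega> \<union> - P = UNIV" by (auto simp: P_def)
    ultimately show "Ck 0 ?g" by simp
  qed
  define Q where "Q = fun_support \<psi>"
  have QP: "Q \<subseteq> P" unfolding Q_def fun_support_def
    by (rule closure_minimal) (use zero cP in \<open>auto simp: compact_imp_closed\<close>)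
  have cQ: "compact Q" using QP cP unfolding Q_def fun_support_def
    by (meson bounded_subset closed_closure compact_eq_bounded_closed)
  \<comment> \<open>Points of the support are limits of points where \<open>\<psi>\<close> does not
    vanish; the strict inequality \<open>\<delta>' < \<delta>\<close> leaves room for this
    limit.\<close>
  have QD: "Q \<subseteq> D"
  proof (cases "\<delta> = \<infinity>")
    case True
    then show ?thesis using QP by (auto simp: bdry_layer_def P_def)
  next
    case False
    obtain \<delta>' where \<delta>': "0 < \<delta>'" "\<delta>' < \<delta>" "\<forall>x \<in> \<Omega> - bdry_layer \<Omega> \<delta>'. \<phi> x = 0"
      using \<phi> unfolding trace_test_def by blast
    obtain d where d: "\<delta> = ennreal d" "0 \<le> d" using False by (cases \<delta>) auto
    obtain d' where d': "\<delta>' = ennreal d'" "0 \<le> d'" using \<delta>'(2) d(1) by (cases \<delta>') auto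
    have dd: "d' < d" using \<delta>'(2) d d' by (simp add: ennreal_less_iff)
    show ?thesis
    proof
      fix x assume x: "x \<in> Q"
      then have "\<forall>\<epsilon>>0. \<exists>y\<in>{x. \<psi> x \<noteq> 0}. dist y x < \<epsilon>"
        unfolding Q_def fun_support_def closure_approachable .
      moreover have "0 < d - d'" using dd by simp
      ultimately obtain y where y: "\<psi> y \<noteq> 0" "dist y x < d - d'" by blast
      then have "y \<in> \<Omega>" "\<phi> y \<noteq> 0" by (auto simp: \<psi>_def split: if_splits)
      then have "y \<in> bdry_layer \<Omega> \<delta>'" using \<delta>'(3) by auto
      then have "bdry_dist \<Omega> y < \<delta>'" using d'(1) by (simp add: bdry_layer_def)
      then obtain p where p: "p \<in> frontier \<Omega>" "dist y p < d'"
        unfolding bdry_dist_def INF_less_iff d'(1) by (auto simp: ennreal_less_iff)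
      have "dist x p < d" using dist_triangle[of x p y] p(2) y(2) by (simp add: dist_commute)
      then have "bdry_dist \<Omega> x < \<delta>"
        unfolding bdry_dist_def INF_less_iff d(1) using p(1) by (auto simp: ennreal_less_iff)
      then show "x \<in> D" using x QP False by (auto simp: bdry_layer_def P_def)
    qed
  qed
  have intw: "(LINT x:\<Omega>|lebesgue. w x * \<phi> x) = (LINT x:D|lebesgue. w x * \<psi> x)"
    unfolding set_lebesgue_integral_def
  proof (rule Bochner_Integration.integral_cong[OF refl])
    fix x
    show "indicat_real \<Omega> x *\<^sub>R (w x * \<phi> x) = indicat_real D x *\<^sub>R (w x * \<psi> x)"
      using trace_test_supportD(3)[OF \<phi>, of x] bdry_layer_subset[of \<Omega> \<delta>]
      by (auto simp: \<psi>_def indicator_def)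
  qed
  have intv: "(LINT x:\<Omega>|lebesgue. v x \<bullet> grad \<phi> x) = (LINT x:D|lebesgue. v x \<bullet> grad \<psi> x)"
    unfolding set_lebesgue_integral_def
  proof (rule Bochner_Integration.integral_cong[OF refl])
    fix x
    have "grad \<psi> x = 0" if "x \<notin> D"
      using grad_outside_support(2)[of x \<psi>] that QD by (auto simp: Q_def)
    then show "indicat_real \<Omega> x *\<^sub>R (v x \<bullet> grad \<phi> x) = indicat_real D x *\<^sub>R (v x \<bullet> grad \<psi> x)"
      using gr_eq[of x] bdry_layer_subset[of \<Omega> \<delta>] by (auto simp: indicator_def)
  qed
  show ?thesis
  proof (cases "Q = {}")
    case True
    then have "\<psi> x = 0" "grad \<psi> x = 0" for x
      using nonzero_in_fun_support[of \<psi> x] grad_outside_support(2)[of x \<psi>] by (auto simp: Q_def)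
    then show ?thesis by (simp add: trace_functional_def intw intv)
  next
    case False
    \<comment> \<open>A margin inside the layer: for \<open>e \<le> e0\<close> the smooth
      approximations are admissible in \<open>distributional_div\<close> and are all supported in
      the one compact set \<open>N\<close>.\<close>
    obtain e0 where e0: "0 < e0" "{x. infdist x Q \<le> e0} \<subseteq> D"
      by (rule compact_in_open_separated[OF False cQ open_bdry_layer[OF open_domain] QD])
    define N where "N = {x. infdist x Q \<le> e0}"
    have cN: "compact N" unfolding N_def by (rule compact_infdist_le[OF False cQ e0(1)])
    obtain R where R: "\<And>x. x \<in> N \<Longrightarrow> norm x \<le> R" using compact_imp_bounded[OF cN] by (auto simp: bounded_iff)
    have N0: "dist x y \<le> e0 \<Longrightarrow> y \<in> Q \<Longrightarrow> x \<in> N" for x y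
      unfolding N_def using infdist_le[of y Q x] by simp
    define Iw where "Iw = (LINT x|lebesgue. \<bar>indicator (D \<inter> cball 0 R) x *\<^sub>R w x\<bar>)"
    define Iv where "Iv = (\<Sum>i\<in>UNIV. LINT x|lebesgue. \<bar>indicator (\<Omega> \<inter> cball 0 R) x *\<^sub>R v x $ i\<bar>)"
    have iw: "integrable lebesgue (\<lambda>x. \<bar>indicator (D \<inter> cball 0 R) x *\<^sub>R w x\<bar>)"
      using w_int[of R] unfolding set_integrable_def by (rule integrable_abs)
    have iv: "integrable lebesgue (\<lambda>x. \<bar>indicator (\<Omega> \<inter> cball 0 R) x *\<^sub>R v x $ i\<bar>)" for i
      using v_int[of R i] unfolding set_integrable_def by (rule integrable_abs)
    \<comment> \<open>By the definition of the divergence the functional vanishes on the smooth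
      approximation. The error is at most \<open>e\<close> times the \<open>L1\<close> norms of
      \<open>w\<close> and \<open>v\<close> on fixed bounded sets.\<close>
    have small: "\<bar>trace_functional \<phi>\<bar> \<le> e * (Iw + Iv)" if e: "0 < e" "e \<le> e0" for e
    proof -
      obtain \<theta> where \<theta>: "\<And>k. Ck k \<theta>" "\<And>x. \<theta> x \<noteq> 0 \<Longrightarrow> \<exists>y \<in> fun_support \<psi>. dist x y \<le> e"
        "\<And>x. \<bar>\<theta> x - \<psi> x\<bar> \<le> e" "\<And>x. norm (grad \<theta> x - grad \<psi> x) \<le> e"
        by (rule smooth_approximation_C1[of \<psi> e]) (use Ck cQ e in \<open>auto simp: Q_def simp del: Ck.simps\<close>)
      have suppN: "fun_support \<theta> \<subseteq> N"
        unfolding fun_support_def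
      proof (rule closure_minimal)
        show "{x. \<theta> x \<noteq> 0} \<subseteq> N"
        proof
          fix x assume "x \<in> {x. \<theta> x \<noteq> 0}"
          then obtain y where "y \<in> fun_support \<psi>" "dist x y \<le> e" using \<theta>(2)[of x] by auto
          then show "x \<in> N" using N0[of x y] e(2) by (simp add: Q_def)
        qed
      qed (use cN in \<open>simp add: compact_imp_closed\<close>)
      have c\<theta>: "compact (fun_support \<theta>)"
        using bounded_subset[OF compact_imp_bounded[OF cN] suppN] by (simp add: fun_support_def compact_eq_bounded_closed)
      have Ck1: "Ck 1 \<theta>" by (rule \<theta>(1))
      have suppD: "fun_support \<theta> \<subseteq> D" using suppN e0(2) by (auto simp: N_def)
      have div0: "(LINT x:D|lebesgue. w x * \<theta> x) + (LINT x:D|lebesgue. v x \<bullet> grad \<theta> x) = 0"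
        using div \<theta>(1) c\<theta> suppD unfolding distributional_div_def by simp
      have QN: "Q \<subseteq> N" using e0(1) by (auto simp: N_def)
      have out: "\<theta> x = 0" "\<psi> x = 0" "grad \<theta> x = 0" "grad \<psi> x = 0" if "x \<notin> N" for x
        using that suppN QN nonzero_in_fun_support[of \<theta> x] nonzero_in_fun_support[of \<psi> x]
          grad_outside_support(2)[of x \<theta>] grad_outside_support(2)[of x \<psi>] by (auto simp: Q_def)
      have ND: "N \<subseteq> D" using e0(2) by (simp add: N_def)
      \<comment> \<open>In \<open>fw\<close> and \<open>fv\<close> the factors \<open>w\<close> and
        \<open>v\<close> are cut off to a ball, where they are integrable. The integrals do not
        change, because all functions concerned vanish off \<open>N\<close>.\<close>
      define fw where "fw = (\<lambda>f x. (indicator (D \<inter> cball 0 R) x *\<^sub>R w x) * f x)"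
      define fv where "fv = (\<lambda>f x. \<Sum>i\<in>UNIV. (indicator (\<Omega> \<inter> cball 0 R) x *\<^sub>R v x $ i) * grad f x $ i)"
      have fw_int: "integrable lebesgue (fw f)" if f: "Ck 1 f" "compact (fun_support f)" for f
      proof -
        have cf: "continuous_on UNIV f" using f(1) by (rule Ck_continuous)
        have bf: "bounded {x. f x \<noteq> 0}" using f(2) by (simp add: compact_fun_support_iff)
        obtain c where "0 \<le> c" "\<And>x. \<bar>f x\<bar> \<le> c" using continuous_compact_support_bounded[OF cf bf] by blast
        then show ?thesis unfolding fw_def
          by (intro integrable_mult_bounded[where c=c] w_int[unfolded set_integrable_def] lebesgue_borel_measurable_continuous cf)
      qed
      have fv_int: "integrable lebesgue (fv f)" if f: "Ck 1 f" "compact (fun_support f)" for f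
        unfolding fv_def
      proof (rule Bochner_Integration.integrable_sum)
        fix i
        obtain c where "0 \<le> c" "\<And>x. \<bar>grad f x $ i\<bar> \<le> c"
          using continuous_compact_support_bounded[OF grad_component_facts[OF f]] by blast
        then show "integrable lebesgue (\<lambda>x. (indicator (\<Omega> \<inter> cball 0 R) x *\<^sub>R v x $ i) * grad f x $ i)"
          by (intro integrable_mult_bounded[where c=c] v_int[unfolded set_integrable_def] lebesgue_borel_measurable_continuous grad_component_facts[OF f])
      qed
      have Lw: "(LINT x:D|lebesgue. w x * f x) = (LINT x|lebesgue. fw f x)" if "\<And>x. x \<notin> N \<Longrightarrow> f x = 0" for f
        unfolding set_lebesgue_integral_def fw_def
      proof (rule Bochner_Integration.integral_cong[OF refl])
        fix x
        show "indicator D x *\<^sub>R (w x * f x) = (indicator (D \<inter> cball 0 R) x *\<^sub>R w x) * f x"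
          using that[of x] R[of x] by (cases "x \<in> N") (auto simp: indicator_def)
      qed
      have Lv: "(LINT x:D|lebesgue. v x \<bullet> grad f x) = (LINT x|lebesgue. fv f x)" if "\<And>x. x \<notin> N \<Longrightarrow> grad f x = 0" for f
        unfolding set_lebesgue_integral_def fv_def
      proof (rule Bochner_Integration.integral_cong[OF refl])
        fix x
        show "indicator D x *\<^sub>R (v x \<bullet> grad f x) = (\<Sum>i\<in>UNIV. (indicator (\<Omega> \<inter> cball 0 R) x *\<^sub>R v x $ i) * grad f x $ i)"
          using that[of x] R[of x] subsetD[OF ND, of x] bdry_layer_subset[of \<Omega> \<delta>]
          by (cases "x \<in> N") (auto simp: indicator_def inner_vec_def)
      qed
      have \<psi>C: "Ck 1 \<psi>" "compact (fun_support \<psi>)" using Ck cQ by (simp_all add: Q_def)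
      have "trace_functional \<phi> = (LINT x|lebesgue. fw \<psi> x) + (LINT x|lebesgue. fv \<psi> x)"
        using Lw[of \<psi>] Lv[of \<psi>] out by (simp add: trace_functional_def intw intv)
      also have "\<dots> = (LINT x|lebesgue. fw \<psi> x - fw \<theta> x) + (LINT x|lebesgue. fv \<psi> x - fv \<theta> x)"
        using div0 Lw[of \<theta>] Lv[of \<theta>] out fw_int[OF \<psi>C] fw_int[OF Ck1 c\<theta>] fv_int[OF \<psi>C] fv_int[OF Ck1 c\<theta>]
        by simp
      finally have T_eq: "trace_functional \<phi> = (LINT x|lebesgue. fw \<psi> x - fw \<theta> x) + (LINT x|lebesgue. fv \<psi> x - fv \<theta> x)" .
      have w_le: "\<bar>LINT x|lebesgue. fw \<psi> x - fw \<theta> x\<bar> \<le> e * Iw"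
      proof -
        have "\<bar>LINT x|lebesgue. fw \<psi> x - fw \<theta> x\<bar> \<le> (LINT x|lebesgue. \<bar>fw \<psi> x - fw \<theta> x\<bar>)"
          by (rule integral_abs_bound)
        also have "\<dots> \<le> (LINT x|lebesgue. e * \<bar>indicator (D \<inter> cball 0 R) x *\<^sub>R w x\<bar>)"
        proof (rule integral_mono)
          fix x
          have "fw \<psi> x - fw \<theta> x = (indicator (D \<inter> cball 0 R) x *\<^sub>R w x) * (\<psi> x - \<theta> x)"
            by (simp add: fw_def right_diff_distrib)
          then show "\<bar>fw \<psi> x - fw \<theta> x\<bar> \<le> e * \<bar>indicator (D \<inter> cball 0 R) x *\<^sub>R w x\<bar>"
            using mult_left_mono[OF \<theta>(3)[of x], of "\<bar>indicator (D \<inter> cball 0 R) x *\<^sub>R w x\<bar>"]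
            by (simp only: abs_mult abs_minus_commute[of "\<psi> x"]) (simp add: mult.commute)
        qed (use fw_int[OF \<psi>C] fw_int[OF Ck1 c\<theta>] iw in auto)
        finally show ?thesis by (simp add: Iw_def)
      qed
      have v_le: "\<bar>LINT x|lebesgue. fv \<psi> x - fv \<theta> x\<bar> \<le> e * Iv"
      proof -
        have "\<bar>LINT x|lebesgue. fv \<psi> x - fv \<theta> x\<bar> \<le> (LINT x|lebesgue. \<bar>fv \<psi> x - fv \<theta> x\<bar>)"
          by (rule integral_abs_bound)
        also have "\<dots> \<le> (LINT x|lebesgue. (\<Sum>i\<in>UNIV. e * \<bar>indicator (\<Omega> \<inter> cball 0 R) x *\<^sub>R v x $ i\<bar>))"
        proof (rule integral_mono)
          fix x
          have le: "\<bar>grad \<psi> x $ i - grad \<theta> x $ i\<bar> \<le> e" for i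
            using component_le_norm_cart[of "grad \<theta> x - grad \<psi> x" i] \<theta>(4)[of x] by (simp add: abs_minus_commute)
          have "fv \<psi> x - fv \<theta> x = (\<Sum>i\<in>UNIV. (indicator (\<Omega> \<inter> cball 0 R) x *\<^sub>R v x $ i) * (grad \<psi> x $ i - grad \<theta> x $ i))"
            by (simp add: fv_def right_diff_distrib sum_subtractf)
          also have "\<bar>\<dots>\<bar> \<le> (\<Sum>i\<in>UNIV. \<bar>(indicator (\<Omega> \<inter> cball 0 R) x *\<^sub>R v x $ i) * (grad \<psi> x $ i - grad \<theta> x $ i)\<bar>)"
            by (rule sum_abs)
          also have "\<dots> \<le> (\<Sum>i\<in>UNIV. e * \<bar>indicator (\<Omega> \<inter> cball 0 R) x *\<^sub>R v x $ i\<bar>)"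
          proof (rule sum_mono)
            fix i
            show "\<bar>(indicator (\<Omega> \<inter> cball 0 R) x *\<^sub>R v x $ i) * (grad \<psi> x $ i - grad \<theta> x $ i)\<bar> \<le> e * \<bar>indicator (\<Omega> \<inter> cball 0 R) x *\<^sub>R v x $ i\<bar>"
              using mult_left_mono[OF le[of i], of "\<bar>indicator (\<Omega> \<inter> cball 0 R) x *\<^sub>R v x $ i\<bar>"]
              by (simp only: abs_mult mult.commute[of e])
          qed
          finally show "\<bar>fv \<psi> x - fv \<theta> x\<bar> \<le> (\<Sum>i\<in>UNIV. e * \<bar>indicator (\<Omega> \<inter> cball 0 R) x *\<^sub>R v x $ i\<bar>)" .
        qed (use fv_int[OF \<psi>C] fv_int[OF Ck1 c\<theta>] iv in \<open>auto intro!: Bochner_Integration.integrable_sum\<close>)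
        also have "\<dots> = (\<Sum>i\<in>UNIV. e * (LINT x|lebesgue. \<bar>indicator (\<Omega> \<inter> cball 0 R) x *\<^sub>R v x $ i\<bar>))"
          using iv by (subst Bochner_Integration.integral_sum) auto
        finally show ?thesis by (simp add: Iv_def sum_distrib_left)
      qed
      have "\<bar>trace_functional \<phi>\<bar> \<le> e * Iw + e * Iv" using T_eq w_le v_le by linarith
      then show ?thesis by (simp add: distrib_left)
    qed
    have nn: "0 \<le> Iw + Iv"
      unfolding Iw_def Iv_def by (intro add_nonneg_nonneg sum_nonneg Bochner_Integration.integral_nonneg) auto
    have "\<bar>trace_functional \<phi>\<bar> \<le> 0 + \<epsilon>" if "0 < \<epsilon>" for \<epsilon>
    proof -
      define e where "e = min e0 (\<epsilon> / (Iw + Iv + 1))"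
      have e: "0 < e" "e \<le> e0" using that e0(1) nn by (auto simp: e_def)
      have "e * (Iw + Iv) \<le> \<epsilon> / (Iw + Iv + 1) * (Iw + Iv)" using nn by (intro mult_right_mono) (auto simp: e_def)
      also have "\<dots> \<le> \<epsilon>" using nn that by (simp add: field_simps)
      finally show ?thesis using small[OF e] by simp
    qed
    then have "\<bar>trace_functional \<phi>\<bar> \<le> 0" by (rule field_le_epsilon)
    then show ?thesis by simp
  qed
qed

end

text \<open>\<open>c\<close> bounds the density of the surface measure from below, and
  \<open>b i\<close> stands for the b-seminorm of the \<open>i\<close>-th component of
  \<open>v\<close>; both estimates hold at scales up to \<open>\<rho>\<^sub>1\<close>.\<close>

locale boundary_trace = locally_finite_boundary \<Omega> \<delta> + div_field \<Omega> \<delta> v w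
  for \<Omega> :: "(real ^ 'n) set" and \<delta> v w +
  fixes c \<rho>\<^sub>1 :: real and b :: "'n \<Rightarrow> real"
  assumes c_pos: "0 < c" and \<rho>\<^sub>1_pos: "0 < \<rho>\<^sub>1"
    and surface_lower: "\<And>z r. z \<in> frontier \<Omega> \<Longrightarrow> 0 < r \<Longrightarrow> r \<le> \<rho>\<^sub>1 \<Longrightarrow>
      c * r ^ (CARD('n) - 1) \<le> measure (surface_measure \<Omega>) (frontier \<Omega> \<inter> cball z r)"
    and b_bound: "\<And>z r i. z \<in> frontier \<Omega> \<Longrightarrow> 0 < r \<Longrightarrow> r \<le> \<rho>\<^sub>1 \<Longrightarrow>
      (LINT y:\<Omega> \<inter> cball z r|lebesgue. \<bar>v y $ i\<bar>) \<le> r ^ CARD('n) * b i"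
begin

text \<open>At a net point \<open>z\<close> the volume side contributes
  \<open>4 / \<rho> * (6 * \<rho>) ^ n\<close> and the surface side
  \<open>c * \<rho> ^ (n - 1)\<close>, each times \<open>\<bar>\<phi> z\<bar>\<close> up to the
  oscillation \<open>e\<close>. Their quotient does not depend on \<open>\<rho>\<close>, which
  leaves a constant times a Riemann sum for the integral of \<open>\<bar>\<phi>\<bar>\<close> over
  the boundary.\<close>

lemma boundary_term_bound:
  fixes S :: "(real ^ 'n) set"
  assumes \<phi>: "trace_test \<Omega> \<delta> \<phi>" and e: "0 < e"
    and osc: "\<And>x y. dist y x \<le> 6 * \<rho> \<Longrightarrow> \<bar>\<phi> y - \<phi> x\<bar> \<le> e"
    and S: "compact S" "S \<subseteq> \<Gamma>" "S \<noteq> {}" "\<And>z. z \<in> S \<Longrightarrow> norm z \<le> B"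
    and \<rho>: "0 < \<rho>" "6 * \<rho> \<le> \<rho>\<^sub>1" "\<rho> \<le> 1"
    and \<theta>: "Ck 1 \<theta>" "compact (fun_support \<theta>)" "\<And>x. \<rho> \<le> infdist x S \<Longrightarrow> \<theta> x = 0" "\<And>x. norm (grad \<theta> x) \<le> 4 / \<rho>"
  shows "\<bar>LINT x|lebesgue. indicator \<Omega> x * (v x \<bullet> (\<phi> x *\<^sub>R grad \<theta> x))\<bar>
    \<le> 4 * 6 ^ CARD('n) * (\<Sum>i\<in>UNIV. b i) / c *
       ((LINT x|\<sigma>. \<bar>\<phi> x\<bar>) + 2 * e * measure \<sigma> (\<Gamma> \<inter> cball 0 (B + 1)))"
proof -
  let ?n = "CARD('n)" let ?b = "\<Sum>i\<in>UNIV. b i"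
  have c\<phi>: "continuous_on UNIV \<phi>" by (rule trace_test_continuous[OF \<phi>])
  obtain C where C: "0 \<le> C" "\<And>x. \<bar>\<phi> x\<bar> \<le> C"
    using continuous_compact_support_bounded[OF c\<phi>] trace_test_supportD(2)[OF \<phi>] by (metis compact_fun_support_iff)
  obtain Z where Z: "finite Z" "Z \<subseteq> S" "S \<subseteq> (\<Union>z\<in>Z. cball z (5 * \<rho>))"
    "pairwise (\<lambda>z z'. disjnt (cball z \<rho>) (cball z' \<rho>)) Z"
    using finite_separated_net[OF compact_imp_bounded[OF S(1)] \<rho>(1)] by metis
  have ZG: "z \<in> \<Gamma>" if "z \<in> Z" for z using that Z(2) S(2) by blast
  \<comment> \<open>Any boundary point forces this through \<open>b_bound\<close>.\<close>
  have bnn: "0 \<le> b i" for i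
  proof -
    obtain z where z: "z \<in> \<Gamma>" using S by blast
    have "0 \<le> (LINT y:\<Omega> \<inter> cball z \<rho>\<^sub>1|lebesgue. \<bar>v y $ i\<bar>)"
      unfolding set_lebesgue_integral_def by (intro Bochner_Integration.integral_nonneg) auto
    also have "\<dots> \<le> \<rho>\<^sub>1 ^ ?n * b i" by (rule b_bound[OF z \<rho>\<^sub>1_pos]) simp
    finally show ?thesis using zero_less_power[OF \<rho>\<^sub>1_pos, of ?n] by (auto simp: zero_le_mult_iff)
  qed
  have bnn': "0 \<le> ?b" by (intro sum_nonneg bnn)
  have supp\<theta>: "infdist x S \<le> \<rho>" if "grad \<theta> x \<noteq> 0" for x
  proof -
    have "fun_support \<theta> \<subseteq> {x. infdist x S \<le> \<rho>}"
      unfolding fun_support_def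
    proof (rule closure_minimal)
      show "closed {x. infdist x S \<le> \<rho>}"
        using compact_infdist_le[OF S(3,1) \<rho>(1)] by (rule compact_imp_closed)
      show "{x. \<theta> x \<noteq> 0} \<subseteq> {x. infdist x S \<le> \<rho>}"
      proof
        fix x assume "x \<in> {x. \<theta> x \<noteq> 0}"
        then show "x \<in> {x. infdist x S \<le> \<rho>}" using \<theta>(3)[of x] by force
      qed
    qed
    then show ?thesis using grad_outside_support(2)[of x \<theta>] that by auto
  qed
  define W where "W = (\<lambda>z x. \<Sum>i\<in>UNIV. indicator (\<Omega> \<inter> cball z (6 * \<rho>)) x *\<^sub>R \<bar>v x $ i\<bar>)"
  have v_int_cball: "set_integrable lebesgue (\<Omega> \<inter> cball z (6 * \<rho>)) (\<lambda>x. v x $ i)" for z i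
  proof (rule set_integrable_subset[OF v_int[of "norm z + 6 * \<rho>"]])
    show "\<Omega> \<inter> cball z (6 * \<rho>) \<in> sets lebesgue" using open_domain by auto
    show "\<Omega> \<inter> cball z (6 * \<rho>) \<subseteq> \<Omega> \<inter> cball 0 (norm z + 6 * \<rho>)"
      using norm_triangle_sub by (auto simp: dist_norm norm_minus_commute) (smt (verit) norm_triangle_sub norm_minus_commute)
  qed
  have vi: "integrable lebesgue (\<lambda>x. indicator (\<Omega> \<inter> cball z (6 * \<rho>)) x *\<^sub>R \<bar>v x $ i\<bar>)" for z i
    using set_integrable_abs[OF v_int_cball[of z i]] by (simp add: set_integrable_def)
  have Wi: "integrable lebesgue (W z)" for z
    unfolding W_def by (intro Bochner_Integration.integrable_sum vi)
  have W_nn: "0 \<le> W z x" for z x unfolding W_def by (intro sum_nonneg) auto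
  have W_le: "(LINT x|lebesgue. W z x) \<le> (6 * \<rho>) ^ ?n * ?b" if "z \<in> Z" for z
  proof -
    have "(LINT x|lebesgue. W z x) = (\<Sum>i\<in>UNIV. LINT x:\<Omega> \<inter> cball z (6 * \<rho>)|lebesgue. \<bar>v x $ i\<bar>)"
      unfolding W_def set_lebesgue_integral_def by (rule Bochner_Integration.integral_sum) (rule vi)
    also have "\<dots> \<le> (\<Sum>i\<in>UNIV. (6 * \<rho>) ^ ?n * b i)"
      by (intro sum_mono b_bound ZG that) (use \<rho> in auto)
    finally show ?thesis by (simp add: sum_distrib_left)
  qed
  define F where "F = (\<lambda>x. indicator \<Omega> x * (v x \<bullet> (\<phi> x *\<^sub>R grad \<theta> x)))"
  have Fint: "integrable lebesgue F"
    unfolding F_def using v_grad_mult_integrable[OF \<theta>(1,2) c\<phi> C(2)] .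
  \<comment> \<open>Where \<open>grad \<theta>\<close> does not vanish, \<open>x\<close> is within
    \<open>\<rho>\<close> of \<open>S\<close> and therefore within
    \<open>\<rho> + 5 * \<rho>\<close> of a net point \<open>z\<close>. There
    \<open>\<phi> x\<close> is replaced by \<open>\<phi> z\<close> at the cost
    \<open>e\<close>.\<close>
  have F_le: "\<bar>F x\<bar> \<le> (\<Sum>z\<in>Z. 4 / \<rho> * (\<bar>\<phi> z\<bar> + e) * W z x)" for x
  proof (cases "x \<in> \<Omega> \<and> grad \<theta> x \<noteq> 0")
    case True
    then have "infdist x S \<le> \<rho>" using supp\<theta> by blast
    moreover obtain a where a: "a \<in> S" "infdist x S = dist x a"
      using infdist_attains_inf[OF compact_imp_closed[OF S(1)] S(3)] by metis
    moreover obtain z where z: "z \<in> Z" "dist z a \<le> 5 * \<rho>" using subsetD[OF Z(3) a(1)] by auto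
    ultimately have dz: "dist z x \<le> 6 * \<rho>" using dist_triangle[of z x a] by (simp add: dist_commute)
    have "\<bar>\<phi> x\<bar> \<le> \<bar>\<phi> z\<bar> + e" using osc[of x z] dz by (simp add: dist_commute)
    moreover have "\<bar>v x \<bullet> grad \<theta> x\<bar> \<le> 4 / \<rho> * W z x"
    proof -
      have "\<bar>v x \<bullet> grad \<theta> x\<bar> \<le> norm (v x) * norm (grad \<theta> x)" by (rule Cauchy_Schwarz_ineq2)
      also have "\<dots> \<le> (\<Sum>i\<in>UNIV. \<bar>v x $ i\<bar>) * (4 / \<rho>)"
        by (intro mult_mono norm_le_l1_cart \<theta>(4)) (auto intro: sum_nonneg)
      also have "(\<Sum>i\<in>UNIV. \<bar>v x $ i\<bar>) = W z x" using True dz by (simp add: W_def)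
      finally show ?thesis by (simp add: mult.commute)
    qed
    ultimately have "\<bar>\<phi> x\<bar> * \<bar>v x \<bullet> grad \<theta> x\<bar> \<le> (\<bar>\<phi> z\<bar> + e) * (4 / \<rho> * W z x)"
      using e by (intro mult_mono) auto
    then have "\<bar>F x\<bar> \<le> 4 / \<rho> * (\<bar>\<phi> z\<bar> + e) * W z x"
      using True by (simp add: F_def abs_mult mult_ac)
    also have "\<dots> \<le> (\<Sum>z\<in>Z. 4 / \<rho> * (\<bar>\<phi> z\<bar> + e) * W z x)"
      using Z(1) z(1) \<rho>(1) e W_nn by (intro member_le_sum) auto
    finally show ?thesis .
  next
    case False
    then have "F x = 0" by (auto simp: F_def)
    then show ?thesis using \<rho>(1) e W_nn by (auto intro!: sum_nonneg)
  qed
  \<comment> \<open>The share of \<open>z\<close> in the surface integral. The summand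
    \<open>2 * e\<close> comes from
    \<open>\<bar>\<phi> z\<bar> + e \<le> \<bar>\<phi> x\<bar> + 2 * e\<close> for \<open>x\<close>
    near \<open>z\<close>.\<close>
  define J where "J = (\<lambda>z. LINT x|\<sigma>. indicator (\<Gamma> \<inter> cball z \<rho>) x * (\<bar>\<phi> x\<bar> + 2 * e))"
  have ball_sets [measurable]: "\<Gamma> \<inter> cball z r \<in> sets \<sigma>" for z r
    by (auto simp: sets_surface_measure_iff borel_closed closed_Int)
  have ball_sub: "\<Gamma> \<inter> cball z r \<subseteq> \<Gamma> \<inter> cball 0 (norm z + r)" for z r
    using norm_triangle_sub by (auto simp: dist_norm norm_minus_commute) (smt (verit) norm_triangle_sub norm_minus_commute)
  have ball_fin: "emeasure \<sigma> (\<Gamma> \<inter> cball z r) < \<infinity>" for z r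
    using emeasure_mono[OF ball_sub Gamma_cball_sets] finite_cball by (rule le_less_trans)
  have ind_int: "integrable \<sigma> (indicator (\<Gamma> \<inter> cball z r) :: _ \<Rightarrow> real)" for z r
    using ball_fin[of z r] by (intro integrable_real_indicator) auto
  have \<phi>i: "integrable \<sigma> \<phi>" by (rule trace_test_integrable[OF \<phi>])
  have Jint: "integrable \<sigma> (\<lambda>x. indicator (\<Gamma> \<inter> cball z \<rho>) x * (\<bar>\<phi> x\<bar> + 2 * e))" for z
  proof (rule integrable_mult_bounded[OF ind_int, where c="C + 2 * e"])
    show "(\<lambda>x. \<bar>\<phi> x\<bar> + 2 * e) \<in> borel_measurable \<sigma>" using \<phi>i by auto
    show "\<bar>\<bar>\<phi> x\<bar> + 2 * e\<bar> \<le> C + 2 * e" for x using C(2)[of x] e by simp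
  qed
  have J_ge: "c * \<rho> ^ (?n - 1) * (\<bar>\<phi> z\<bar> + e) \<le> J z" if z: "z \<in> Z" for z
  proof -
    have "c * \<rho> ^ (?n - 1) * (\<bar>\<phi> z\<bar> + e) \<le> measure \<sigma> (\<Gamma> \<inter> cball z \<rho>) * (\<bar>\<phi> z\<bar> + e)"
      using surface_lower[OF ZG[OF z] \<rho>(1)] \<rho> e by (intro mult_right_mono) auto
    also have "\<dots> = (LINT x|\<sigma>. indicator (\<Gamma> \<inter> cball z \<rho>) x * (\<bar>\<phi> z\<bar> + e))"
      using ind_int[of z \<rho>] by (simp add: Int_absorb2)
    also have "\<dots> \<le> J z"
      unfolding J_def
    proof (rule integral_mono[OF _ Jint])
      show "integrable \<sigma> (\<lambda>x. indicator (\<Gamma> \<inter> cball z \<rho>) x * (\<bar>\<phi> z\<bar> + e))" using ind_int by auto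
      fix x
      show "indicator (\<Gamma> \<inter> cball z \<rho>) x * (\<bar>\<phi> z\<bar> + e) \<le> indicator (\<Gamma> \<inter> cball z \<rho>) x * (\<bar>\<phi> x\<bar> + 2 * e)"
        using osc[of z x] \<rho>(1) by (cases "x \<in> \<Gamma> \<inter> cball z \<rho>") auto
    qed
    finally show ?thesis .
  qed
  \<comment> \<open>The balls of radius \<open>\<rho>\<close> are disjoint, so at each point at most
    one summand is nonzero; as \<open>\<rho> \<le> 1\<close>, they all lie in the ball of radius
    \<open>B + 1\<close>.\<close>
  have J_sum: "(\<Sum>z\<in>Z. J z) \<le> (LINT x|\<sigma>. \<bar>\<phi> x\<bar>) + 2 * e * measure \<sigma> (\<Gamma> \<inter> cball 0 (B + 1))"
  proof -
    have "(\<Sum>z\<in>Z. J z) = (LINT x|\<sigma>. (\<Sum>z\<in>Z. indicator (\<Gamma> \<inter> cball z \<rho>) x * (\<bar>\<phi> x\<bar> + 2 * e)))"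
      unfolding J_def by (rule Bochner_Integration.integral_sum[symmetric]) (rule Jint)
    also have "\<dots> \<le> (LINT x|\<sigma>. \<bar>\<phi> x\<bar> + 2 * e * indicator (\<Gamma> \<inter> cball 0 (B + 1)) x)"
    proof (rule integral_mono)
      show "integrable \<sigma> (\<lambda>x. \<Sum>z\<in>Z. indicator (\<Gamma> \<inter> cball z \<rho>) x * (\<bar>\<phi> x\<bar> + 2 * e))"
        by (intro Bochner_Integration.integrable_sum Jint)
      show "integrable \<sigma> (\<lambda>x. \<bar>\<phi> x\<bar> + 2 * e * indicator (\<Gamma> \<inter> cball 0 (B + 1)) x)"
        using \<phi>i ind_int[of 0 "B + 1"] by auto
      fix x
      show "(\<Sum>z\<in>Z. indicator (\<Gamma> \<inter> cball z \<rho>) x * (\<bar>\<phi> x\<bar> + 2 * e)) \<le> \<bar>\<phi> x\<bar> + 2 * e * indicator (\<Gamma> \<inter> cball 0 (B + 1)) x"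
      proof (cases "\<exists>z\<in>Z. x \<in> \<Gamma> \<inter> cball z \<rho>")
        case True
        then obtain z where z: "z \<in> Z" "x \<in> \<Gamma> \<inter> cball z \<rho>" by blast
        have "x \<notin> \<Gamma> \<inter> cball z' \<rho>" if "z' \<in> Z - {z}" for z'
          using Z(4) that z by (auto simp: pairwise_def disjnt_iff)
        then have "(\<Sum>z\<in>Z. indicator (\<Gamma> \<inter> cball z \<rho>) x * (\<bar>\<phi> x\<bar> + 2 * e)) = indicator (\<Gamma> \<inter> cball z \<rho>) x * (\<bar>\<phi> x\<bar> + 2 * e)"
          using Z(1) z(1) by (subst sum.remove[of Z z]) (auto intro!: sum.neutral)
        moreover have "norm x \<le> B + 1"
          using z S(4)[of z] Z(2) \<rho>(3) norm_triangle_sub[of x z] by (auto simp: dist_norm norm_minus_commute)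
        ultimately show ?thesis using z(2) by simp
      next
        case False
        then have "(\<Sum>z\<in>Z. indicator (\<Gamma> \<inter> cball z \<rho>) x * (\<bar>\<phi> x\<bar> + 2 * e)) = 0"
          by (intro sum.neutral) auto
        then show ?thesis using e by simp
      qed
    qed
    also have "\<dots> = (LINT x|\<sigma>. \<bar>\<phi> x\<bar>) + 2 * e * measure \<sigma> (\<Gamma> \<inter> cball 0 (B + 1))"
      using \<phi>i ind_int[of 0 "B + 1"] by (simp add: Int_absorb2)
    finally show ?thesis .
  qed
  obtain m where m: "?n = Suc m" by (metis not0_implies_Suc zero_less_card_finite less_numeral_extra(3))
  have "\<bar>LINT x|lebesgue. F x\<bar> \<le> (LINT x|lebesgue. \<bar>F x\<bar>)" by (rule integral_abs_bound)
  also have "\<dots> \<le> (LINT x|lebesgue. (\<Sum>z\<in>Z. 4 / \<rho> * (\<bar>\<phi> z\<bar> + e) * W z x))"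
    using Fint Wi F_le by (intro integral_mono Bochner_Integration.integrable_sum) auto
  also have "\<dots> = (\<Sum>z\<in>Z. 4 / \<rho> * (\<bar>\<phi> z\<bar> + e) * (LINT x|lebesgue. W z x))"
    using Wi by (subst Bochner_Integration.integral_sum) auto
  also have "\<dots> \<le> (\<Sum>z\<in>Z. 4 / \<rho> * (\<bar>\<phi> z\<bar> + e) * ((6 * \<rho>) ^ ?n * ?b))"
    using \<rho>(1) e by (intro sum_mono mult_left_mono W_le) auto
  also have "\<dots> = (\<Sum>z\<in>Z. 4 * 6 ^ ?n * ?b / c * (c * \<rho> ^ (?n - 1) * (\<bar>\<phi> z\<bar> + e)))"
  proof (rule sum.cong[OF refl])
    fix z
    show "4 / \<rho> * (\<bar>\<phi> z\<bar> + e) * ((6 * \<rho>) ^ ?n * ?b) = 4 * 6 ^ ?n * ?b / c * (c * \<rho> ^ (?n - 1) * (\<bar>\<phi> z\<bar> + e))"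
      using \<rho>(1) c_pos by (simp add: m power_mult_distrib)
  qed
  also have "\<dots> \<le> (\<Sum>z\<in>Z. 4 * 6 ^ ?n * ?b / c * J z)"
    using bnn' c_pos by (intro sum_mono mult_left_mono J_ge) auto
  also have "\<dots> = 4 * 6 ^ ?n * ?b / c * (\<Sum>z\<in>Z. J z)" by (simp add: sum_distrib_left)
  also have "\<dots> \<le> 4 * 6 ^ ?n * ?b / c * ((LINT x|\<sigma>. \<bar>\<phi> x\<bar>) + 2 * e * measure \<sigma> (\<Gamma> \<inter> cball 0 (B + 1)))"
    using bnn' c_pos J_sum by (intro mult_left_mono) auto
  finally show ?thesis unfolding F_def .
qed

end

lemma integral_mult_vanishing_tendsto_0:
  fixes f :: "'a \<Rightarrow> real"
  assumes f: "integrable M f" and \<theta>: "\<And>k. \<theta> k \<in> borel_measurable M" "\<And>k x. \<bar>\<theta> k x\<bar> \<le> 1"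
    and lim: "\<And>x. f x \<noteq> 0 \<Longrightarrow> \<forall>\<^sub>F k in sequentially. \<theta> k x = 0"
  shows "(\<lambda>k. LINT x|M. f x * \<theta> k x) \<longlonglongrightarrow> 0"
proof -
  have "(\<lambda>k. LINT x|M. f x * \<theta> k x) \<longlonglongrightarrow> (LINT x|M. 0)"
  proof (rule integral_dominated_convergence[where w="\<lambda>x. \<bar>f x\<bar>"])
    show "AE x in M. (\<lambda>k. f x * \<theta> k x) \<longlonglongrightarrow> 0"
    proof (rule AE_I2)
      fix x
      show "(\<lambda>k. f x * \<theta> k x) \<longlonglongrightarrow> 0"
      proof (cases "f x = 0")
        case False
        show ?thesis by (rule tendsto_eventually) (use lim[OF False] in \<open>auto elim!: eventually_mono\<close>)
      qed simp
    qed
    show "AE x in M. norm (f x * \<theta> k x) \<le> \<bar>f x\<bar>" for k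
      using \<theta>(2)[of k] by (intro AE_I2) (simp add: abs_mult mult_left_le)
  qed (use f \<theta>(1) in auto)
  then show ?thesis by simp
qed

context boundary_trace
begin

lemma trace_functional_bound:
  assumes \<phi>: "trace_test \<Omega> \<delta> \<phi>"
  shows "\<bar>trace_functional \<phi>\<bar> \<le> 4 * 6 ^ CARD('n) * (\<Sum>i\<in>UNIV. b i) / c * (LINT x|\<sigma>. \<bar>\<phi> x\<bar>)"
proof -
  define K where "K = 4 * 6 ^ CARD('n) * (\<Sum>i\<in>UNIV. b i) / c"
  define S where "S = \<Gamma> \<inter> fun_support \<phi>"
  have c\<phi>: "continuous_on UNIV \<phi>" by (rule trace_test_continuous[OF \<phi>])
  have b\<phi>: "bounded {x. \<phi> x \<noteq> 0}" using trace_test_supportD(2)[OF \<phi>] by (simp add: compact_fun_support_iff)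
  have cS: "compact S" unfolding S_def by (intro closed_Int_compact trace_test_supportD(2)[OF \<phi>]) simp
  show ?thesis
  proof (cases "S = {}")
    case True
    have "trace_functional \<phi> = 0" by (rule trace_functional_eq_0_off_boundary[OF \<phi>]) (use True in \<open>auto simp: S_def\<close>)
    moreover have "(LINT x|\<sigma>. \<bar>\<phi> x\<bar>) = (LINT x|\<sigma>. 0)"
    proof (rule Bochner_Integration.integral_cong[OF refl])
      fix x assume "x \<in> space \<sigma>"
      then have "x \<notin> fun_support \<phi>" using True by (auto simp: S_def)
      then show "\<bar>\<phi> x\<bar> = 0" using nonzero_in_fun_support[of \<phi> x] by auto
    qed
    ultimately show ?thesis by simp
  next
    case False
    obtain B where B: "\<And>z. z \<in> S \<Longrightarrow> norm z \<le> B" using compact_imp_bounded[OF cS] by (auto simp: bounded_iff)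
    have SG: "S \<subseteq> \<Gamma>" by (auto simp: S_def)
    have claim: "\<bar>trace_functional \<phi>\<bar> \<le> K * ((LINT x|\<sigma>. \<bar>\<phi> x\<bar>) + 2 * e * measure \<sigma> (\<Gamma> \<inter> cball 0 (B + 1)))" if e: "0 < e" for e
    proof -
      obtain d where d: "0 < d" "\<And>x y. dist y x \<le> d \<Longrightarrow> \<bar>\<phi> y - \<phi> x\<bar> \<le> e"
        using uniformly_continuous_compact_support[OF c\<phi> b\<phi> e] by blast
      define \<rho>0 where "\<rho>0 = Min {d / 6, \<rho>\<^sub>1 / 6, 1}"
      have \<rho>0: "0 < \<rho>0" "6 * \<rho>0 \<le> d" "6 * \<rho>0 \<le> \<rho>\<^sub>1" "\<rho>0 \<le> 1" using d(1) \<rho>\<^sub>1_pos by (auto simp: \<rho>0_def)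
      define \<rho> where "\<rho> = (\<lambda>k. \<rho>0 / real (Suc k))"
      have \<rho>: "0 < \<rho> k" "\<rho> k \<le> \<rho>0" for k using \<rho>0 by (auto simp: \<rho>_def field_simps)
      have \<rho>lim: "\<rho> \<longlonglongrightarrow> 0" unfolding \<rho>_def by (rule LIMSEQ_Suc[OF lim_const_over_n])
      have "\<exists>\<theta>. (\<forall>j. Ck j \<theta>) \<and> compact (fun_support \<theta>) \<and> (\<forall>x. 0 \<le> \<theta> x) \<and> (\<forall>x. \<theta> x \<le> 1) \<and>
        (\<forall>x. infdist x S \<le> \<rho> k / 4 \<longrightarrow> \<theta> x = 1) \<and> (\<forall>x. \<rho> k \<le> infdist x S \<longrightarrow> \<theta> x = 0) \<and>
        (\<forall>x. norm (grad \<theta> x) \<le> 4 / \<rho> k)" for k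
        by (rule cutoff_exists[OF cS False \<rho>(1)[of k]]) blast
      then obtain \<theta> where \<theta>: "\<And>k j. Ck j (\<theta> k)" "\<And>k. compact (fun_support (\<theta> k))" "\<And>k x. 0 \<le> \<theta> k x" "\<And>k x. \<theta> k x \<le> 1"
        "\<And>k x. infdist x S \<le> \<rho> k / 4 \<Longrightarrow> \<theta> k x = 1" "\<And>k x. \<rho> k \<le> infdist x S \<Longrightarrow> \<theta> k x = 0"
        "\<And>k x. norm (grad (\<theta> k) x) \<le> 4 / \<rho> k"
        by metis
      have c\<theta>: "continuous_on UNIV (\<theta> k)" for k by (rule Ck_continuous[OF \<theta>(1)])
      have \<theta>abs: "\<bar>\<theta> k x\<bar> \<le> 1" for k x using \<theta>(3,4)[of k x] by simp
      have tt: "trace_test \<Omega> \<delta> (\<lambda>x. \<phi> x * \<theta> k x)" for k by (rule trace_test_mult[OF \<phi> \<theta>(1)])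
      \<comment> \<open>The three terms of the functional of \<open>\<phi> * \<theta> k\<close>
        after the product rule. Only \<open>Ek\<close>, in which the cutoff is differentiated, need
        not vanish in the limit.\<close>
      define Ak where "Ak = (\<lambda>k. LINT x|lebesgue. indicator \<Omega> x * (w x * (\<phi> x * \<theta> k x)))"
      define Bk where "Bk = (\<lambda>k. LINT x|lebesgue. indicator \<Omega> x * (v x \<bullet> (\<theta> k x *\<^sub>R grad \<phi> x)))"
      define Ek where "Ek = (\<lambda>k. LINT x|lebesgue. indicator \<Omega> x * (v x \<bullet> (\<phi> x *\<^sub>R grad (\<theta> k) x)))"
      obtain C where C: "0 \<le> C" "\<And>x. \<bar>\<phi> x\<bar> \<le> C" using continuous_compact_support_bounded[OF c\<phi> b\<phi>] by blast
      have iA: "integrable lebesgue (\<lambda>x. indicator \<Omega> x * (w x * (\<phi> x * \<theta> k x)))" for k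
        by (rule trace_test_w_integrable[OF \<phi> c\<theta> \<theta>abs])
      have iB: "integrable lebesgue (\<lambda>x. indicator \<Omega> x * (v x \<bullet> (\<theta> k x *\<^sub>R grad \<phi> x)))" for k
        by (rule v_grad_mult_integrable[OF trace_test_supportD(1,2)[OF \<phi>] c\<theta> \<theta>abs])
      have iE: "integrable lebesgue (\<lambda>x. indicator \<Omega> x * (v x \<bullet> (\<phi> x *\<^sub>R grad (\<theta> k) x)))" for k
        by (rule v_grad_mult_integrable[OF \<theta>(1,2) c\<phi> C(2)])
      \<comment> \<open>The difference \<open>\<phi> - \<phi> * \<theta> k\<close> vanishes near
        \<open>S\<close>, and the other points of \<open>\<Gamma>\<close> are outside the support of
        \<open>\<phi>\<close>. So its support misses \<open>\<Gamma>\<close> and the functional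
        annihilates it.\<close>
      have T_eq: "trace_functional \<phi> = Ak k + Bk k + Ek k" for k
      proof -
        let ?r = "\<lambda>x. (-1) * (\<phi> x * \<theta> k x)"
        have tr: "trace_test \<Omega> \<delta> ?r" by (rule trace_test_scale[OF tt])
        have "trace_functional (\<lambda>x. \<phi> x + ?r x) = 0"
        proof (rule trace_functional_eq_0_off_boundary[OF trace_test_add[OF \<phi> tr]])
          have "x \<notin> fun_support (\<lambda>x. \<phi> x + ?r x)" if x: "x \<in> \<Gamma>" for x
          proof (cases "x \<in> S")
            case True
            define U where "U = {y. infdist y S < \<rho> k / 4}"
            have "open U" unfolding U_def by (intro open_Collect_less continuous_intros)
            moreover have "U \<inter> {x. \<phi> x + ?r x \<noteq> 0} = {}" using \<theta>(5)[of _ k] by (auto simp: U_def)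
            ultimately have "U \<inter> closure {x. \<phi> x + ?r x \<noteq> 0} = {}" by (simp only: open_Int_closure_eq_empty)
            moreover have "x \<in> U" using True \<rho>(1)[of k] by (simp add: U_def)
            ultimately show ?thesis by (auto simp: fun_support_def)
          next
            case False
            have "fun_support (\<lambda>x. \<phi> x + ?r x) \<subseteq> fun_support \<phi>" by (rule fun_support_mono) auto
            then show ?thesis using False x by (auto simp: S_def)
          qed
          then show "fun_support (\<lambda>x. \<phi> x + ?r x) \<inter> frontier \<Omega> = {}" by blast
        qed
        then have "trace_functional \<phi> = trace_functional (\<lambda>x. \<phi> x * \<theta> k x)" using trace_functional_add[OF \<phi> tr] trace_functional_scale[OF tt, of "-1"] by simp
        also have "\<dots> = Ak k + (Bk k + Ek k)"
        proof -
          have gr: "grad (\<lambda>x. \<phi> x * \<theta> k x) x = \<phi> x *\<^sub>R grad (\<theta> k) x + \<theta> k x *\<^sub>R grad \<phi> x" for x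
            by (intro GDERIV_imp_grad GDERIV_mult trace_test_GDERIV[OF \<phi>] Ck_GDERIV[OF \<theta>(1)[of "Suc 0"]])
          have "(LINT x:\<Omega>|lebesgue. v x \<bullet> grad (\<lambda>x. \<phi> x * \<theta> k x) x) =
             (LINT x|lebesgue. indicator \<Omega> x * (v x \<bullet> (\<theta> k x *\<^sub>R grad \<phi> x)) + indicator \<Omega> x * (v x \<bullet> (\<phi> x *\<^sub>R grad (\<theta> k) x)))"
            unfolding set_lebesgue_integral_def gr by (simp add: inner_add_right distrib_left add.commute)
          also have "\<dots> = Bk k + Ek k" unfolding Bk_def Ek_def by (rule Bochner_Integration.integral_add[OF iB iE])
          finally show ?thesis by (simp add: trace_functional_def Ak_def set_lebesgue_integral_def)
        qed
        finally show ?thesis by simp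
      qed
      \<comment> \<open>The open set \<open>\<Omega>\<close> is disjoint from \<open>S\<close>, so
        each of its points is eventually outside the shrinking neighbourhoods of
        \<open>S\<close>.\<close>
      have ptw: "\<forall>\<^sub>F k in sequentially. \<theta> k x = 0" if "indicator \<Omega> x * t \<noteq> 0" for x and t :: real
      proof -
        have "x \<notin> S" using that open_domain by (auto simp: S_def frontier_def interior_open indicator_def split: if_splits)
        then have "0 < infdist x S" using cS False by (simp add: infdist_pos_not_in_closed compact_imp_closed)
        from order_tendstoD(2)[OF \<rho>lim this] show ?thesis
          by eventually_elim (use \<theta>(6) in auto)
      qed
      have \<theta>m: "\<theta> k \<in> borel_measurable lebesgue" for k by (rule lebesgue_borel_measurable_continuous[OF c\<theta>])
      have A0: "Ak \<longlonglongrightarrow> 0"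
      proof -
        have "integrable lebesgue (\<lambda>x. indicator \<Omega> x * (w x * (\<phi> x * 1)))"
          by (rule trace_test_w_integrable[OF \<phi>]) auto
        then have "(\<lambda>k. LINT x|lebesgue. (indicator \<Omega> x * (w x * (\<phi> x * 1))) * \<theta> k x) \<longlonglongrightarrow> 0"
          by (rule integral_mult_vanishing_tendsto_0[OF _ \<theta>m \<theta>abs ptw])
        then show ?thesis by (simp add: Ak_def mult_ac)
      qed
      have B0: "Bk \<longlonglongrightarrow> 0"
      proof -
        have "integrable lebesgue (\<lambda>x. indicator \<Omega> x * (v x \<bullet> (1 *\<^sub>R grad \<phi> x)))"
          by (rule v_grad_mult_integrable[OF trace_test_supportD(1,2)[OF \<phi>], of "\<lambda>_. 1" 1]) auto
        then have "(\<lambda>k. LINT x|lebesgue. (indicator \<Omega> x * (v x \<bullet> (1 *\<^sub>R grad \<phi> x))) * \<theta> k x) \<longlonglongrightarrow> 0"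
          by (rule integral_mult_vanishing_tendsto_0[OF _ \<theta>m \<theta>abs ptw])
        then show ?thesis by (simp add: Bk_def mult_ac)
      qed
      have E_le: "\<bar>Ek k\<bar> \<le> K * ((LINT x|\<sigma>. \<bar>\<phi> x\<bar>) + 2 * e * measure \<sigma> (\<Gamma> \<inter> cball 0 (B + 1)))" for k
        unfolding Ek_def K_def
      proof (rule boundary_term_bound[OF \<phi> e _ cS SG False B])
        show "\<bar>\<phi> y - \<phi> x\<bar> \<le> e" if "dist y x \<le> 6 * \<rho> k" for x y
          using that \<rho>(2)[of k] \<rho>0(2) by (intro d(2)) linarith
        show "6 * \<rho> k \<le> \<rho>\<^sub>1" "\<rho> k \<le> 1" using \<rho>(2)[of k] \<rho>0 by linarith+
      qed (use \<rho> \<theta> in auto)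
      have "\<bar>trace_functional \<phi>\<bar> - \<bar>Ak k\<bar> - \<bar>Bk k\<bar> \<le> K * ((LINT x|\<sigma>. \<bar>\<phi> x\<bar>) + 2 * e * measure \<sigma> (\<Gamma> \<inter> cball 0 (B + 1)))" for k
        using T_eq[of k] E_le[of k] by linarith
      moreover have "(\<lambda>k. \<bar>trace_functional \<phi>\<bar> - \<bar>Ak k\<bar> - \<bar>Bk k\<bar>) \<longlonglongrightarrow> \<bar>trace_functional \<phi>\<bar> - \<bar>0\<bar> - \<bar>0\<bar>"
        by (intro tendsto_intros A0 B0)
      ultimately have "\<bar>trace_functional \<phi>\<bar> - \<bar>0\<bar> - \<bar>0\<bar> \<le> K * ((LINT x|\<sigma>. \<bar>\<phi> x\<bar>) + 2 * e * measure \<sigma> (\<Gamma> \<inter> cball 0 (B + 1)))"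
        by (intro LIMSEQ_le_const2) auto
      then show ?thesis by simp
    qed
    \<comment> \<open>Now \<open>e\<close> tends to 0. The radius \<open>B + 1\<close> was fixed
      before \<open>e\<close>, so the measure in the error term stays the same.\<close>
    have "(\<lambda>k. K * ((LINT x|\<sigma>. \<bar>\<phi> x\<bar>) + 2 * inverse (real (Suc k)) * measure \<sigma> (\<Gamma> \<inter> cball 0 (B + 1))))
        \<longlonglongrightarrow> K * ((LINT x|\<sigma>. \<bar>\<phi> x\<bar>) + 2 * 0 * measure \<sigma> (\<Gamma> \<inter> cball 0 (B + 1)))"
      by (intro tendsto_intros LIMSEQ_inverse_real_of_nat)
    then have "\<bar>trace_functional \<phi>\<bar> \<le> K * ((LINT x|\<sigma>. \<bar>\<phi> x\<bar>) + 2 * 0 * measure \<sigma> (\<Gamma> \<inter> cball 0 (B + 1)))"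
      by (rule LIMSEQ_le_const) (use claim in auto)
    then show ?thesis by (simp add: K_def)
  qed
qed

lemma normal_trace_iff:
  "normal_trace \<Omega> \<delta> v w g \<longleftrightarrow> g \<in> borel_measurable \<sigma> \<and>
     (\<forall>K. compact K \<and> K \<subseteq> \<Gamma> \<longrightarrow> set_integrable \<sigma> K g) \<and>
     (\<forall>\<phi>. trace_test \<Omega> \<delta> \<phi> \<longrightarrow> (LINT x|\<sigma>. g x * \<phi> x) = trace_functional \<phi>)"
  unfolding normal_trace_def trace_test_def trace_functional_def by simp

text \<open>The functional is computed from values of \<open>\<phi>\<close> inside
  \<open>\<Omega>\<close>, but its bound contains values on \<open>\<Gamma>\<close> only. This makes
  it continuous in the \<open>L1\<close> norm of the surface measure, in which the test functions
  are dense.\<close>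

lemma normal_trace_exists:
  assumes "0 \<le> (\<Sum>i\<in>UNIV. b i)"
  shows "\<exists>g. normal_trace \<Omega> \<delta> v w g"
proof -
  interpret sigma_finite_measure \<sigma> by (rule sigma_finite_surface_measure)
  define K where "K = 4 * 6 ^ CARD('n) * (\<Sum>i\<in>UNIV. b i) / c"
  have K: "0 \<le> K" using assms c_pos by (simp add: K_def)
  obtain g where g: "g \<in> borel_measurable \<sigma>" "\<And>x. \<bar>g x\<bar> \<le> K"
    "\<And>\<phi>. \<phi> \<in> {\<phi>. trace_test \<Omega> \<delta> \<phi>} \<Longrightarrow> trace_functional \<phi> = (LINT x|\<sigma>. \<phi> x * g x)"
  proof (rule bounded_functional_dense_representation[OF K, of "{\<phi>. trace_test \<Omega> \<delta> \<phi>}" trace_functional])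
    show "\<exists>a\<in>{\<phi>. trace_test \<Omega> \<delta> \<phi>}. (LINT x|\<sigma>. \<bar>a x - f x\<bar>) < e" if "integrable \<sigma> f" "0 < e" for f e
      using trace_test_dense[OF that] by simp
    show "\<bar>trace_functional f\<bar> \<le> K * (LINT x|\<sigma>. \<bar>f x\<bar>)" if "f \<in> {\<phi>. trace_test \<Omega> \<delta> \<phi>}" for f
      using trace_functional_bound[of f] that by (simp add: K_def)
  qed (auto intro: trace_test_integrable trace_test_add trace_test_scale trace_functional_add trace_functional_scale)
  have "set_integrable \<sigma> A g" if A: "compact A" "A \<subseteq> \<Gamma>" for A
  proof -
    obtain R where R: "\<And>x. x \<in> A \<Longrightarrow> norm x \<le> R" using compact_imp_bounded[OF A(1)] by (auto simp: bounded_iff)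
    have [measurable]: "A \<in> sets \<sigma>" using A by (auto simp: sets_surface_measure_iff borel_compact)
    have "(\<lambda>x. indicator A x *\<^sub>R g x) \<in> borel_measurable \<sigma>" using g(1) by measurable
    then show ?thesis unfolding set_integrable_def
      by (rule integrable_bounded_support[where c=K and R=R])
         (use g(2) R K in \<open>auto simp: indicator_def split: if_splits\<close>)
  qed
  then show ?thesis using g by (auto simp: normal_trace_iff mult.commute)
qed

text \<open>Every trace satisfies the defining identity for all test functions, so the bound holds
  for each of them and not just for the function constructed by duality.\<close>

lemma normal_trace_AE_bound:
  assumes g: "normal_trace \<Omega> \<delta> v w g" and b: "0 \<le> (\<Sum>i\<in>UNIV. b i)"
  shows "AE x in \<sigma>. \<bar>g x\<bar> \<le> 4 * 6 ^ CARD('n) * (\<Sum>i\<in>UNIV. b i) / c"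
proof -
  define K where "K = 4 * 6 ^ CARD('n) * (\<Sum>i\<in>UNIV. b i) / c"
  have K: "0 \<le> K" using b c_pos by (simp add: K_def)
  have gm [measurable]: "g \<in> borel_measurable \<sigma>" and gi: "\<And>A. compact A \<Longrightarrow> A \<subseteq> \<Gamma> \<Longrightarrow> set_integrable \<sigma> A g"
    and gT: "\<And>\<phi>. trace_test \<Omega> \<delta> \<phi> \<Longrightarrow> (LINT x|\<sigma>. g x * \<phi> x) = trace_functional \<phi>"
    using g unfolding normal_trace_iff by auto
  have "AE x in \<sigma>. g x \<le> K"
  proof (rule AE_le_of_trace_test_bound[OF gm gi K])
    show "(LINT x|\<sigma>. g x * \<phi> x) \<le> K * (LINT x|\<sigma>. \<bar>\<phi> x\<bar>)" if "trace_test \<Omega> \<delta> \<phi>" for \<phi>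
      using gT[OF that] trace_functional_bound[OF that] by (simp add: K_def)
  qed
  moreover have "AE x in \<sigma>. - g x \<le> K"
  proof (rule AE_le_of_trace_test_bound[OF _ _ K])
    show "(LINT x|\<sigma>. - g x * \<phi> x) \<le> K * (LINT x|\<sigma>. \<bar>\<phi> x\<bar>)" if "trace_test \<Omega> \<delta> \<phi>" for \<phi>
      using gT[OF that] trace_functional_bound[OF that] by (simp add: K_def)
    show "set_integrable \<sigma> A (\<lambda>x. - g x)" if "compact A" "A \<subseteq> \<Gamma>" for A
      using gi[OF that] by (simp add: set_integrable_def)
  qed simp
  ultimately have "AE x in \<sigma>. \<bar>g x\<bar> \<le> K" by eventually_elim auto
  then show ?thesis by (simp add: K_def)
qed

end

theorem theorem25:
  fixes \<Omega> :: "(real ^ 'n) set" and \<beta> r\<^sub>0 :: real and \<mu> \<nu> \<delta> :: ennreal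
  assumes "CARD('n) \<ge> 2"
    and "0 < \<beta>" and "\<beta> < 1"
    and "uniformly_C1_Hoelder_domain \<beta> \<Omega>"
    and "0 < \<mu>" and "0 < \<nu>" and "0 < \<delta>"
    and "0 < r\<^sub>0"
  shows "\<exists>C > 0. \<forall>v w.
           v \<in> BMO_b_vec \<Omega> \<mu> \<nu> \<and>
           distributional_div (bdry_layer \<Omega> \<delta>) v w \<and>
           w \<in> Lp_ul CARD('n) r\<^sub>0 (bdry_layer \<Omega> \<delta>) \<longrightarrow>
             (\<exists>g. normal_trace \<Omega> \<delta> v w g) \<and>
             (\<forall>g. normal_trace \<Omega> \<delta> v w g \<longrightarrow>
                esssup (surface_measure \<Omega>) (\<lambda>x. ennreal \<bar>g x\<bar>) \<le>
                  ennreal C * (BMO_b_vec_norm \<Omega> \<mu> \<nu> v +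
                    Lp_ul_norm CARD('n) r\<^sub>0 (bdry_layer \<Omega> \<delta>) w))"
proof -
  let ?n = "CARD('n)"
  let ?\<sigma> = "surface_measure \<Omega>"
  have op: "open \<Omega>" using assms(4) by (simp add: uniformly_C1_Hoelder_domain_def)
  obtain L R where LR: "0 < L" "0 < R" and charts: "\<And>z. z \<in> frontier \<Omega> \<Longrightarrow> \<exists>e h. Lipschitz_graph_at L R (frontier \<Omega>) z e h"
    by (rule uniformly_C1_Hoelder_domain_Lipschitz[OF assms(4)]) blast
  have fin: "emeasure ?\<sigma> (frontier \<Omega> \<inter> cball 0 r) < \<infinity>" for r
  proof -
    have "emeasure (hausdorff_measure (?n - 1)) (frontier \<Omega> \<inter> closure (cball (0 :: real ^ 'n) r)) < \<infinity>"
      by (rule emeasure_hausdorff_bounded_finite[OF _ LR charts]) auto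
    then show ?thesis
      by (simp add: emeasure_surface_measure emeasure_hausdorff_measure borel_closed closed_Int)
  qed
  interpret bd: locally_finite_boundary \<Omega> \<delta> by unfold_locales (use fin assms(7) in auto)
  define c where "c = unit_ball_vol (real (?n - 1)) / (5 * 4 ^ ?n * (1 + L) ^ ?n)"
  have c: "0 < c" using LR by (auto simp: c_def intro!: divide_pos_pos mult_pos_pos)
  \<comment> \<open>The b-seminorm takes radii strictly below \<open>\<nu>\<close>, which may be
    infinite; a real number below it covers both cases.\<close>
  obtain \<nu>1 where \<nu>1: "0 < \<nu>1" "ennreal \<nu>1 < \<nu>" using ennreal_real_below[OF assms(6)] by blast
  define \<rho>1 where "\<rho>1 = min R \<nu>1"
  have \<rho>1: "0 < \<rho>1" "\<rho>1 \<le> R" "\<rho>1 \<le> \<nu>1" using LR \<nu>1 by (auto simp: \<rho>1_def)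
  have lower: "c * r ^ (?n - 1) \<le> measure ?\<sigma> (frontier \<Omega> \<inter> cball z r)"
    if z: "z \<in> frontier \<Omega>" and r: "0 < r" "r \<le> \<rho>1" for z r
  proof -
    obtain e h where "Lipschitz_graph_at L R (frontier \<Omega>) z e h" using charts[OF z] by blast
    then have "ennreal (c * r ^ (?n - 1)) \<le> hausdorff_outer (?n - 1) (frontier \<Omega> \<inter> cball z r)"
      unfolding c_def by (rule Lipschitz_graph_hausdorff_lower[OF _ LR(1) r(1) _ assms(1)]) (use r \<rho>1 in auto)
    also have "\<dots> = emeasure ?\<sigma> (frontier \<Omega> \<inter> cball z r)"
      by (simp add: emeasure_surface_measure borel_closed closed_Int)
    also have "\<dots> = ennreal (measure ?\<sigma> (frontier \<Omega> \<inter> cball z r))"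
    proof (rule emeasure_eq_ennreal_measure)
      have "frontier \<Omega> \<inter> cball z r \<subseteq> frontier \<Omega> \<inter> cball 0 (norm z + r)"
      proof
        fix x assume "x \<in> frontier \<Omega> \<inter> cball z r"
        then show "x \<in> frontier \<Omega> \<inter> cball 0 (norm z + r)"
          using norm_triangle_sub[of x z] by (auto simp: dist_norm norm_minus_commute)
      qed
      then have "emeasure ?\<sigma> (frontier \<Omega> \<inter> cball z r) \<le> emeasure ?\<sigma> (frontier \<Omega> \<inter> cball 0 (norm z + r))"
        by (rule emeasure_mono) (rule bd.Gamma_cball_sets)
      then show "emeasure ?\<sigma> (frontier \<Omega> \<inter> cball z r) \<noteq> top" using fin[of "norm z + r"] by (auto simp: top_unique)
    qed
    finally show ?thesis by simp
  qed
  \<comment> \<open>This depends on the dimension and on \<open>L\<close> only: the radius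
    \<open>\<rho>1\<close> has dropped out, because the estimate is taken in the limit of small
    scales.\<close>
  define C where "C = 4 * 6 ^ ?n / c"
  have C: "0 < C" using c by (simp add: C_def)
  show ?thesis
  proof (intro exI[of _ C] conjI C allI impI)
    fix v w
    assume vw: "v \<in> BMO_b_vec \<Omega> \<mu> \<nu> \<and> distributional_div (bdry_layer \<Omega> \<delta>) v w \<and>
      w \<in> Lp_ul ?n r\<^sub>0 (bdry_layer \<Omega> \<delta>)"
    define b where "b = (\<lambda>i. enn2real (b_seminorm \<Omega> \<nu> (\<lambda>x. v x $ i)))"
    have vL: "L1_loc \<Omega> (\<lambda>x. v x $ i)" and vb: "b_seminorm \<Omega> \<nu> (\<lambda>x. v x $ i) < \<infinity>" for i
      using vw by (auto simp: BMO_b_vec_def BMO_b_def BMO_b_norm_def)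
    have bnn: "0 \<le> (\<Sum>i\<in>UNIV. b i)" by (intro sum_nonneg) (simp add: b_def)
    interpret tr: boundary_trace \<Omega> \<delta> v w c \<rho>1 b
    proof
      show "set_integrable lebesgue (\<Omega> \<inter> cball 0 R) (\<lambda>x. v x $ i)" for i R
        by (rule b_seminorm_set_integrable[OF vL vb op assms(6)])
      show "set_integrable lebesgue (bdry_layer \<Omega> \<delta> \<inter> cball 0 R) w" for R
        using vw assms(8) open_bdry_layer[OF op] by (intro Lp_ul_set_integrable) auto
      show "(LINT y:\<Omega> \<inter> cball z r|lebesgue. \<bar>v y $ i\<bar>) \<le> r ^ ?n * b i"
        if "z \<in> frontier \<Omega>" "0 < r" "r \<le> \<rho>1" for z r i
      proof -
        have "ennreal r < \<nu>" using that \<rho>1 \<nu>1(2) by (meson ennreal_leI le_less_trans order_trans)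
        then show ?thesis unfolding b_def using b_seminorm_set_integrable_cball(2)[OF vL vb op that(1,2)] by blast
      qed
    qed (use vw op c \<rho>1 lower in auto)
    show "\<exists>g. normal_trace \<Omega> \<delta> v w g" by (rule tr.normal_trace_exists[OF bnn])
    show "esssup ?\<sigma> (\<lambda>x. ennreal \<bar>g x\<bar>) \<le> ennreal C * (BMO_b_vec_norm \<Omega> \<mu> \<nu> v +
        Lp_ul_norm ?n r\<^sub>0 (bdry_layer \<Omega> \<delta>) w)" if g: "normal_trace \<Omega> \<delta> v w g" for g
    proof -
      have [measurable]: "g \<in> borel_measurable ?\<sigma>" using g by (simp add: normal_trace_def)
      have "AE x in ?\<sigma>. \<bar>g x\<bar> \<le> C * (\<Sum>i\<in>UNIV. b i)"
        using tr.normal_trace_AE_bound[OF g bnn] by (simp add: C_def)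
      then have "AE x in ?\<sigma>. ennreal \<bar>g x\<bar> \<le> ennreal (C * (\<Sum>i\<in>UNIV. b i))"
        by eventually_elim (rule ennreal_leI)
      then have "esssup ?\<sigma> (\<lambda>x. ennreal \<bar>g x\<bar>) \<le> ennreal (C * (\<Sum>i\<in>UNIV. b i))"
        by (intro esssup_I) measurable
      also have "\<dots> = ennreal C * (\<Sum>i\<in>UNIV. ennreal (b i))"
        using C by (subst ennreal_mult'') (auto simp: b_def intro!: sum_nonneg)
      also have "(\<Sum>i\<in>UNIV. ennreal (b i)) = (\<Sum>i\<in>UNIV. b_seminorm \<Omega> \<nu> (\<lambda>x. v x $ i))"
        using vb by (intro sum.cong) (auto simp: b_def less_top)
      \<comment> \<open>Each b-seminorm is a summand of the norm of its component, and all summands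
        are nonnegative.\<close>
      also have "\<dots> \<le> BMO_b_vec_norm \<Omega> \<mu> \<nu> v"
        unfolding BMO_b_vec_norm_def BMO_b_norm_def by (intro sum_mono) simp
      also have "\<dots> \<le> BMO_b_vec_norm \<Omega> \<mu> \<nu> v + Lp_ul_norm ?n r\<^sub>0 (bdry_layer \<Omega> \<delta>) w" by simp
      finally show ?thesis by (simp add: mult_left_mono)
    qed
  qed
qed

end
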